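(* Let $d\in\mathbb N$. (i) Let $(S^{(n)})_{n=0}^\infty$ be a Sheffer sequence on $\mathbb C^d$ with generating function $$\sum_{n=0}^\infty\frac{1}{n!}\langle S^{(n)}(\omega),\xi^{\otimes n}\rangle=\frac{\exp[\langle\omega,A(\xi)\rangle]}{\rho(A(\xi))}.$$ Assume that there exists an open neighborhood $U$ of zero in $\mathbb C^d$ such that the functions $A:U\to\mathbb C^d$ and $\rho:U\to\mathbb C$ are holomorphic. Then, for each $\alpha\in[0,1]$, the corresponding Sheffer operator $\mathfrak S:\mathcal P(\mathbb C^d)\to\mathcal P(\mathbb C^d)$ extends by continuity to a linear self-homeomorphism of $\mathcal E^{\alpha}_{\mathrm{min}}(\mathbb C^d)$. (ii) Let $(S^{(n)})_{n=0}^\infty$ be an Appell sequence on $\mathbb C^d$ with generating function $$\sum_{n=0}^\infty\frac{1}{n!}\langle S^{(n)}(\omega),\xi^{\otimes n}\rangle=\frac{\exp[\langle\omega,\xi\rangle]}{\rho(\xi)},\qquad \rho(\xi)=\sum_{n=0}^\infty\langle\rho^{(n)},\xi^{\otimes n}\rangle,$$ and let $\theta^{(n)}\in(\mathbb C^d)^{\odot n}$ be given by $\frac1{\rho(\xi)}=\sum_{n=0}^\infty\langle\theta^{(n)},\xi^{\otimes n}\rangle$. Assume that there exist $\beta\in(1,\infty)$ and a constant $C\ge1$ such that $$\|\theta^{(n)}\|\le C^{n}(n!)^{\frac1\beta-1},\qquad \|\rho^{(n)}\|\le C^{n}(n!)^{\frac1\beta-1},\qquad n\in\mathbb N.$$ Then,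 for each $\alpha\in[0,\beta]$, the corresponding Sheffer operator $\mathfrak S$ extends by continuity to a linear self-homeomorphism of $\mathcal E^{\alpha}_{\mathrm{min}}(\mathbb C^d)$.
   Context: $\mathbb N_0=\{0,1,2,\dots\}$. $\langle\cdot,\cdot\rangle$ is the standard bilinear pairing $\langle\omega,\xi\rangle=\sum_{i=1}^d\omega_i\xi_i$ on $\mathbb C^d$ and the induced bilinear pairing on the symmetric tensor powers $(\mathbb C^d)^{\odot n}$ ($(\mathbb C^d)^{\odot0}=\mathbb C$, $\omega^{\otimes0}=1$). $\|\cdot\|$ is the norm on $\mathbb C^d$ and the induced Hilbert norm on $(\mathbb C^d)^{\odot n}$. $\mathcal P(\mathbb C^d)$ is the space of polynomials $p(\omega)=\sum_{k=0}^n\langle\omega^{\otimes k},\varphi^{(k)}\rangle$ with $\varphi^{(k)}\in(\mathbb C^d)^{\odot k}$, $n\in\mathbb N_0$. A sequence of monic polynomials on $\mathbb C^d$ is a sequence of maps $S^{(n)}:\mathbb C^d\to(\mathbb C^d)^{\odot n}$, $n\in\mathbb N_0$, of the form $S^{(n)}(\omega)=\sum_{k=0}^nU_{n,k}\omega^{\otimes k}$ with linear operators $U_{n,k}:(\mathbb C^d)^{\odot k}\to(\mathbb C^d)^{\odot n}$ and $U_{n,n}=\mathbf 1$ (identity). It is a Sheffer sequence on $\mathbb C^d$ if its generating function has the form displayed in (i), where $A(\xi)=\sum_{k=1}^\infty A_k\xi^{\otimes k}$ with linear $A_k:(\mathbb C^d)^{\odot k}\to\mathbb C^d$, $A_1=\mathbf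 1$, and $\rho(\xi)=\sum_{n=0}^\infty\langle\rho^{(n)},\xi^{\otimes n}\rangle$ with $\rho^{(n)}\in(\mathbb C^d)^{\odot n}$, $\rho^{(0)}=1$ are formal power series. It is an Appell sequence if moreover $A(\xi)=\xi$. Identities between generating functions are identities of formal power series in $\xi$. The corresponding Sheffer operator is the linear bijection of $\mathcal P(\mathbb C^d)$ given by $\mathfrak S\langle\omega^{\otimes n},\varphi^{(n)}\rangle=\langle S^{(n)}(\omega),\varphi^{(n)}\rangle$, $\varphi^{(n)}\in(\mathbb C^d)^{\odot n}$, $n\in\mathbb N_0$. For $\alpha>0$, $\mathcal E^\alpha_{\mathrm{min}}(\mathbb C^d)$ is the space of entire functions $f:\mathbb C^d\to\mathbb C$ such that $\sup_{\omega\in\mathbb C^d}|f(\omega)|\exp(-2^{-l}\|\omega\|^\alpha)<\infty$ for all $l\in\mathbb N_0$, with the topology generated by these norms; $\mathcal E^0_{\mathrm{min}}(\mathbb C^d):=\operatorname{proj\,lim}_{\alpha>0}\mathcal E^\alpha_{\mathrm{min}}(\mathbb C^d)$ (intersection with projective limit topology). *)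

theory Defs
  imports
    "HOL-Analysis.Analysis"
    "HOL-Library.Multiset"
    "HOL-Computational_Algebra.Primes"
    "HOL-Computational_Algebra.Polynomial"
begin

section \<open>Symmetric tensors\<close>

text \<open>
  The space \<open>\<complex>\<^sup>d\<close> is \<open>complex ^ 'd\<close> with \<open>'d\<close> a finite type.  A tensor of order \<open>n\<close> over it is
  given by its coordinates in the standard basis \<open>e\<^bsub>l\<^esub> = e\<^bsub>l!0\<^esub> \<otimes> \<dots> \<otimes> e\<^bsub>l!(n-1)\<^esub>\<close>, i.e. by a
  function on the index tuples \<open>l\<close> of length \<open>n\<close>, extended by 0 to lists of other lengths.
  It is symmetric iff its coordinates are invariant under permutations of the tuple.
\<close>

type_synonym 'd tensor = "'d list \<Rightarrow> complex"

definition sym_tensors :: "nat \<Rightarrow> ('d::finite) tensor set" where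
  "sym_tensors n = {\<phi>. (\<forall>l. length l \<noteq> n \<longrightarrow> \<phi> l = 0) \<and>
                       (\<forall>l l'. mset l = mset l' \<longrightarrow> \<phi> l = \<phi> l')}"

definition tensor_power :: "nat \<Rightarrow> complex ^ ('d::finite) \<Rightarrow> 'd tensor" where
  "tensor_power n \<omega> = (\<lambda>l. if length l = n then \<Prod>i\<leftarrow>l. \<omega> $ i else 0)"

definition tpair :: "nat \<Rightarrow> ('d::finite) tensor \<Rightarrow> 'd tensor \<Rightarrow> complex" where
  "tpair n \<phi> \<psi> = (\<Sum>l | length l = n. \<phi> l * \<psi> l)"

definition tnorm :: "nat \<Rightarrow> ('d::finite) tensor \<Rightarrow> real" where
  "tnorm n \<phi> = sqrt (\<Sum>l | length l = n. (cmod (\<phi> l))\<^sup>2)"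

definition linear_op :: "nat \<Rightarrow> nat \<Rightarrow> (('d::finite) tensor \<Rightarrow> 'd tensor) \<Rightarrow> bool" where
  "linear_op k n U \<longleftrightarrow> U ` sym_tensors k \<subseteq> sym_tensors n \<and>
     (\<forall>c. \<forall>\<phi>\<in>sym_tensors k. \<forall>\<psi>\<in>sym_tensors k.
        U (\<lambda>l. c * \<phi> l + \<psi> l) = (\<lambda>l. c * U \<phi> l + U \<psi> l))"

definition linear_vec :: "nat \<Rightarrow> (('d::finite) tensor \<Rightarrow> complex ^ 'd) \<Rightarrow> bool" where
  "linear_vec k L \<longleftrightarrow>
     (\<forall>c. \<forall>\<phi>\<in>sym_tensors k. \<forall>\<psi>\<in>sym_tensors k. L (\<lambda>l. c * \<phi> l + \<psi> l) = c *s L \<phi> + L \<psi>)"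

text \<open>The canonical identification of tensors of order 1 with vectors.\<close>

definition vec_of_tensor :: "('d::finite) tensor \<Rightarrow> complex ^ 'd" where
  "vec_of_tensor \<phi> = (\<chi> i. \<phi> [i])"


section \<open>Formal power series in \<open>\<xi> \<in> \<complex>\<^sup>d\<close>\<close>

text \<open>
  The monomial \<open>\<Prod>\<^sub>i \<xi>\<^sub>i\<^bsup>m\<^sub>i\<^esup>\<close> is encoded by the multiset in which each \<open>i\<close> has multiplicity \<open>m\<^sub>i\<close>.
\<close>

typedef 'd mps = "UNIV :: ('d multiset \<Rightarrow> complex) set"
  morphisms mcoeff Abs_mps ..

lemma mps_eqI: "(\<And>m. mcoeff F m = mcoeff G m) \<Longrightarrow> F = G"
  by (simp add: mcoeff_inject[symmetric] fun_eq_iff)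

lemma mcoeff_Abs [simp]: "mcoeff (Abs_mps f) = f"
  by (simp add: Abs_mps_inverse)

lemma finite_mset_antidiagonal [simp]: "finite {(a, b). a + b = (m :: 'a multiset)}"
proof -
  have fin: "finite {a. a \<subseteq># m}"
  proof (rule finite_subset)
    show "{a. a \<subseteq># m} \<subseteq> mset ` {l. set l \<subseteq> set_mset m \<and> length l \<le> size m}"
    proof
      fix a assume "a \<in> {a. a \<subseteq># m}"
      moreover obtain l where "a = mset l" by (metis ex_mset)
      ultimately show "a \<in> mset ` {l. set l \<subseteq> set_mset m \<and> length l \<le> size m}"
        using set_mset_mono size_mset_mono by fastforce
    qed
    show "finite (mset ` {l. set l \<subseteq> set_mset m \<and> length l \<le> size m})"
      by (intro finite_imageI finite_lists_length_le) simp
  qed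
  show ?thesis
    by (rule finite_subset[OF _ finite_cartesian_product[OF fin fin]]) auto
qed

instantiation mps :: (type) comm_ring_1
begin

definition "0 = Abs_mps (\<lambda>_. 0)"
definition "1 = Abs_mps (\<lambda>m. if m = {#} then 1 else 0)"
definition "F + G = Abs_mps (\<lambda>m. mcoeff F m + mcoeff G m)"
definition "- F = Abs_mps (\<lambda>m. - mcoeff F m)"
definition "F - G = Abs_mps (\<lambda>m. mcoeff F m - mcoeff G m)"
definition "F * G = Abs_mps (\<lambda>m. \<Sum>(a, b) | a + b = m. mcoeff F a * mcoeff G b)"

instance
proof
  fix F G H :: "'a mps"
  show "F * G * H = F * (G * H)"
  proof (rule mps_eqI)
    fix m
    let ?f = "\<lambda>a b c. mcoeff F a * mcoeff G b * mcoeff H c"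
    have "mcoeff (F * G * H) m =
        (\<Sum>x\<in>{(a, b). a + b = m}. \<Sum>y\<in>{(a, b). a + b = fst x}. ?f (fst y) (snd y) (snd x))"
      by (simp add: times_mps_def case_prod_beta sum_distrib_right)
    also have "\<dots> = (\<Sum>(x, y)\<in>Sigma {(a, b). a + b = m} (\<lambda>x. {(a, b). a + b = fst x}).
        ?f (fst y) (snd y) (snd x))"
      by (rule sum.Sigma) auto
    also have "\<dots> = (\<Sum>(x, y)\<in>Sigma {(a, b). a + b = m} (\<lambda>x. {(a, b). a + b = snd x}).
        ?f (fst x) (fst y) (snd y))"
      by (rule sum.reindex_bij_witness[
            of _ "\<lambda>((a, _), (b, c)). ((a + b, c), (a, b))" "\<lambda>((_, c), (a, b)). ((a, b + c), (b, c))"])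
         (auto simp: algebra_simps)
    also have "\<dots> = (\<Sum>x\<in>{(a, b). a + b = m}. \<Sum>y\<in>{(a, b). a + b = snd x}. ?f (fst x) (fst y) (snd y))"
      by (rule sum.Sigma[symmetric]) auto
    also have "\<dots> = mcoeff (F * (G * H)) m"
      by (simp add: times_mps_def case_prod_beta sum_distrib_left mult.assoc)
    finally show "mcoeff (F * G * H) m = mcoeff (F * (G * H)) m" .
  qed
  show "F * G = G * F"
    unfolding times_mps_def
    by (intro arg_cong[where f = Abs_mps] ext sum.reindex_bij_witness[of _ prod.swap prod.swap])
       (auto simp: add.commute mult.commute)
  show "1 * F = F"
  proof (rule mps_eqI)
    fix m
    have "mcoeff (1 * F) m = (\<Sum>x\<in>{(a, b). a + b = m}. if x = ({#}, m) then mcoeff F m else 0)"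
      unfolding times_mps_def one_mps_def mcoeff_Abs
      by (rule sum.cong) (auto split: if_splits)
    then show "mcoeff (1 * F) m = mcoeff F m" by simp
  qed
  show "(F + G) * H = F * H + G * H"
    by (rule mps_eqI) (simp add: times_mps_def plus_mps_def algebra_simps case_prod_beta sum.distrib)
  show "(0 :: 'a mps) \<noteq> 1"
  proof
    assume "(0 :: 'a mps) = 1"
    then have "mcoeff (0 :: 'a mps) {#} = mcoeff 1 {#}" by simp
    then show False by (simp add: zero_mps_def one_mps_def)
  qed
qed (auto intro!: mps_eqI simp: plus_mps_def zero_mps_def uminus_mps_def minus_mps_def algebra_simps)

end

instantiation mps :: (type) inverse
begin

definition "inverse F = (if \<exists>G. F * G = 1 then THE G. F * G = (1 :: 'a mps) else 0)"
definition "F div G = F * inverse (G :: 'a mps)"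

instance ..

end

lemma mps_inverse_eqI:
  fixes F G :: "'a mps"
  assumes "F * G = 1"
  shows "inverse F = G"
proof -
  have "H = G" if "F * H = 1" for H
    using that assms by (metis mult.assoc mult.commute mult_1)
  then have "(THE H. F * H = 1) = G" using assms by blast
  with assms show ?thesis by (auto simp: inverse_mps_def)
qed

lemma mcoeff_power_eq_0:
  assumes "mcoeff F {#} = 0" "size m < k"
  shows "mcoeff (F ^ k) m = 0"
  using assms(2)
proof (induction k arbitrary: m)
  case (Suc k)
  have "mcoeff F a * mcoeff (F ^ k) b = 0" if "a + b = m" for a b
  proof (cases "a = {#}")
    case False
    then have "size a > 0" by (simp add: nonempty_has_size)
    then have "size b < k" using that Suc.prems by auto
    then show ?thesis using Suc.IH by simp
  qed (use assms(1) in simp)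
  then show ?case by (auto simp: times_mps_def intro!: sum.neutral)
qed simp

lemma mcoeff_sum: "mcoeff (sum f A) m = (\<Sum>x\<in>A. mcoeff (f x) m)"
  by (induction A rule: infinite_finite_induct) (auto simp: zero_mps_def plus_mps_def)

lemma mps_mult_inverse:
  fixes F :: "'a mps"
  assumes "mcoeff F {#} = 1"
  shows "F * inverse F = 1"
proof -
  let ?H = "1 - F"
  define G where "G = Abs_mps (\<lambda>m. \<Sum>k\<le>size m. mcoeff (?H ^ k) m)"
  have H0: "mcoeff ?H {#} = 0" using assms by (simp add: minus_mps_def one_mps_def)
  have "F * G = 1"
  proof (rule mps_eqI)
    fix m :: "'a multiset"
    define P where "P = (\<Sum>k\<le>size m. ?H ^ k)"
    have P: "mcoeff G b = mcoeff P b" if "size b \<le> size m" for b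
    proof -
      have "(\<Sum>k\<le>size b. mcoeff (?H ^ k) b) = (\<Sum>k\<le>size m. mcoeff (?H ^ k) b)"
        using that by (intro sum.mono_neutral_left) (auto intro: mcoeff_power_eq_0[OF H0])
      then show ?thesis by (simp add: G_def P_def mcoeff_sum)
    qed
    have "mcoeff (F * G) m = mcoeff (F * P) m"
      unfolding times_mps_def mcoeff_Abs by (rule sum.cong) (auto simp: P)
    also have "F * P = 1 - ?H ^ Suc (size m)"
      using sum_gp_basic[of ?H "size m"] by (simp add: P_def)
    also have "mcoeff \<dots> m = mcoeff 1 m"
      using mcoeff_power_eq_0[OF H0, of m "Suc (size m)"] by (simp add: minus_mps_def)
    finally show "mcoeff (F * G) m = mcoeff 1 m" .
  qed
  then show ?thesis using mps_inverse_eqI by metis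
qed

definition mps_const :: "complex \<Rightarrow> 'd mps" where
  "mps_const c = Abs_mps (\<lambda>m. if m = {#} then c else 0)"

text \<open>
  \<open>exp F = \<Sum>\<^sub>k F\<^sup>k / k!\<close> for \<open>F\<close> without constant term: then \<open>F\<^sup>k\<close> has no monomials of degree
  less than \<open>k\<close>, so the terms with \<open>k > size m\<close> do not contribute to the coefficient at \<open>m\<close>.
  Truncation in the composition below is justified in the same way.
\<close>

definition mps_exp :: "'d mps \<Rightarrow> 'd mps" where
  "mps_exp F = Abs_mps (\<lambda>m. \<Sum>k\<le>size m. mcoeff (F ^ k) m / fact k)"

text \<open>The series \<open>\<Sum>\<^sub>n \<langle>f\<^sub>n, \<xi>\<^bsup>\<otimes>n\<^esup>\<rangle>\<close>, with all tuples yielding the same monomial collected.\<close>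

definition tensor_series :: "(nat \<Rightarrow> ('d::finite) tensor) \<Rightarrow> 'd mps" where
  "tensor_series f = Abs_mps (\<lambda>m. \<Sum>l | mset l = m. f (size m) l)"

text \<open>
  The components of \<open>A(\<xi>) = \<Sum>\<^bsub>k\<ge>1\<^esub> A\<^sub>k \<xi>\<^bsup>\<otimes>k\<^esup>\<close>.  The coefficient of the monomial \<open>m\<close> in
  \<open>\<xi>\<^bsup>\<otimes>k\<^esup>\<close>, \<open>k = size m\<close>, is the symmetric tensor which is 1 on the arrangements of \<open>m\<close>.
\<close>

definition vector_series :: "(nat \<Rightarrow> ('d::finite) tensor \<Rightarrow> complex ^ 'd) \<Rightarrow> 'd \<Rightarrow> 'd mps" where
  "vector_series A i = Abs_mps (\<lambda>m. if m = {#} then 0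
     else A (size m) (\<lambda>l. if mset l = m then 1 else 0) $ i)"

definition pair_series ::
  "complex ^ ('d::finite) \<Rightarrow> (nat \<Rightarrow> 'd tensor \<Rightarrow> complex ^ 'd) \<Rightarrow> 'd mps" where
  "pair_series \<omega> A = (\<Sum>i\<in>UNIV. mps_const (\<omega> $ i) * vector_series A i)"

text \<open>\<open>\<rho>(A(\<xi>)) = \<Sum>\<^sub>n \<langle>\<rho>\<^sub>n, A(\<xi>)\<^bsup>\<otimes>n\<^esup>\<rangle>\<close>\<close>

definition comp_series ::
  "(nat \<Rightarrow> ('d::finite) tensor) \<Rightarrow> (nat \<Rightarrow> 'd tensor \<Rightarrow> complex ^ 'd) \<Rightarrow> 'd mps" where
  "comp_series \<rho> A = Abs_mps (\<lambda>m. \<Sum>n\<le>size m. \<Sum>l | length l = n.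
     \<rho> n l * mcoeff (\<Prod>i\<leftarrow>l. vector_series A i) m)"


section \<open>Polynomials, Sheffer sequences and Sheffer operators\<close>

definition polynomials :: "(complex ^ ('d::finite) \<Rightarrow> complex) set" where
  "polynomials = {p. \<exists>n \<phi>. (\<forall>k. \<phi> k \<in> sym_tensors k) \<and>
     p = (\<lambda>\<omega>. \<Sum>k\<le>n. tpair k (tensor_power k \<omega>) (\<phi> k))}"

definition monic_sequence :: "(nat \<Rightarrow> complex ^ ('d::finite) \<Rightarrow> 'd tensor) \<Rightarrow> bool" where
  "monic_sequence S \<longleftrightarrow> (\<exists>U :: nat \<Rightarrow> nat \<Rightarrow> 'd tensor \<Rightarrow> 'd tensor.
     (\<forall>n. \<forall>k\<le>n. linear_op k n (U n k)) \<and>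
     (\<forall>n. \<forall>\<phi>\<in>sym_tensors n. U n n \<phi> = \<phi>) \<and>
     (\<forall>n \<omega>. S n \<omega> = (\<lambda>l. \<Sum>k\<le>n. U n k (tensor_power k \<omega>) l)))"

definition sheffer_sequence ::
  "(nat \<Rightarrow> complex ^ ('d::finite) \<Rightarrow> 'd tensor) \<Rightarrow> (nat \<Rightarrow> 'd tensor \<Rightarrow> complex ^ 'd) \<Rightarrow>
   (nat \<Rightarrow> 'd tensor) \<Rightarrow> bool" where
  "sheffer_sequence S A \<rho> \<longleftrightarrow> monic_sequence S \<and>
     (\<forall>k\<ge>1. linear_vec k (A k)) \<and> (\<forall>\<phi>\<in>sym_tensors 1. A 1 \<phi> = vec_of_tensor \<phi>) \<and>
     (\<forall>n. \<rho> n \<in> sym_tensors n) \<and> \<rho> 0 [] = 1 \<and>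
     (\<forall>\<omega>. tensor_series (\<lambda>n l. S n \<omega> l / fact n) =
           mps_exp (pair_series \<omega> A) / comp_series \<rho> A)"

definition identity_coeffs :: "nat \<Rightarrow> ('d::finite) tensor \<Rightarrow> complex ^ 'd" where
  "identity_coeffs k \<phi> = (if k = 1 then vec_of_tensor \<phi> else 0)"

lemma vector_series_identity: "mcoeff (vector_series identity_coeffs i) m = (if m = {#i#} then 1 else 0)"
proof -
  show ?thesis
  proof (cases "size m = 1")
    case True
    then obtain j where "m = {#j#}" by (metis size_1_singleton_mset)
    then show ?thesis by (simp add: vector_series_def identity_coeffs_def vec_of_tensor_def)
  next
    case False
    then have "m \<noteq> {#i#}" by auto
    with False show ?thesis by (simp add: vector_series_def identity_coeffs_def)
  qed
qed

lemma prod_vector_series_identity: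
  "mcoeff (\<Prod>i\<leftarrow>l. vector_series identity_coeffs i) m = (if m = mset l then 1 else 0)"
proof (induction l arbitrary: m)
  case Nil then show ?case by (simp add: one_mps_def)
next
  case (Cons i l)
  have "mcoeff (\<Prod>i\<leftarrow>i#l. vector_series identity_coeffs i) m =
     (\<Sum>x\<in>{(a,b). a + b = m}. if ({#i#}, mset l) = x then 1 else 0)"
    unfolding list.map prod_list.Cons times_mps_def mcoeff_Abs vector_series_identity Cons.IH
    by (intro sum.cong refl) (simp split: prod.split)
  also have "\<dots> = (if ({#i#}, mset l) \<in> {(a,b). a + b = m} then 1 else 0)"
    by (rule sum.delta') simp
  finally show ?case by (simp add: eq_commute)
qed

text \<open>\<open>\<rho>(A(\<xi>)) = \<rho>(\<xi>)\<close> for \<open>A(\<xi>) = \<xi>\<close>\<close>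

lemma comp_identity: "comp_series \<rho> identity_coeffs = tensor_series \<rho>"
proof (rule mps_eqI)
  fix m
  have fin: "finite {l::'a::finite list. length l = n}" for n
    using finite_lists_length_eq[of "UNIV::'a set" n] by simp
  have "mcoeff (comp_series \<rho> identity_coeffs) m =
    (\<Sum>n\<le>size m. \<Sum>l | length l = n. if m = mset l then \<rho> n l else 0)"
    by (auto simp: comp_series_def prod_vector_series_identity intro!: sum.cong)
  also have "\<dots> = (\<Sum>n\<le>size m. if n = size m then \<Sum>l | length l = n \<and> m = mset l. \<rho> n l else 0)"
  proof (intro sum.cong refl)
    fix n
    have "(\<Sum>l | length l = n. if m = mset l then \<rho> n l else 0) = (\<Sum>l | length l = n \<and> m = mset l. \<rho> n l)"
      using fin by (intro sum.mono_neutral_cong_right) auto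
    moreover have "{l. length l = n \<and> m = mset l} = {}" if "n \<noteq> size m" using that by auto
    ultimately show "(\<Sum>l | length l = n. if m = mset l then \<rho> n l else 0) = (if n = size m then \<Sum>l | length l = n \<and> m = mset l. \<rho> n l else 0)"
      by (metis sum.empty)
  qed
  also have "\<dots> = mcoeff (tensor_series \<rho>) m"
  proof -
    have "{l. length l = size m \<and> m = mset l} = {l. mset l = m}" by auto
    then show ?thesis by (simp add: tensor_series_def)
  qed
  finally show "mcoeff (comp_series \<rho> identity_coeffs) m = mcoeff (tensor_series \<rho>) m" .
qed

lemma comp_const: assumes "\<rho> 0 [] = 1" shows "mcoeff (comp_series \<rho> A) {#} = 1"
  using assms by (simp add: comp_series_def one_mps_def)

definition appell_sequence ::
  "(nat \<Rightarrow> complex ^ ('d::finite) \<Rightarrow> 'd tensor) \<Rightarrow> (nat \<Rightarrow> 'd tensor) \<Rightarrow> bool" where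
  "appell_sequence S \<rho> \<longleftrightarrow> sheffer_sequence S identity_coeffs \<rho>"

text \<open>
  The value is determined uniquely, since a polynomial has only one representation by symmetric
  tensors up to trailing zeros; see \<open>sheffer_operator_eq\<close> below.
\<close>

definition sheffer_operator ::
  "(nat \<Rightarrow> complex ^ ('d::finite) \<Rightarrow> 'd tensor) \<Rightarrow>
   (complex ^ 'd \<Rightarrow> complex) \<Rightarrow> (complex ^ 'd \<Rightarrow> complex)" where
  "sheffer_operator S p = (THE q. \<exists>n \<phi>. (\<forall>k. \<phi> k \<in> sym_tensors k) \<and>
     p = (\<lambda>\<omega>. \<Sum>k\<le>n. tpair k (tensor_power k \<omega>) (\<phi> k)) \<and>
     q = (\<lambda>\<omega>. \<Sum>k\<le>n. tpair k (S k \<omega>) (\<phi> k)))"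


lemma sym_tensor_eq_0:
  fixes \<phi> :: "('d::finite) tensor"
  assumes \<phi>: "\<phi> \<in> sym_tensors k" and zero: "\<And>\<omega>. tpair k (tensor_power k \<omega>) \<phi> = 0"
  shows "\<phi> = (\<lambda>_. 0)"
proof
  fix l0
  show "\<phi> l0 = 0"
  proof (cases "length l0 = k")
    case False
    then show ?thesis using \<phi> by (simp add: sym_tensors_def)
  next
    case True
    obtain p :: "'d \<Rightarrow> nat" where p: "inj p" "\<And>i. prime (p i)"
    proof -
      obtain B where B: "finite B" "card B = CARD('d)" "B \<subseteq> {q::nat. prime q}"
        using infinite_arbitrarily_large[OF primes_infinite] by blast
      then obtain p where "bij_betw p (UNIV :: 'd set) B"
        using finite_same_card_bij[of "UNIV :: 'd set" B] by auto
      then show ?thesis using B(3) that[of p] by (auto simp: bij_betw_def)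
    qed
    define N where "N l = (\<Prod>i\<leftarrow>l. p i)" for l
    have pf: "prime_factorization (N l) = image_mset p (mset l)" for l
    proof -
      have "N l = prod_mset (image_mset p (mset l))"
        by (simp add: N_def flip: prod_mset_prod_list)
      moreover have "prime_factorization (prod_mset (image_mset p (mset l))) = image_mset p (mset l)"
        using p(2) by (intro prime_factorization_prod_mset_primes) auto
      ultimately show ?thesis by metis
    qed
    have N_eq: "mset l = mset l'" if "N l = N l'" for l l'
      proof -
      have "image_mset p (mset l) = image_mset p (mset l')" using pf[of l] pf[of l'] that by simp
      then show ?thesis by (rule injD[OF multiset.inj_map[OF p(1)]])
    qed
    let ?L = "{l::'d list. length l = k}"
    have fin: "finite ?L" using finite_lists_length_eq[of "UNIV :: 'd set" k] by simp
    have pow: "(\<Sum>l\<in>?L. \<phi> l * of_nat (N l) ^ s) = 0" for s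
    proof -
      have "of_nat (N l) ^ s = (\<Prod>i\<leftarrow>l. of_nat (p i) ^ s :: complex)" for l
        unfolding N_def by (induction l) (auto simp: power_mult_distrib)
      then have "\<phi> l * of_nat (N l) ^ s = tensor_power k (\<chi> i. of_nat (p i) ^ s) l * \<phi> l"
        if "length l = k" for l
        unfolding tensor_power_def vec_lambda_beta using that by simp
      then have "(\<Sum>l\<in>?L. \<phi> l * of_nat (N l) ^ s) = tpair k (tensor_power k (\<chi> i. of_nat (p i) ^ s)) \<phi>"
        unfolding tpair_def by (intro sum.cong) auto
      then show ?thesis using zero by simp
    qed
    have poly: "(\<Sum>l\<in>?L. \<phi> l * poly q (of_nat (N l))) = 0" for q
    proof -
      have "(\<Sum>l\<in>?L. \<phi> l * poly q (of_nat (N l))) =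
            (\<Sum>s\<le>degree q. coeff q s * (\<Sum>l\<in>?L. \<phi> l * of_nat (N l) ^ s))"
        unfolding poly_altdef sum_distrib_left by (subst sum.swap) (simp only: mult.left_commute)
      then show ?thesis by (simp add: pow)
    qed
    define q :: "complex poly" where "q = (\<Prod>v\<in>N ` ?L - {N l0}. [:- of_nat v, 1:])"
    have q0: "poly q (of_nat (N l)) = 0 \<longleftrightarrow> N l \<noteq> N l0" if "length l = k" for l
      using that fin by (auto simp: q_def poly_prod)
    have "(\<Sum>l\<in>?L. \<phi> l * poly q (of_nat (N l))) =
          (\<Sum>l\<in>{l\<in>?L. N l = N l0}. \<phi> l * poly q (of_nat (N l)))"
      using fin q0 by (intro sum.mono_neutral_right) auto
    also have "\<dots> = (\<Sum>l\<in>{l\<in>?L. N l = N l0}. \<phi> l0 * poly q (of_nat (N l0)))"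
    proof (intro sum.cong refl)
      fix l assume "l \<in> {l\<in>?L. N l = N l0}"
      then have "\<phi> l = \<phi> l0" "N l = N l0"
        using N_eq[of l l0] \<phi> unfolding sym_tensors_def by blast+
      then show "\<phi> l * poly q (of_nat (N l)) = \<phi> l0 * poly q (of_nat (N l0))" by simp
    qed
    finally have "of_nat (card {l\<in>?L. N l = N l0}) * (\<phi> l0 * poly q (of_nat (N l0))) = 0"
      using poly by simp
    moreover have "card {l\<in>?L. N l = N l0} \<noteq> 0"
      using fin True by (auto simp: card_eq_0_iff)
    ultimately show ?thesis using q0[OF True] by simp
  qed
qed

lemma tensor_power_scale: "tensor_power k (c *s \<omega>) = (\<lambda>l. c ^ k * tensor_power k \<omega> l)"
proof -
  have "(\<Prod>i\<leftarrow>l. (c *s \<omega>) $ i) = c ^ length l * (\<Prod>i\<leftarrow>l. \<omega> $ i)" for l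
    by (induction l) (auto simp: mult_ac)
  note this[simp del, unfolded vector_smult_component]
  then show ?thesis
    unfolding tensor_power_def vector_smult_component by (intro ext) simp
qed

lemma polynomial_repr_unique:
  fixes \<phi> :: "nat \<Rightarrow> ('d::finite) tensor"
  assumes "\<And>k. \<phi> k \<in> sym_tensors k"
    and "\<And>\<omega>. (\<Sum>k\<le>n. tpair k (tensor_power k \<omega>) (\<phi> k)) = 0" and "k \<le> n"
  shows "\<phi> k = (\<lambda>_. 0)"
proof (rule sym_tensor_eq_0[OF assms(1)])
  fix \<omega> :: "complex ^ 'd"
  have "(\<Sum>k\<le>n. tpair k (tensor_power k \<omega>) (\<phi> k) * t ^ k) = 0" for t
    using assms(2)[of "t *s \<omega>"]
    by (simp add: tensor_power_scale tpair_def sum_distrib_left sum_distrib_right mult_ac)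
  then show "tpair k (tensor_power k \<omega>) (\<phi> k) = 0"
    using polyfun_eq_0[of "\<lambda>k. tpair k (tensor_power k \<omega>) (\<phi> k)" n] \<open>k \<le> n\<close> by auto
qed

lemma sheffer_operator_eq:
  fixes \<phi> :: "nat \<Rightarrow> ('d::finite) tensor"
  assumes \<phi>: "\<And>k. \<phi> k \<in> sym_tensors k"
  shows "sheffer_operator S (\<lambda>\<omega>. \<Sum>k\<le>n. tpair k (tensor_power k \<omega>) (\<phi> k)) =
         (\<lambda>\<omega>. \<Sum>k\<le>n. tpair k (S k \<omega>) (\<phi> k))"
  unfolding sheffer_operator_def
proof (rule the_equality)
  let ?\<sigma> = "\<lambda>N (T :: nat \<Rightarrow> complex ^ 'd \<Rightarrow> 'd tensor) \<psi> \<omega>. \<Sum>k\<le>N. tpair k (T k \<omega>) (\<psi> k)"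
  fix q assume "\<exists>n' \<phi>'. (\<forall>k. \<phi>' k \<in> sym_tensors k) \<and>
    (\<lambda>\<omega>. \<Sum>k\<le>n. tpair k (tensor_power k \<omega>) (\<phi> k)) = (\<lambda>\<omega>. \<Sum>k\<le>n'. tpair k (tensor_power k \<omega>) (\<phi>' k)) \<and>
    q = (\<lambda>\<omega>. \<Sum>k\<le>n'. tpair k (S k \<omega>) (\<phi>' k))"
  then obtain n' \<phi>' where \<phi>': "\<And>k. \<phi>' k \<in> sym_tensors k"
    and eq: "\<And>\<omega>. ?\<sigma> n tensor_power \<phi> \<omega> = ?\<sigma> n' tensor_power \<phi>' \<omega>"
    and q: "q = ?\<sigma> n' S \<phi>'" by (auto simp: fun_eq_iff)
  define \<psi> where "\<psi> k = (\<lambda>l. (if k \<le> n then \<phi> k l else 0) - (if k \<le> n' then \<phi>' k l else 0))" for k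
  have diff: "?\<sigma> (max n n') T \<psi> \<omega> = ?\<sigma> n T \<phi> \<omega> - ?\<sigma> n' T \<phi>' \<omega>" for T \<omega>
  proof -
    have "tpair k (T k \<omega>) (\<psi> k) = (if k \<le> n then tpair k (T k \<omega>) (\<phi> k) else 0) -
          (if k \<le> n' then tpair k (T k \<omega>) (\<phi>' k) else 0)" for k
      by (auto simp: tpair_def \<psi>_def sum_subtractf sum_negf right_diff_distrib)
    then have "?\<sigma> (max n n') T \<psi> \<omega> =
        (\<Sum>k\<le>max n n'. if k \<le> n then tpair k (T k \<omega>) (\<phi> k) else 0) -
        (\<Sum>k\<le>max n n'. if k \<le> n' then tpair k (T k \<omega>) (\<phi>' k) else 0)"
      by (simp add: sum_subtractf)
    also have "(\<Sum>k\<le>max n n'. if k \<le> n then tpair k (T k \<omega>) (\<phi> k) else 0) = ?\<sigma> n T \<phi> \<omega>"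
      by (rule sum.mono_neutral_cong_right) auto
    also have "(\<Sum>k\<le>max n n'. if k \<le> n' then tpair k (T k \<omega>) (\<phi>' k) else 0) = ?\<sigma> n' T \<phi>' \<omega>"
      by (rule sum.mono_neutral_cong_right) auto
    finally show ?thesis .
  qed
  have "\<psi> k = (\<lambda>_. 0)" if "k \<le> max n n'" for k
  proof (rule polynomial_repr_unique[OF _ _ that])
    have "\<forall>l. length l \<noteq> k \<longrightarrow> \<psi> k l = 0" "\<forall>l l'. mset l = mset l' \<longrightarrow> \<psi> k l = \<psi> k l'" for k
      using \<phi>[of k] \<phi>'[of k] unfolding sym_tensors_def \<psi>_def mem_Collect_eq by (simp, metis)
    then show "\<psi> k \<in> sym_tensors k" for k unfolding sym_tensors_def by blast
    show "?\<sigma> (max n n') tensor_power \<psi> \<omega> = 0" for \<omega>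
      using diff[of tensor_power \<omega>] eq by simp
  qed
  then have "?\<sigma> (max n n') S \<psi> \<omega> = 0" for \<omega>
    by (intro sum.neutral) (auto simp: tpair_def)
  then show "q = ?\<sigma> n S \<phi>" using diff[of S] q by (auto simp: fun_eq_iff)
qed (use \<phi> in blast)


section \<open>Holomorphic functions and the spaces of entire functions\<close>

definition holomorphic_Cd ::
  "(complex ^ ('d::finite) \<Rightarrow> complex) \<Rightarrow> (complex ^ 'd) set \<Rightarrow> bool" where
  "holomorphic_Cd f U \<longleftrightarrow>
     (\<forall>x\<in>U. \<exists>D. (f has_derivative D) (at x) \<and> (\<forall>c v. D (c *s v) = c * D v))"

definition holomorphic_near_zero ::
  "(nat \<Rightarrow> ('d::finite) tensor \<Rightarrow> complex ^ 'd) \<Rightarrow> (nat \<Rightarrow> 'd tensor) \<Rightarrow> bool" where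
  "holomorphic_near_zero A \<rho> \<longleftrightarrow> (\<exists>U a r. open U \<and> 0 \<in> U \<and>
     (\<forall>\<xi>\<in>U. (\<lambda>k. A (Suc k) (tensor_power (Suc k) \<xi>)) sums a \<xi>) \<and>
     (\<forall>\<xi>\<in>U. (\<lambda>n. tpair n (\<rho> n) (tensor_power n \<xi>)) sums r \<xi>) \<and>
     (\<forall>i. holomorphic_Cd (\<lambda>\<xi>. a \<xi> $ i) U) \<and> holomorphic_Cd r U)"

definition Emin_norm :: "real \<Rightarrow> nat \<Rightarrow> (complex ^ ('d::finite) \<Rightarrow> complex) \<Rightarrow> real" where
  "Emin_norm \<alpha> l f = (SUP \<omega>. cmod (f \<omega>) * exp (- (1 / 2 ^ l) * norm \<omega> powr \<alpha>))"

text \<open>The following two constants are meant for \<open>\<alpha> > 0\<close>.\<close>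

definition Emin_pos :: "real \<Rightarrow> (complex ^ ('d::finite) \<Rightarrow> complex) set" where
  "Emin_pos \<alpha> = {f. holomorphic_Cd f UNIV \<and>
     (\<forall>l::nat. bdd_above (range (\<lambda>\<omega>. cmod (f \<omega>) * exp (- (1 / 2 ^ l) * norm \<omega> powr \<alpha>))))}"

definition Emin_pos_topology :: "real \<Rightarrow> (complex ^ ('d::finite) \<Rightarrow> complex) topology" where
  "Emin_pos_topology \<alpha> = topology_generated_by
     {{g \<in> Emin_pos \<alpha>. Emin_norm \<alpha> l (\<lambda>\<omega>. g \<omega> - f \<omega>) < \<epsilon>} | f l \<epsilon>. f \<in> Emin_pos \<alpha> \<and> \<epsilon> > 0}"

text \<open>
  For \<open>\<alpha> = 0\<close>: the projective limit, i.e. the intersection of the spaces with positive index,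
  with the coarsest topology making all the inclusions continuous.
\<close>

definition Emin_topology :: "real \<Rightarrow> (complex ^ ('d::finite) \<Rightarrow> complex) topology" where
  "Emin_topology \<alpha> = (if \<alpha> = 0
     then topology_generated_by
       {W \<inter> (\<Inter>b\<in>{0<..}. Emin_pos b) | W a. a > 0 \<and> openin (Emin_pos_topology a) W}
     else Emin_pos_topology \<alpha>)"

text \<open>
  An operator \<open>L\<close> on a dense subspace \<open>D\<close> of a function space \<open>X\<close> extends by continuity to a
  linear self-homeomorphism of \<open>X\<close>.  Density is what makes the continuous extension the unique one.
\<close>

definition extends_to_linear_self_homeomorphism ::
  "('a \<Rightarrow> complex) topology \<Rightarrow> ('a \<Rightarrow> complex) set \<Rightarrow> (('a \<Rightarrow> complex) \<Rightarrow> ('a \<Rightarrow> complex)) \<Rightarrow> bool"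
  where
  "extends_to_linear_self_homeomorphism X D L \<longleftrightarrow>
     D \<subseteq> topspace X \<and> X closure_of D = topspace X \<and>
     (\<exists>T. (\<forall>p\<in>D. T p = L p) \<and>
          (\<forall>c. \<forall>f\<in>topspace X. \<forall>g\<in>topspace X. T (\<lambda>x. c * f x + g x) = (\<lambda>x. c * T f x + T g x)) \<and>
          homeomorphic_map X X T)"

end

theory Submission
  imports Defs "HOL-Complex_Analysis.Cauchy_Integral_Formula"
begin

text \<open>
  In the basis of monomials a Sheffer operator is an infinite matrix with finite rows. For multi-indices \<open>m\<close>, \<open>k\<close> the
  coefficient of \<open>\<omega>\<^sup>k\<close> in the image of \<open>\<omega>\<^sup>m\<close> is \<open>m! / k!\<close> times the coefficient of \<open>\<xi>\<^sup>m\<close> in \<open>A(\<xi>)\<^sup>k \<sigma>(\<xi>)\<close>, where \<open>\<sigma> = 1 / (\<rho> \<circ> A)\<close>;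
  this is read off the generating function (\<open>sheffer_sequence_coeffs\<close>). Up to the factorials it is the transposed matrix
  of the operator \<open>F \<mapsto> \<sigma> \<cdot> (F \<circ> A)\<close> on formal power series. That operator has the inverse \<open>F \<mapsto> \<rho> \<cdot> (F \<circ> B)\<close> with the
  compositional inverse \<open>B\<close> of \<open>A\<close>, so the inverse of a Sheffer operator is given by a matrix of the same shape
  (\<open>sheffer_matrix_inverse\<close>), and everything that is proved for the operator applies to its inverse.

  The Taylor coefficients identify the space of entire functions of minimal type and order \<open>\<alpha> > 0\<close> with the space of
  all sequences \<open>a\<close> for which \<open>\<Sum>\<^sub>m \<bar>a\<^sub>m\<bar> R\<^bsup>|m|\<^esup> (|m|!)\<^bsup>1/\<alpha>\<^esup>\<close> is finite for every \<open>R > 0\<close>, with equivalent families of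
  norms (\<open>Emin_coeff_norm_le\<close>, \<open>Emin_norm_le_coeff_norm\<close>). A matrix therefore acts continuously if its rows satisfy a
  weighted bound. Suppose that for \<open>|k| \<le> |m|\<close> the coefficient of \<open>\<xi>\<^sup>m\<close> in \<open>A(\<xi>)\<^sup>k \<sigma>(\<xi>)\<close> is at most
  \<open>K R\<^bsup>|m|\<^esup> ((|m| - |k|)!)\<^bsup>\<gamma> - 1\<^esup>\<close> (\<open>sheffer_bound\<close>). Then the factorials combine (\<open>factorial_weight_le\<close>) to a row bound
  for every weight exponent \<open>1 / \<alpha> \<ge> \<gamma>\<close>, that is, for all orders \<open>\<alpha> \<le> 1 / \<gamma>\<close>.

  For analytic \<open>A\<close> and \<open>\<rho>\<close> this holds with \<open>\<gamma> = 1\<close>: on a small polydisc the majorants of \<open>A\<close> and \<open>B\<close> are below 1 and those of \<open>\<sigma>\<close>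
  and \<open>\<rho>\<close> are bounded (\<open>compositional_inverse_bound\<close>, \<open>reciprocal_of_subst_bound\<close>). In the Appell case \<open>A\<close> and \<open>B\<close> are the
  identity, the coefficient is one of \<open>\<sigma>\<close> or \<open>\<rho>\<close> of degree \<open>|m| - |k|\<close>, and the assumed growth is the bound with \<open>\<gamma> = 1 / \<beta>\<close>.

  The two operators given by the matrices are mutually inverse on every such space. For order 0, each norm of
  order \<open>a\<close> of the image is controlled by a norm of order \<open>min a (1 / \<gamma>)\<close> of the argument, which gives continuity in the projective
  limit. Taylor polynomials converge in every norm, hence the polynomials are dense.
\<close>

section \<open>Multi-indices\<close>

lemma finite_multisets_size_le [simp]: "finite {m :: ('d::finite) multiset. size m \<le> n}"
proof (rule finite_subset)
  show "{m :: 'd multiset. size m \<le> n} \<subseteq> mset ` {l. set l \<subseteq> UNIV \<and> length l \<le> n}"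
    by (auto simp: image_iff) (metis ex_mset size_mset)
qed (intro finite_imageI finite_lists_length_le, simp)

lemma finite_multisets_size_less [simp]: "finite {m :: ('d::finite) multiset. size m < n}"
  by (rule finite_subset[OF _ finite_multisets_size_le[of n]]) auto

lemma finite_multisets_size_eq [simp]: "finite {m :: ('d::finite) multiset. size m = n}"
  by (rule finite_subset[OF _ finite_multisets_size_le[of n]]) auto

lemma finite_lists_fixed_length [simp]: "finite {l :: ('d::finite) list. length l = n}"
  using finite_lists_length_eq[of "UNIV :: 'd set" n] by simp

lemma finite_lists_of_mset [simp]: "finite {l :: ('d::finite) list. mset l = m}"
  by (rule finite_subset[OF _ finite_lists_fixed_length[of "size m"]]) auto

lemma card_lists_fixed_length: "card {l :: ('d::finite) list. length l = n} = CARD('d) ^ n"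
  using card_lists_length_eq[of "UNIV :: 'd set" n] by simp

lemma card_multisets_size: "card {m :: ('d::finite) multiset. size m = n} \<le> CARD('d) ^ n"
proof -
  have "{m :: 'd multiset. size m = n} \<subseteq> mset ` {l. length l = n}"
    by (auto simp: image_iff) (metis ex_mset size_mset)
  then have "card {m :: 'd multiset. size m = n} \<le> card (mset ` {l :: 'd list. length l = n})"
    by (intro card_mono finite_imageI) auto
  also have "\<dots> \<le> card {l :: 'd list. length l = n}"
    by (rule card_image_le) simp
  finally show ?thesis by (simp add: card_lists_fixed_length)
qed

text \<open>This is the multinomial coefficient \<open>(size m)! / \<Prod>\<^sub>i m\<^sub>i!\<close>; the estimates use
  \<open>1 \<le> arrangements m \<le> d ^ size m\<close>.\<close>

definition arrangements :: "('d::finite) multiset \<Rightarrow> nat" where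
  "arrangements m = card {l. mset l = m}"

lemma arrangements_pos [simp]: "arrangements m > 0"
  unfolding arrangements_def card_gt_0_iff using ex_mset[of m] by auto

lemma arrangements_le: "arrangements (m :: ('d::finite) multiset) \<le> CARD('d) ^ size m"
proof -
  have "arrangements m \<le> card {l :: 'd list. length l = size m}"
    unfolding arrangements_def by (rule card_mono) auto
  then show ?thesis by (simp add: card_lists_fixed_length)
qed

lemma sum_lists_by_mset:
  "(\<Sum>l | length l = n. f l) = (\<Sum>m | size m = n. \<Sum>l | mset l = m. f (l :: ('d::finite) list))"
proof -
  have "(\<Sum>m | size m = n. \<Sum>l | mset l = m. f l) =
        (\<Sum>m | size m = n. \<Sum>l\<in>{l\<in>{l. length l = n}. mset l = m}. f l)"
    by (intro sum.cong arg_cong2[where f = sum]) auto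
  also have "\<dots> = (\<Sum>l | length l = n. f l)"
    by (rule sum.group) auto
  finally show ?thesis by simp
qed

lemma sum_multisets_by_size:
  "(\<Sum>m | size (m :: ('d::finite) multiset) \<le> n. f m) = (\<Sum>j\<le>n. \<Sum>m | size m = j. f m)"
proof -
  have "(\<Sum>j\<le>n. \<Sum>m | size m = j. f m) = (\<Sum>j\<le>n. \<Sum>m\<in>{m\<in>{m. size m \<le> n}. size m = j}. f m)"
    by (intro sum.cong arg_cong2[where f = sum]) auto
  also have "\<dots> = (\<Sum>m | size m \<le> n. f m)"
    by (rule sum.group) auto
  finally show ?thesis by simp
qed

lemma sum_size_eq_power_le:
  assumes "(0::real) \<le> x"
  shows "(\<Sum>m | size (m :: ('d::finite) multiset) = n. x ^ size m) \<le> (real CARD('d) * x) ^ n"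
proof -
  have "(\<Sum>m | size (m :: 'd multiset) = n. x ^ size m) = card {m :: 'd multiset. size m = n} * x ^ n"
    by simp
  also have "\<dots> \<le> real (CARD('d) ^ n) * x ^ n"
    using assms card_multisets_size[where 'd='d, of n] by (intro mult_right_mono) (auto simp del: of_nat_power)
  finally show ?thesis by (simp add: power_mult_distrib)
qed

lemma sum_finite_geometric_le:
  assumes "(0::real) \<le> x" "x \<le> 1/2"
  shows "(\<Sum>j=k..n. x ^ j) \<le> 2 * x ^ k"
proof -
  have "(\<Sum>j=k..n. x ^ j) \<le> 2 * x ^ k - x ^ n" if "k \<le> n"
    using that
  proof (induction n rule: dec_induct)
    case (step n)
    have "2 * x ^ Suc n \<le> x ^ n" using assms by (simp add: mult_left_le_one_le mult.assoc[symmetric])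
    then show ?case using step by simp
  qed simp
  then show ?thesis using assms by (cases "k \<le> n") (auto intro: order_trans)
qed

lemma sum_multisets_geometric_le:
  assumes "(0::real) \<le> x" "real CARD('d::finite) * x \<le> 1/2"
  shows "(\<Sum>m | k \<le> size (m :: 'd multiset) \<and> size m \<le> n. x ^ size m) \<le> 2 * (real CARD('d) * x) ^ k"
proof -
  have "(\<Sum>m | k \<le> size (m :: 'd multiset) \<and> size m \<le> n. x ^ size m) =
        (\<Sum>j=k..n. \<Sum>m\<in>{m \<in> {m :: 'd multiset. k \<le> size m \<and> size m \<le> n}. size m = j}. x ^ size m)"
    by (rule sum.group[symmetric]) (auto intro: finite_subset[OF _ finite_multisets_size_le[of n]])
  also have "\<dots> = (\<Sum>j=k..n. \<Sum>m | size (m :: 'd multiset) = j. x ^ size m)"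
    by (intro sum.cong arg_cong2[where f = sum]) auto
  also have "\<dots> \<le> (\<Sum>j=k..n. (real CARD('d) * x) ^ j)"
    by (intro sum_mono sum_size_eq_power_le assms)
  also have "\<dots> \<le> 2 * (real CARD('d) * x) ^ k"
    by (rule sum_finite_geometric_le) (use assms in auto)
  finally show ?thesis .
qed

text \<open>There are at most \<open>d ^ n\<close> multi-indices of degree \<open>n\<close>, so the series converges for \<open>d x < 1\<close>; the
  condition \<open>d x \<le> 1/2\<close> gives a bound without parameters.\<close>

lemma multisets_geometric_summable:
  assumes "(0::real) \<le> x" "real CARD('d::finite) * x \<le> 1/2"
  shows "(\<lambda>m :: 'd multiset. x ^ size m) summable_on UNIV"
    and "(\<Sum>\<^sub>\<infinity>m :: 'd multiset. x ^ size m) \<le> 2"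
proof -
  have bound: "(\<Sum>m\<in>F. x ^ size m) \<le> 2" if F: "finite F" for F :: "'d multiset set"
  proof -
    obtain n where n: "\<And>m. m \<in> F \<Longrightarrow> size m \<le> n"
      using finite_imageI[OF F, of size] by (auto simp: finite_nat_set_iff_bounded_le)
    have "(\<Sum>m\<in>F. x ^ size m) \<le> (\<Sum>m | 0 \<le> size (m :: 'd multiset) \<and> size m \<le> n. x ^ size m)"
      using assms n by (intro sum_mono2) auto
    also have "\<dots> \<le> 2" using sum_multisets_geometric_le[where 'd='d, OF assms, of 0 n] by simp
    finally show ?thesis .
  qed
  show summable: "(\<lambda>m :: 'd multiset. x ^ size m) summable_on UNIV"
    by (rule nonneg_bdd_above_summable_on) (use assms bound in \<open>auto intro!: bdd_aboveI[where M = 2]\<close>)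
  show "(\<Sum>\<^sub>\<infinity>m :: 'd multiset. x ^ size m) \<le> 2"
    by (rule infsum_le_finite_sums[OF summable]) (use bound in auto)
qed

definition monom_val :: "complex ^ ('d::finite) \<Rightarrow> 'd multiset \<Rightarrow> complex" where
  "monom_val \<omega> m = (\<Prod>i\<in>#m. \<omega> $ i)"

lemma monom_val_empty [simp]: "monom_val \<omega> {#} = 1"
  and monom_val_add_mset [simp]: "monom_val \<omega> (add_mset i m) = \<omega> $ i * monom_val \<omega> m"
  and monom_val_plus: "monom_val \<omega> (m + m') = monom_val \<omega> m * monom_val \<omega> m'"
  by (simp_all add: monom_val_def)

lemma monom_val_mset: "monom_val \<omega> (mset l) = (\<Prod>i\<leftarrow>l. \<omega> $ i)"
  by (induction l) auto

lemma monom_val_replicate: "monom_val \<omega> (replicate_mset n i) = (\<omega> $ i) ^ n"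
  by (induction n) auto

lemma monom_val_le:
  assumes "\<And>i. cmod (\<omega> $ i) \<le> R"
  shows "cmod (monom_val \<omega> m) \<le> R ^ size m"
  using assms
  by (induction m) (auto simp: norm_mult intro!: mult_mono order_trans[OF norm_ge_zero])

lemma monom_val_eq_prod: "monom_val \<omega> m = (\<Prod>i\<in>UNIV. (\<omega> $ i) ^ count m i)"
proof (induction m)
  case (add j m)
  have "(\<Prod>i\<in>UNIV. (\<omega> $ i) ^ count (add_mset j m) i) =
        (\<Prod>i\<in>UNIV. (if i = j then \<omega> $ i else 1) * (\<omega> $ i) ^ count m i)"
    by (intro prod.cong) auto
  also have "\<dots> = \<omega> $ j * (\<Prod>i\<in>UNIV. (\<omega> $ i) ^ count m i)"
    by (subst prod.distrib) simp
  finally show ?case using add by simp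
qed simp


section \<open>Formal power series and substitution\<close>

lemma mcoeff_minus: "mcoeff (F - G) m = mcoeff F m - mcoeff G m"
  and mcoeff_zero [simp]: "mcoeff 0 m = 0"
  and mcoeff_one: "mcoeff 1 m = (if m = {#} then 1 else 0)"
  and mcoeff_times: "mcoeff (F * G) m = (\<Sum>(a, b) | a + b = m. mcoeff F a * mcoeff G b)"
  by (simp_all add: minus_mps_def zero_mps_def one_mps_def times_mps_def)

lemma mcoeff_const_times: "mcoeff (mps_const c * F) m = c * mcoeff F m"
proof -
  have "mcoeff (mps_const c * F) m = (\<Sum>x | fst x + snd x = m. if x = ({#}, m) then c * mcoeff F m else 0)"
    unfolding mcoeff_times mps_const_def mcoeff_Abs by (intro sum.cong) (auto split: if_splits)
  also have "\<dots> = c * mcoeff F m"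
  proof (subst sum.delta)
    have "{x. fst x + snd x = m} = {(a, b). a + b = m}" by auto
    then show "finite {x. fst x + snd x = m}" by simp
  qed simp
  finally show ?thesis .
qed

definition mps_var :: "'d \<Rightarrow> 'd mps" where
  "mps_var i = Abs_mps (\<lambda>m. if m = {#i#} then 1 else 0)"

lemma mcoeff_var: "mcoeff (mps_var i) m = (if m = {#i#} then 1 else 0)"
  by (simp add: mps_var_def)

text \<open>The power \<open>A(\<xi>)\<^sup>k\<close> for a multi-index \<open>k\<close> and a tuple of series \<open>A\<close>.\<close>

definition multi_pow :: "('d \<Rightarrow> 'd mps) \<Rightarrow> 'd multiset \<Rightarrow> 'd mps" where
  "multi_pow A k = (\<Prod>i\<in>#k. A i)"

lemma multi_pow_empty [simp]: "multi_pow A {#} = 1"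
  and multi_pow_add_mset [simp]: "multi_pow A (add_mset i k) = A i * multi_pow A k"
  and multi_pow_plus: "multi_pow A (k + k') = multi_pow A k * multi_pow A k'"
  by (simp_all add: multi_pow_def)

lemma multi_pow_mset: "multi_pow A (mset l) = (\<Prod>i\<leftarrow>l. A i)"
  by (induction l) auto

lemma multi_pow_var: "mcoeff (multi_pow mps_var k) m = (if m = k then 1 else 0)"
proof (induction k arbitrary: m)
  case (add i k)
  have "mcoeff (multi_pow mps_var (add_mset i k)) m =
        (\<Sum>x\<in>{(a, b). a + b = m}. if x = ({#i#}, k) then 1 else 0)"
    unfolding multi_pow_add_mset mcoeff_times mcoeff_var add
    by (intro sum.cong) (auto split: if_splits)
  also have "\<dots> = (if ({#i#}, k) \<in> {(a, b). a + b = m} then 1 else 0)"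
    by (rule sum.delta) simp
  finally show ?case by auto
qed (simp add: mcoeff_one)

text \<open>Tuples \<open>A(\<xi>) = \<xi> + \<close> terms of degree at least 2. Substitution of such a tuple acts on coefficients by a
  unipotent triangular matrix.\<close>

definition tangent_to_id :: "('d \<Rightarrow> 'd mps) \<Rightarrow> bool" where
  "tangent_to_id A \<longleftrightarrow> (\<forall>i m. size m \<le> 1 \<longrightarrow> mcoeff (A i) m = mcoeff (mps_var i) m)"

lemma tangent_to_id_const: "tangent_to_id A \<Longrightarrow> mcoeff (A i) {#} = 0"
  by (simp add: tangent_to_id_def mcoeff_var)

lemma tangent_to_id_var: "tangent_to_id mps_var"
  by (simp add: tangent_to_id_def)

text \<open>Each factor of \<open>A\<^sup>k\<close> has order 1, so in degree at most \<open>size k\<close> only the product of the linear parts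
  survives.\<close>

lemma mcoeff_multi_pow_low_order:
  assumes A: "tangent_to_id A" and "size m \<le> size k"
  shows "mcoeff (multi_pow A k) m = (if m = k then 1 else 0)"
  using assms(2)
proof (induction k arbitrary: m)
  case (add i k)
  have "mcoeff (A i) a * mcoeff (multi_pow A k) b = (if (a, b) = ({#i#}, k) then 1 else 0)"
    if "a + b = m" for a b
  proof (cases "size b \<le> size k")
    case True
    show ?thesis
    proof (cases "b = k")
      case True
      then have "size a \<le> 1" using add.prems that by auto
      then show ?thesis using A True add.IH[of b] by (simp add: tangent_to_id_def mcoeff_var)
    qed (use True add.IH in simp)
  next
    case False
    moreover have "size a + size b \<le> Suc (size k)" using add.prems that by auto
    ultimately have "size a = 0" by linarith
    then have "a = {#}" by simp
    then show ?thesis using tangent_to_id_const[OF A] by simp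
  qed
  then have "mcoeff (multi_pow A (add_mset i k)) m =
        (\<Sum>x\<in>{(a, b). a + b = m}. if x = ({#i#}, k) then 1 else 0)"
    unfolding multi_pow_add_mset mcoeff_times by (intro sum.cong) (auto split: if_splits)
  also have "\<dots> = (if ({#i#}, k) \<in> {(a, b). a + b = m} then 1 else 0)"
    by (rule sum.delta) simp
  finally show ?case by auto
qed (auto simp: mcoeff_one)

lemma mcoeff_multi_pow_eq_0:
  assumes "tangent_to_id A" "size m < size k"
  shows "mcoeff (multi_pow A k) m = 0"
  using mcoeff_multi_pow_low_order[OF assms(1), of m k] assms(2) by auto

lemma mcoeff_multi_pow_mult_eq_0:
  assumes "tangent_to_id A" "size m < size k"
  shows "mcoeff (multi_pow A k * F) m = 0"
  unfolding mcoeff_times using assms by (auto intro!: sum.neutral mcoeff_multi_pow_eq_0)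

text \<open>\<open>F(A(\<xi>))\<close>; as in the definition of the exponential, exponents \<open>k\<close> with
  \<open>size k > size m\<close> cannot contribute to the coefficient at \<open>m\<close>.\<close>

definition mps_subst :: "(('d::finite) \<Rightarrow> 'd mps) \<Rightarrow> 'd mps \<Rightarrow> 'd mps" where
  "mps_subst A F = Abs_mps (\<lambda>m. \<Sum>k | size k \<le> size m. mcoeff F k * mcoeff (multi_pow A k) m)"

lemma mcoeff_subst:
  assumes "tangent_to_id A" "size m \<le> n"
  shows "mcoeff (mps_subst A F) m = (\<Sum>k | size k \<le> n. mcoeff F k * mcoeff (multi_pow A k) m)"
  unfolding mps_subst_def mcoeff_Abs
  using assms by (intro sum.mono_neutral_left) (auto simp: mcoeff_multi_pow_eq_0)

lemma mcoeff_subst_times: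
  assumes A: "tangent_to_id A" and "size m \<le> n"
  shows "mcoeff (mps_subst A F * G) m = (\<Sum>k | size k \<le> n. mcoeff F k * mcoeff (multi_pow A k * G) m)"
proof -
  have "mcoeff (mps_subst A F * G) m = (\<Sum>x | fst x + snd x = m.
      (\<Sum>k | size k \<le> n. mcoeff F k * mcoeff (multi_pow A k) (fst x)) * mcoeff G (snd x))"
    unfolding mcoeff_times using assms
    by (intro sum.cong) (auto simp: mcoeff_subst[OF A, where n = n])
  also have "\<dots> = (\<Sum>k | size k \<le> n. \<Sum>x | fst x + snd x = m.
      mcoeff F k * (mcoeff (multi_pow A k) (fst x) * mcoeff G (snd x)))"
    unfolding sum_distrib_right by (subst sum.swap) (simp add: mult_ac)
  also have "{x. fst x + snd x = m} = {(a, b). a + b = m}" by auto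
  finally show ?thesis
    by (simp add: mcoeff_times sum_distrib_left case_prod_beta)
qed

lemma mps_subst_one: "tangent_to_id A \<Longrightarrow> mps_subst A 1 = 1"
proof (rule mps_eqI)
  fix m :: "'a multiset" assume A: "tangent_to_id A"
  have "mcoeff (mps_subst A 1) m = (\<Sum>k :: 'a multiset | size k \<le> size m. if k = {#} then mcoeff 1 m else 0)"
    unfolding mps_subst_def mcoeff_Abs by (intro sum.cong) (auto simp: mcoeff_one)
  then show "mcoeff (mps_subst A 1) m = mcoeff 1 m" by simp
qed

lemma mps_subst_var: 
  assumes A: "tangent_to_id A"
  shows "mps_subst A (mps_var i) = A i"
proof (rule mps_eqI)
  fix m :: "'a multiset"
  have "mcoeff (mps_subst A (mps_var i)) m = (\<Sum>k :: 'a multiset | size k \<le> Suc (size m). if k = {#i#} then mcoeff (A i) m else 0)"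
    unfolding mcoeff_subst[OF A, of m "Suc (size m)" "mps_var i", simplified]
    by (intro sum.cong) (auto simp: mcoeff_var)
  then show "mcoeff (mps_subst A (mps_var i)) m = mcoeff (A i) m" by simp
qed

lemma mps_subst_minus: "mps_subst A (F - G) = mps_subst A F - mps_subst A G"
  by (rule mps_eqI) (simp add: mps_subst_def mcoeff_minus algebra_simps sum_subtractf)

text \<open>Collect the pairs \<open>(a, b)\<close> of exponents of the two factors by their sum \<open>k\<close>, and use \<open>A\<^bsup>a + b\<^esup> = A\<^sup>a A\<^sup>b\<close>. The
  pairs with \<open>size (a + b) > size m\<close>, present on the right-hand side only, do not contribute.\<close>

lemma mps_subst_mult:
  assumes A: "tangent_to_id A"
  shows "mps_subst A (F * G) = mps_subst A F * mps_subst A G"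
proof (rule mps_eqI)
  fix m :: "'a multiset"
  let ?n = "size m"
  let ?f = "\<lambda>(a, b). mcoeff F a * mcoeff G b * mcoeff (multi_pow A (a + b)) m"
  have "mcoeff (mps_subst A (F * G)) m =
      (\<Sum>k | size k \<le> ?n. \<Sum>x\<in>{(a, b). a + b = k}. ?f x)"
    by (auto simp: mps_subst_def mcoeff_times sum_distrib_right intro!: sum.cong)
  also have "\<dots> = (\<Sum>y\<in>Sigma {k. size k \<le> ?n} (\<lambda>k. {(a, b). a + b = k}). ?f (snd y))"
    by (subst sum.Sigma) (auto simp: case_prod_beta)
  also have "\<dots> = (\<Sum>x\<in>{x. size (fst x) + size (snd x) \<le> ?n}. ?f x)"
    by (rule sum.reindex_bij_witness[of _ "\<lambda>x. (fst x + snd x, x)" snd]) auto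
  also have "\<dots> = (\<Sum>x\<in>{a. size a \<le> ?n} \<times> {b. size b \<le> ?n}. ?f x)"
  proof (intro sum.mono_neutral_left finite_cartesian_product ballI)
    fix x :: "'a multiset \<times> 'a multiset"
    assume "x \<in> {a. size a \<le> ?n} \<times> {b. size b \<le> ?n} - {x. size (fst x) + size (snd x) \<le> ?n}"
    then have "size m < size (fst x + snd x)" by auto
    then show "?f x = 0" by (simp only: case_prod_beta mcoeff_multi_pow_eq_0[OF A] mult_zero_right)
  qed auto
  also have "\<dots> = (\<Sum>a | size a \<le> ?n. \<Sum>b | size b \<le> ?n. ?f (a, b))"
    by (simp add: sum.cartesian_product)
  also have "\<dots> = (\<Sum>a | size a \<le> ?n. mcoeff F a * mcoeff (mps_subst A G * multi_pow A a) m)"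
    by (auto simp: mcoeff_subst_times[OF A order_refl] sum_distrib_left multi_pow_plus mult_ac intro!: sum.cong)
  also have "\<dots> = mcoeff (mps_subst A F * mps_subst A G) m"
    by (simp add: mcoeff_subst_times[OF A order_refl] mult.commute)
  finally show "mcoeff (mps_subst A (F * G)) m = mcoeff (mps_subst A F * mps_subst A G) m" .
qed

lemma mps_subst_multi_pow:
  assumes A: "tangent_to_id A"
  shows "mps_subst A (multi_pow B k) = multi_pow (\<lambda>i. mps_subst A (B i)) k"
  by (induction k) (simp_all add: mps_subst_one[OF A] mps_subst_mult[OF A])

lemma mps_subst_id: "mps_subst mps_var F = F"
  by (rule mps_eqI) (simp add: mps_subst_def multi_pow_var if_distrib[of "\<lambda>x. _ * x"] cong: if_cong)

lemma mps_subst_subst: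
  assumes A: "tangent_to_id A" and B: "tangent_to_id B"
  shows "mps_subst B (mps_subst A F) = mps_subst (\<lambda>i. mps_subst B (A i)) F"
proof (rule mps_eqI)
  fix m :: "'a multiset"
  let ?n = "size m"
  have "mcoeff (mps_subst B (mps_subst A F)) m =
     (\<Sum>k | size k \<le> ?n. (\<Sum>j | size j \<le> ?n. mcoeff F j * mcoeff (multi_pow A j) k) * mcoeff (multi_pow B k) m)"
    unfolding mps_subst_def[of B] mcoeff_Abs
    by (intro sum.cong) (auto simp: mcoeff_subst[OF A])
  also have "\<dots> = (\<Sum>j | size j \<le> ?n. mcoeff F j * mcoeff (mps_subst B (multi_pow A j)) m)"
    unfolding sum_distrib_right mps_subst_def[of B] mcoeff_Abs sum_distrib_left
    by (subst sum.swap) (simp add: mult_ac)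
  also have "\<dots> = mcoeff (mps_subst (\<lambda>i. mps_subst B (A i)) F) m"
    unfolding mps_subst_multi_pow[OF B] by (simp add: mps_subst_def)
  finally show "mcoeff (mps_subst B (mps_subst A F)) m = mcoeff (mps_subst (\<lambda>i. mps_subst B (A i)) F) m" .
qed

text \<open>The coefficients of the compositional inverse: \<open>B(A(\<xi>)) = \<xi>\<close> is a linear system for \<open>B\<close>
  with a unipotent triangular matrix, solved degree by degree.\<close>

function inverse_coeff :: "(('d::finite) \<Rightarrow> 'd mps) \<Rightarrow> 'd \<Rightarrow> 'd multiset \<Rightarrow> complex" where
  "inverse_coeff A i m = mcoeff (mps_var i) m -
     (\<Sum>k | size k < size m. inverse_coeff A i k * mcoeff (multi_pow A k) m)"
  by auto
termination by (relation "Wellfounded.measure (\<lambda>(A, i, m). size m)") auto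

declare inverse_coeff.simps [simp del]

lemma exists_left_compositional_inverse:
  assumes A: "tangent_to_id A"
  obtains B where "tangent_to_id B" "\<And>i. mps_subst A (B i) = mps_var i"
proof
  let ?B = "\<lambda>i. Abs_mps (inverse_coeff A i)"
  have empty: "inverse_coeff A i {#} = 0" for i
    by (subst inverse_coeff.simps) (simp add: mcoeff_var)
  show "tangent_to_id ?B"
    unfolding tangent_to_id_def mcoeff_Abs
  proof (intro allI impI)
    fix i and m :: "'a multiset"
    assume "size m \<le> 1"
    then have "(\<Sum>k | size k < size m. inverse_coeff A i k * mcoeff (multi_pow A k) m) = 0"
    proof (intro sum.neutral ballI)
      fix k :: "'a multiset" assume "k \<in> {k. size k < size m}"
      then have "size k < size m" by simp
      with \<open>size m \<le> 1\<close> have "size k = 0" by linarith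
      then have "k = {#}" by simp
      then show "inverse_coeff A i k * mcoeff (multi_pow A k) m = 0" by (simp add: empty)
    qed
    then show "inverse_coeff A i m = mcoeff (mps_var i) m"
      by (subst inverse_coeff.simps) simp
  qed
  show "mps_subst A (?B i) = mps_var i" for i
  proof (rule mps_eqI)
    fix m :: "'a multiset"
    have split: "{k :: 'a multiset. size k \<le> size m} = {k. size k < size m} \<union> {k. size k = size m}"
      by auto
    have "mcoeff (mps_subst A (?B i)) m =
      (\<Sum>k | size k < size m. inverse_coeff A i k * mcoeff (multi_pow A k) m) +
      (\<Sum>k | size k = size m. inverse_coeff A i k * mcoeff (multi_pow A k) m)"
      unfolding mps_subst_def mcoeff_Abs split by (rule sum.union_disjoint) auto
    also have "(\<Sum>k | size k = size m. inverse_coeff A i k * mcoeff (multi_pow A k) m) =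
      (\<Sum>k | size k = size m. if k = m then inverse_coeff A i m else 0)"
      by (intro sum.cong) (auto simp: mcoeff_multi_pow_low_order[OF A])
    also have "\<dots> = inverse_coeff A i m" by simp
    finally show "mcoeff (mps_subst A (?B i)) m = mcoeff (mps_var i) m"
      by (subst (asm) (2) inverse_coeff.simps) simp
  qed
qed

text \<open>A left inverse in the group of substitutions is two-sided: the left inverse \<open>B\<close> has a left
  inverse itself, which must be \<open>A\<close>.\<close>

lemma exists_compositional_inverse:
  assumes A: "tangent_to_id A"
  obtains B where "tangent_to_id B" "\<And>i. mps_subst A (B i) = mps_var i" "\<And>i. mps_subst B (A i) = mps_var i"
proof -
  obtain B where B: "tangent_to_id B" and BA: "\<And>i. mps_subst A (B i) = mps_var i"
    using exists_left_compositional_inverse[OF A] by blast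
  obtain C where C: "tangent_to_id C" and CB: "\<And>i. mps_subst B (C i) = mps_var i"
    using exists_left_compositional_inverse[OF B] by blast
  have "A i = C i" for i
  proof -
    have "A i = mps_subst (\<lambda>j. mps_subst A (B j)) (C i)"
      using mps_subst_subst[OF B A, of "C i"] CB A by (simp add: mps_subst_var)
    then show ?thesis by (simp add: BA mps_subst_id)
  qed
  then show ?thesis using that B BA CB by simp
qed

section \<open>Truncated majorant norms\<close>

text \<open>The weighted \<open>\<ell>\<^sup>1\<close> norm of the part of degree at most \<open>n\<close>. Truncation makes it finite for every
  formal series; a bound that is uniform in \<open>n\<close> says that the series converges absolutely on the
  polydisc of radius \<open>r\<close>.\<close>

definition trunc_norm :: "nat \<Rightarrow> real \<Rightarrow> ('d::finite) mps \<Rightarrow> real" where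
  "trunc_norm n r F = (\<Sum>m | size m \<le> n. cmod (mcoeff F m) * r ^ size m)"

lemma trunc_norm_nonneg: "r \<ge> 0 \<Longrightarrow> trunc_norm n r F \<ge> 0"
  unfolding trunc_norm_def by (intro sum_nonneg) auto

lemma mcoeff_le_trunc_norm:
  assumes "r \<ge> 0" "size m \<le> n"
  shows "cmod (mcoeff F m) * r ^ size m \<le> trunc_norm n r F"
  unfolding trunc_norm_def
  by (rule member_le_sum[where f = "\<lambda>m. cmod (mcoeff F m) * r ^ size m"]) (use assms in auto)

lemma trunc_norm_one: "trunc_norm n r 1 = 1"
proof -
  have "trunc_norm n r (1 :: 'a mps) = (\<Sum>m :: 'a multiset | size m \<le> n. if m = {#} then 1 else 0)"
    unfolding trunc_norm_def by (intro sum.cong) (auto simp: mcoeff_one)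
  then show ?thesis by simp
qed

lemma trunc_norm_var: "r \<ge> 0 \<Longrightarrow> trunc_norm n r (mps_var i) \<le> r"
proof -
  assume "r \<ge> 0"
  have "trunc_norm n r (mps_var i) = (\<Sum>m | size m \<le> n. if m = {#i#} then r else 0)"
    unfolding trunc_norm_def by (intro sum.cong) (auto simp: mcoeff_var)
  with \<open>r \<ge> 0\<close> show ?thesis by simp
qed

lemma trunc_norm_minus:
  assumes "r \<ge> 0"
  shows "trunc_norm n r (F - G) \<le> trunc_norm n r F + trunc_norm n r G"
  unfolding trunc_norm_def mcoeff_minus sum.distrib[symmetric] distrib_right[symmetric]
  using assms by (intro sum_mono mult_right_mono norm_triangle_ineq4) auto

text \<open>Submultiplicativity, with the sets \<open>X\<close> and \<open>Y\<close> of exponents on which the factors are really evaluated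
  left open; the two choices below are what the estimates use.\<close>

lemma trunc_norm_times_aux:
  assumes r: "r \<ge> 0" and fin: "finite X" "finite Y"
    and XY: "\<And>a b. size a + size b \<le> n \<Longrightarrow> mcoeff F a \<noteq> 0 \<Longrightarrow> mcoeff G b \<noteq> 0 \<Longrightarrow> a \<in> X \<and> b \<in> Y"
  shows "trunc_norm n r (F * G) \<le>
    (\<Sum>a\<in>X. cmod (mcoeff F a) * r ^ size a) * (\<Sum>b\<in>Y. cmod (mcoeff G b) * r ^ size b)"
proof -
  let ?f = "\<lambda>(a, b). (cmod (mcoeff F a) * r ^ size a) * (cmod (mcoeff G b) * r ^ size b)"
  have nonneg: "?f x \<ge> 0" for x using r by (auto simp: case_prod_beta)
  have "trunc_norm n r (F * G) \<le> (\<Sum>m | size m \<le> n. \<Sum>x\<in>{(a, b). a + b = m}. ?f x)"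
    unfolding trunc_norm_def
  proof (rule sum_mono)
    fix m :: "'a multiset"
    have "cmod (mcoeff (F * G) m) * r ^ size m \<le>
          (\<Sum>x\<in>{(a, b). a + b = m}. cmod (mcoeff F (fst x) * mcoeff G (snd x))) * r ^ size m"
      unfolding mcoeff_times case_prod_beta using r by (intro mult_right_mono norm_sum) auto
    also have "\<dots> = (\<Sum>x\<in>{(a, b). a + b = m}. ?f x)"
      unfolding sum_distrib_right by (intro sum.cong) (auto simp: norm_mult power_add)
    finally show "cmod (mcoeff (F * G) m) * r ^ size m \<le> (\<Sum>x\<in>{(a, b). a + b = m}. ?f x)" .
  qed
  also have "\<dots> = (\<Sum>y\<in>Sigma {m. size m \<le> n} (\<lambda>m. {(a, b). a + b = m}). ?f (snd y))"
    by (subst sum.Sigma) (auto simp: case_prod_beta)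
  also have "\<dots> = (\<Sum>x\<in>{x. size (fst x) + size (snd x) \<le> n}. ?f x)"
    by (rule sum.reindex_bij_witness[of _ "\<lambda>x. (fst x + snd x, x)" snd]) auto
  also have "\<dots> = (\<Sum>x\<in>{x. size (fst x) + size (snd x) \<le> n} \<inter> (X \<times> Y). ?f x)"
  proof (rule sum.mono_neutral_right)
    show "finite {x :: 'a multiset \<times> 'a multiset. size (fst x) + size (snd x) \<le> n}"
      by (rule finite_subset[of _ "{a. size a \<le> n} \<times> {b. size b \<le> n}"]) auto
    show "\<forall>x\<in>{x. size (fst x) + size (snd x) \<le> n} - {x. size (fst x) + size (snd x) \<le> n} \<inter> X \<times> Y. ?f x = 0"
    proof
      fix x assume x: "x \<in> {x. size (fst x) + size (snd x) \<le> n} - {x. size (fst x) + size (snd x) \<le> n} \<inter> X \<times> Y"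
      then have "mcoeff F (fst x) = 0 \<or> mcoeff G (snd x) = 0"
        using XY[of "fst x" "snd x"] by (cases x) auto
      then show "?f x = 0" by (auto simp: case_prod_beta)
    qed
  qed auto
  also have "\<dots> \<le> (\<Sum>x\<in>X \<times> Y. ?f x)"
    using nonneg fin by (intro sum_mono2) auto
  also have "\<dots> = (\<Sum>a\<in>X. cmod (mcoeff F a) * r ^ size a) * (\<Sum>b\<in>Y. cmod (mcoeff G b) * r ^ size b)"
    by (simp add: sum_product sum.cartesian_product)
  finally show ?thesis .
qed

lemma trunc_norm_times:
  assumes "r \<ge> 0"
  shows "trunc_norm n r (F * G) \<le> trunc_norm n r F * trunc_norm n r G"
  using trunc_norm_times_aux[OF assms, of "{a. size a \<le> n}" "{a. size a \<le> n}" n F G]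
  by (simp add: trunc_norm_def)

text \<open>If both factors have no constant term, the coefficients of degree up to \<open>n + 1\<close> of the product
  only involve those of degree up to \<open>n\<close> of the factors. This is what makes the induction in the
  bound for the compositional inverse below possible.\<close>

lemma trunc_norm_times_Suc:
  assumes "r \<ge> 0" "mcoeff F {#} = 0" "mcoeff G {#} = 0"
  shows "trunc_norm (Suc n) r (F * G) \<le> trunc_norm n r F * trunc_norm n r G"
  unfolding trunc_norm_def[of n]
proof (rule trunc_norm_times_aux[OF \<open>r \<ge> 0\<close>])
  fix a b assume *: "size a + size b \<le> Suc n" "mcoeff F a \<noteq> 0" "mcoeff G b \<noteq> 0"
  then have "a \<noteq> {#}" "b \<noteq> {#}" using assms by auto
  then have "size a > 0" "size b > 0" by (simp_all add: nonempty_has_size)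
  then show "a \<in> {m. size m \<le> n} \<and> b \<in> {m. size m \<le> n}" using * by auto
qed auto

lemma trunc_norm_multi_pow:
  assumes "r \<ge> 0" "\<And>i. trunc_norm n r (A i) \<le> s"
  shows "trunc_norm n r (multi_pow A k) \<le> s ^ size k"
proof (induction k)
  case (add i k)
  have "trunc_norm n r (A i * multi_pow A k) \<le> trunc_norm n r (A i) * trunc_norm n r (multi_pow A k)"
    by (rule trunc_norm_times) fact
  also have "\<dots> \<le> s * s ^ size k"
    using assms(1) by (intro mult_mono add assms(2) trunc_norm_nonneg order_trans[OF trunc_norm_nonneg assms(2)])
  finally show ?case by simp
qed (simp add: trunc_norm_one)

lemma trunc_norm_multi_pow_Suc:
  assumes "r \<ge> 0" "\<And>i. trunc_norm n r (A i) \<le> s" "\<And>i. mcoeff (A i) {#} = 0" "2 \<le> size k"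
  shows "trunc_norm (Suc n) r (multi_pow A k) \<le> s ^ size k"
proof -
  obtain i k' where k: "k = add_mset i k'" using assms(4) by (cases k) auto
  obtain j k'' where k': "k' = add_mset j k''" using assms(4) k by (cases k') auto
  have "mcoeff (multi_pow A k') {#} = 0"
    unfolding k' multi_pow_add_mset mcoeff_times using assms(3) by (auto intro!: sum.neutral)
  then have "trunc_norm (Suc n) r (A i * multi_pow A k') \<le> trunc_norm n r (A i) * trunc_norm n r (multi_pow A k')"
    using assms by (intro trunc_norm_times_Suc) auto
  also have "\<dots> \<le> s * s ^ size k'"
    using assms(1) by (intro mult_mono trunc_norm_multi_pow assms(2) trunc_norm_nonneg
        order_trans[OF trunc_norm_nonneg assms(2)])
  finally show ?thesis by (simp add: k)
qed

text \<open>The bound on the powers is a hypothesis, because it is available in two ways: from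
  \<open>trunc_norm_multi_pow\<close>, and from \<open>trunc_norm_multi_pow_Suc\<close> if only powers of order at least 2 occur in \<open>F\<close>.\<close>

lemma trunc_norm_subst_le:
  assumes A: "tangent_to_id A" and r: "r \<ge> 0"
    and le: "\<And>k. size k \<le> n \<Longrightarrow> mcoeff F k \<noteq> 0 \<Longrightarrow> trunc_norm n r (multi_pow A k) \<le> s ^ size k"
  shows "trunc_norm n r (mps_subst A F) \<le> trunc_norm n s F"
proof -
  have "trunc_norm n r (mps_subst A F) \<le>
    (\<Sum>m | size m \<le> n. \<Sum>k | size k \<le> n. cmod (mcoeff F k) * (cmod (mcoeff (multi_pow A k) m) * r ^ size m))"
    unfolding trunc_norm_def
  proof (rule sum_mono)
    fix m :: "'a multiset" assume "m \<in> {m. size m \<le> n}"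
    then have eq: "mcoeff (mps_subst A F) m = (\<Sum>k | size k \<le> n. mcoeff F k * mcoeff (multi_pow A k) m)"
      by (intro mcoeff_subst[OF A]) simp
    have "cmod (mcoeff (mps_subst A F) m) * r ^ size m \<le>
        (\<Sum>k | size k \<le> n. cmod (mcoeff F k * mcoeff (multi_pow A k) m)) * r ^ size m"
      unfolding eq using r by (intro mult_right_mono norm_sum) auto
    then show "cmod (mcoeff (mps_subst A F) m) * r ^ size m \<le>
        (\<Sum>k | size k \<le> n. cmod (mcoeff F k) * (cmod (mcoeff (multi_pow A k) m) * r ^ size m))"
      by (simp add: sum_distrib_right norm_mult mult.assoc)
  qed
  also have "\<dots> = (\<Sum>k | size k \<le> n. cmod (mcoeff F k) * trunc_norm n r (multi_pow A k))"
    unfolding trunc_norm_def sum_distrib_left by (rule sum.swap)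
  also have "\<dots> \<le> (\<Sum>k | size k \<le> n. cmod (mcoeff F k) * s ^ size k)"
  proof (rule sum_mono)
    fix k :: "'a multiset" assume "k \<in> {k. size k \<le> n}"
    then show "cmod (mcoeff F k) * trunc_norm n r (multi_pow A k) \<le> cmod (mcoeff F k) * s ^ size k"
      using le[of k] by (cases "mcoeff F k = 0") (auto intro!: mult_left_mono)
  qed
  finally show ?thesis by (simp add: trunc_norm_def)
qed

text \<open>Geometric growth of the coefficients, i.e. convergence near 0; all bounds derived from it hold for all
  sufficiently small radii, whence the filter \<open>at_right 0\<close>.\<close>

definition analytic_series :: "'d mps \<Rightarrow> bool" where
  "analytic_series F \<longleftrightarrow> (\<exists>K R. 0 \<le> K \<and> 0 < R \<and> (\<forall>m. cmod (mcoeff F m) \<le> K * R ^ size m))"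

lemma analytic_series_var: "analytic_series (mps_var i)"
  unfolding analytic_series_def by (intro exI[of _ 1]) (auto simp: mcoeff_var)

lemma analytic_series_one: "analytic_series 1"
  unfolding analytic_series_def by (intro exI[of _ 1]) (auto simp: mcoeff_one)

lemma analytic_series_minus:
  assumes "analytic_series F" "analytic_series G"
  shows "analytic_series (F - G)"
proof -
  obtain K R K' R' where *: "0 \<le> K" "0 < R" "\<And>m. cmod (mcoeff F m) \<le> K * R ^ size m"
      "0 \<le> K'" "0 < R'" "\<And>m. cmod (mcoeff G m) \<le> K' * R' ^ size m"
    using assms unfolding analytic_series_def by blast
  have "cmod (mcoeff (F - G) m) \<le> (K + K') * (max R R') ^ size m" for m
  proof -
    have "cmod (mcoeff (F - G) m) \<le> cmod (mcoeff F m) + cmod (mcoeff G m)"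
      unfolding mcoeff_minus by (rule norm_triangle_ineq4)
    also have "\<dots> \<le> K * R ^ size m + K' * R' ^ size m"
      by (intro add_mono *)
    also have "\<dots> \<le> K * (max R R') ^ size m + K' * (max R R') ^ size m"
      using * by (intro add_mono mult_left_mono power_mono) auto
    finally show ?thesis by (simp add: distrib_right)
  qed
  then show ?thesis
    unfolding analytic_series_def using * by (intro exI[of _ "K + K'"] exI[of _ "max R R'"]) auto
qed

text \<open>For a small radius the majorant is dominated by a geometric series that starts at the order \<open>k\<close>.\<close>

lemma analytic_series_trunc_norm:
  fixes F :: "('d::finite) mps"
  assumes "analytic_series F" and order: "\<And>m. size m < k \<Longrightarrow> mcoeff F m = 0"
  obtains K where "K > 0" "\<forall>\<^sub>F r in at_right 0. \<forall>n. trunc_norm n r F \<le> K * r ^ k"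
proof -
  obtain K R where K: "0 \<le> K" "0 < R" and le: "\<And>m. cmod (mcoeff F m) \<le> K * R ^ size m"
    using assms unfolding analytic_series_def by blast
  let ?d = "real CARD('d)"
  have "trunc_norm n r F \<le> (2 * K * (?d * R) ^ k + 1) * r ^ k"
    if r: "0 < r" "r < 1 / (2 * ?d * R)" for r n
  proof -
    have small: "?d * (R * r) \<le> 1/2" using r K by (simp add: field_simps)
    have "trunc_norm n r F = (\<Sum>m | k \<le> size m \<and> size m \<le> n. cmod (mcoeff F m) * r ^ size m)"
      unfolding trunc_norm_def by (rule sum.mono_neutral_right) (auto simp: order)
    also have "\<dots> \<le> (\<Sum>m | k \<le> size (m :: 'd multiset) \<and> size m \<le> n. K * (R * r) ^ size m)"
    proof (rule sum_mono)
      fix m :: "'d multiset"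
      show "cmod (mcoeff F m) * r ^ size m \<le> K * (R * r) ^ size m"
        using mult_right_mono[OF le, of "r ^ size m" m] r by (simp add: power_mult_distrib mult.assoc)
    qed
    also have "\<dots> \<le> K * (2 * (?d * (R * r)) ^ k)"
      unfolding sum_distrib_left[symmetric] using K r small
      by (intro mult_left_mono sum_multisets_geometric_le) auto
    also have "\<dots> \<le> (2 * K * (?d * R) ^ k + 1) * r ^ k"
      using r by (simp add: power_mult_distrib algebra_simps)
    finally show ?thesis .
  qed
  moreover have "1 / (2 * ?d * R) > 0" using K by simp
  ultimately have "\<forall>\<^sub>F r in at_right 0. \<forall>n. trunc_norm n r F \<le> (2 * K * (?d * R) ^ k + 1) * r ^ k"
    unfolding eventually_at_right_field by blast
  then show thesis using K by (intro that[of "2 * K * (?d * R) ^ k + 1"]) (auto intro: add_nonneg_pos)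
qed

lemma analytic_series_bounded:
  assumes "analytic_series F"
  obtains K where "K > 0" "\<forall>\<^sub>F r in at_right 0. \<forall>n. trunc_norm n r F \<le> K"
  using analytic_series_trunc_norm[OF assms, of 0] by auto

lemma analytic_series_small:
  assumes "analytic_series F" "mcoeff F {#} = 0" "\<epsilon> > 0"
  shows "\<forall>\<^sub>F r in at_right 0. \<forall>n. trunc_norm n r F \<le> \<epsilon>"
proof -
  obtain K where K: "K > 0" "\<forall>\<^sub>F r in at_right 0. \<forall>n. trunc_norm n r F \<le> K * r ^ 1"
    using analytic_series_trunc_norm[OF assms(1), of 1] assms(2) by auto
  have "\<forall>\<^sub>F r in at_right 0. r < \<epsilon> / K"
    unfolding eventually_at_right_field using K assms by (intro exI[of _ "\<epsilon> / K"]) auto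
  with K(2) show ?thesis
  proof eventually_elim
    case (elim r)
    then have "K * r ^ 1 \<le> \<epsilon>" using K by (simp add: field_simps)
    with elim show ?case by (auto intro: order_trans)
  qed
qed

text \<open>With \<open>A = id + Q\<close> the inverse satisfies \<open>B = id - Q \<circ> B\<close>. As \<open>Q\<close> has order 2, a bound \<open>2 r\<close> for
  the part of \<open>B\<close> of degree at most \<open>n\<close> reproduces itself in degree \<open>n + 1\<close> once
  the majorant of \<open>Q\<close> at \<open>2 r\<close> is below \<open>r\<close>.\<close>

lemma compositional_inverse_bound:
  fixes A B :: "('d::finite) \<Rightarrow> 'd mps"
  assumes A: "tangent_to_id A" "\<And>i. analytic_series (A i)"
    and B: "tangent_to_id B" "\<And>i. mps_subst B (A i) = mps_var i"
  shows "\<forall>\<^sub>F r in at_right 0. \<forall>n i. trunc_norm n r (B i) \<le> 2 * r"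
proof -
  define Q where "Q i = A i - mps_var i" for i
  have Q0: "mcoeff (Q i) m = 0" if "size m < 2" for i m
    using A(1) that by (simp add: Q_def mcoeff_minus tangent_to_id_def)
  have BQ: "B i = mps_var i - mps_subst B (Q i)" for i
    using B by (simp add: Q_def mps_subst_minus mps_subst_var)
  have "\<forall>\<^sub>F r in at_right 0. \<forall>n. trunc_norm n (2 * r) (Q i) \<le> r" for i
  proof -
    obtain K b where K: "K > 0" and b: "b > 0" "\<And>r n. 0 < r \<Longrightarrow> r < b \<Longrightarrow> trunc_norm n r (Q i) \<le> K * r ^ 2"
      using analytic_series_trunc_norm[of "Q i" 2] A(2)[of i] Q0 analytic_series_var[of i]
      unfolding eventually_at_right_field Q_def by (metis analytic_series_minus)
    have "trunc_norm n (2 * r) (Q i) \<le> r" if "0 < r" "r < min (b / 2) (1 / (4 * K))" for r n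
    proof -
      have "trunc_norm n (2 * r) (Q i) \<le> K * (2 * r) ^ 2"
        using that by (intro b(2)) auto
      also have "\<dots> = (4 * K * r) * r" by (simp add: power2_eq_square)
      also have "\<dots> \<le> 1 * r"
        using that K by (intro mult_right_mono) (auto simp: field_simps)
      finally show ?thesis by simp
    qed
    then show ?thesis
      unfolding eventually_at_right_field using b K
      by (intro exI[of _ "min (b / 2) (1 / (4 * K))"]) auto
  qed
  then have "\<forall>\<^sub>F r in at_right 0. \<forall>i n. trunc_norm n (2 * r) (Q i) \<le> r"
    by (rule eventually_all_finite)
  moreover have "\<forall>\<^sub>F r in at_right (0::real). r > 0" by (rule eventually_at_right_less)
  ultimately show ?thesis
  proof eventually_elim
    case (elim r)
    have "\<forall>i. trunc_norm n r (B i) \<le> 2 * r" for n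
    proof (induction n)
      case 0
      then show ?case using elim by (simp add: trunc_norm_def tangent_to_id_const[OF B(1)])
    next
      case (Suc n)
      show ?case
      proof
        fix i
        have "trunc_norm (Suc n) r (mps_subst B (Q i)) \<le> trunc_norm (Suc n) (2 * r) (Q i)"
        proof (rule trunc_norm_subst_le[OF B(1)])
          fix k assume "mcoeff (Q i) k \<noteq> 0"
          then have "2 \<le> size k" using Q0[of k i] by fastforce
          then show "trunc_norm (Suc n) r (multi_pow B k) \<le> (2 * r) ^ size k"
            using elim Suc by (intro trunc_norm_multi_pow_Suc tangent_to_id_const[OF B(1)]) auto
        qed (use elim in auto)
        also have "\<dots> \<le> r" using elim by blast
        finally have "trunc_norm (Suc n) r (mps_subst B (Q i)) \<le> r" .
        moreover have "trunc_norm (Suc n) r (B i) \<le>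
            trunc_norm (Suc n) r (mps_var i) + trunc_norm (Suc n) r (mps_subst B (Q i))"
          by (subst BQ) (use elim in \<open>auto intro!: trunc_norm_minus\<close>)
        moreover have "trunc_norm (Suc n) r (mps_var i) \<le> r" using elim by (intro trunc_norm_var) auto
        ultimately show "trunc_norm (Suc n) r (B i) \<le> 2 * r" by linarith
      qed
    qed
    then show ?case by blast
  qed
qed

text \<open>The Neumann argument \<open>\<sigma> = 1 - (\<tau> - 1) \<sigma>\<close> for the reciprocal \<open>\<sigma>\<close> of \<open>\<tau> = \<rho> \<circ> A\<close>.\<close>

lemma reciprocal_of_subst_bound:
  fixes A :: "('d::finite) \<Rightarrow> 'd mps"
  assumes A: "tangent_to_id A" "\<And>i. analytic_series (A i)"
    and \<rho>: "analytic_series \<rho>" "mcoeff \<rho> {#} = 1" and \<sigma>: "mps_subst A \<rho> * \<sigma> = 1"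
  shows "\<forall>\<^sub>F r in at_right 0. \<forall>n. trunc_norm n r \<sigma> \<le> 2"
proof -
  have "\<forall>\<^sub>F s in at_right 0. \<forall>n. trunc_norm n s (\<rho> - 1) \<le> 1/2"
    using \<rho> by (intro analytic_series_small analytic_series_minus analytic_series_one)
               (auto simp: mcoeff_minus mcoeff_one)
  then obtain b where b: "b > 0" "\<And>s n. 0 < s \<Longrightarrow> s < b \<Longrightarrow> trunc_norm n s (\<rho> - 1) \<le> 1/2"
    unfolding eventually_at_right_field by blast
  let ?s = "b / 2"
  have "\<forall>\<^sub>F r in at_right 0. \<forall>i n. trunc_norm n r (A i) \<le> ?s"
    using b A by (intro eventually_all_finite analytic_series_small tangent_to_id_const) auto
  moreover have "\<forall>\<^sub>F r in at_right (0::real). r > 0" by (rule eventually_at_right_less)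
  ultimately show ?thesis
  proof eventually_elim
    case (elim r)
    show ?case
    proof
      fix n
      have "trunc_norm n r (mps_subst A (\<rho> - 1)) \<le> trunc_norm n ?s (\<rho> - 1)"
        using elim by (intro trunc_norm_subst_le A trunc_norm_multi_pow) auto
      also have "\<dots> \<le> 1/2" using b by auto
      finally have small: "trunc_norm n r (mps_subst A (\<rho> - 1)) \<le> 1/2" .
      have "\<sigma> = 1 - mps_subst A (\<rho> - 1) * \<sigma>"
        using \<sigma> by (simp add: mps_subst_minus mps_subst_one[OF A(1)] algebra_simps)
      then have "trunc_norm n r \<sigma> \<le> trunc_norm n r (1 :: 'd mps) + trunc_norm n r (mps_subst A (\<rho> - 1) * \<sigma>)"
        using trunc_norm_minus[of r n 1 "mps_subst A (\<rho> - 1) * \<sigma>"] elim by (metis order_less_imp_le)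
      also have "\<dots> \<le> 1 + trunc_norm n r (mps_subst A (\<rho> - 1)) * trunc_norm n r \<sigma>"
        using elim by (intro add_mono trunc_norm_times) (auto simp: trunc_norm_one)
      also have "\<dots> \<le> 1 + 1/2 * trunc_norm n r \<sigma>"
        using elim by (intro add_left_mono mult_right_mono small trunc_norm_nonneg) auto
      finally show "trunc_norm n r \<sigma> \<le> 2" by simp
    qed
  qed
qed

section \<open>The matrix of a Sheffer operator\<close>

text \<open>The condition on the pair \<open>(A, \<sigma>)\<close>, and on the pair belonging to the inverse operator, under which
  the operator acts on entire functions of order \<open>1 / \<gamma>\<close>; it holds with \<open>\<gamma> = 1\<close> for analytic data and
  with \<open>\<gamma> = 1 / \<beta>\<close> in the Appell case.\<close>

definition sheffer_bound :: "real \<Rightarrow> (('d::finite) \<Rightarrow> 'd mps) \<Rightarrow> 'd mps \<Rightarrow> bool" where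
  "sheffer_bound \<gamma> A \<sigma> \<longleftrightarrow> (\<exists>K R. 0 \<le> K \<and> 0 < R \<and> (\<forall>k m. size k \<le> size m \<longrightarrow>
     cmod (mcoeff (multi_pow A k * \<sigma>) m) \<le> K * R ^ size m * fact (size m - size k) powr (\<gamma> - 1)))"

lemma sheffer_bound_analytic:
  assumes A: "\<forall>\<^sub>F r in at_right 0. \<forall>n i. trunc_norm n r (A i) \<le> 1"
    and \<sigma>: "\<forall>\<^sub>F r in at_right 0. \<forall>n. trunc_norm n r \<sigma> \<le> K" and K: "K > 0"
  shows "sheffer_bound 1 A \<sigma>"
proof -
  have "\<forall>\<^sub>F r in at_right 0. r > 0 \<and> (\<forall>n i. trunc_norm n r (A i) \<le> 1) \<and> (\<forall>n. trunc_norm n r \<sigma> \<le> K)"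
    by (intro eventually_conj A \<sigma> eventually_at_right_less)
  then obtain r where r: "r > 0" and le: "\<And>n i. trunc_norm n r (A i) \<le> 1" "\<And>n. trunc_norm n r \<sigma> \<le> K"
    using eventually_happens trivial_limit_at_right_real by blast
  have "cmod (mcoeff (multi_pow A k * \<sigma>) m) \<le> K * (1 / r) ^ size m" for k m
  proof -
    have "cmod (mcoeff (multi_pow A k * \<sigma>) m) * r ^ size m \<le> trunc_norm (size m) r (multi_pow A k * \<sigma>)"
      using r by (intro mcoeff_le_trunc_norm) auto
    also have "\<dots> \<le> trunc_norm (size m) r (multi_pow A k) * trunc_norm (size m) r \<sigma>"
      using r by (intro trunc_norm_times) auto
    also have "\<dots> \<le> 1 ^ size k * K"
      using r le K by (intro mult_mono trunc_norm_multi_pow trunc_norm_nonneg) auto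
    finally show ?thesis using r by (simp add: field_simps)
  qed
  then show ?thesis unfolding sheffer_bound_def
    using r K by (intro exI[of _ K] exI[of _ "1 / r"]) auto
qed

lemma multi_pow_var_times: "mcoeff (multi_pow mps_var k * F) m = (if k \<subseteq># m then mcoeff F (m - k) else 0)"
proof -
  have "mcoeff (multi_pow mps_var k * F) m =
      (\<Sum>x\<in>{(a, b). a + b = m}. if x = (k, m - k) then mcoeff F (m - k) else 0)"
    unfolding mcoeff_times by (intro sum.cong) (auto simp: multi_pow_var split: if_splits)
  also have "\<dots> = (if (k, m - k) \<in> {(a, b). a + b = m} then mcoeff F (m - k) else 0)"
    by (rule sum.delta) simp
  also have "(k, m - k) \<in> {(a, b). a + b = m} \<longleftrightarrow> k \<subseteq># m"
    by (auto simp: mset_subset_eq_exists_conv intro: exI[of _ "m - k"])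
  finally show ?thesis .
qed

lemma sheffer_bound_var:
  assumes "0 < R" "\<And>m. cmod (mcoeff \<theta> m) \<le> R ^ size m * fact (size m) powr (\<gamma> - 1)"
  shows "sheffer_bound \<gamma> mps_var \<theta>"
  unfolding sheffer_bound_def
proof (rule exI[of _ 1], rule exI[of _ "max 1 R"], intro conjI allI impI)
  fix k m :: "'a multiset" assume "size k \<le> size m"
  show "cmod (mcoeff (multi_pow mps_var k * \<theta>) m) \<le> 1 * max 1 R ^ size m * fact (size m - size k) powr (\<gamma> - 1)"
  proof (cases "k \<subseteq># m")
    case True
    have "R ^ (size m - size k) \<le> max 1 R ^ (size m - size k)"
      using assms(1) by (intro power_mono) auto
    also have "\<dots> \<le> max 1 R ^ size m" by (intro power_increasing) auto
    finally have "R ^ (size m - size k) * fact (size m - size k) powr (\<gamma> - 1) \<le>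
        max 1 R ^ size m * fact (size m - size k) powr (\<gamma> - 1)"
      by (intro mult_right_mono) auto
    then have "cmod (mcoeff \<theta> (m - k)) \<le> max 1 R ^ size m * fact (size m - size k) powr (\<gamma> - 1)"
      using assms(2)[of "m - k"] by (simp only: size_Diff_submset[OF True])
    then show ?thesis using True by (simp add: multi_pow_var_times)
  qed (simp add: multi_pow_var_times)
qed (use assms in auto)

text \<open>The coefficient of \<open>\<omega>\<^sup>k\<close> in the image of \<open>\<omega>\<^sup>m\<close>.\<close>

definition sheffer_matrix :: "(('d::finite) \<Rightarrow> 'd mps) \<Rightarrow> 'd mps \<Rightarrow> 'd multiset \<Rightarrow> 'd multiset \<Rightarrow> complex" where
  "sheffer_matrix A \<sigma> m k = (fact (size m) / of_nat (arrangements m)) *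
     (of_nat (arrangements k) / fact (size k)) * mcoeff (multi_pow A k * \<sigma>) m"

lemma sheffer_matrix_eq_0:
  "tangent_to_id A \<Longrightarrow> size m < size k \<Longrightarrow> sheffer_matrix A \<sigma> m k = 0"
  by (simp add: sheffer_matrix_def mcoeff_multi_pow_mult_eq_0)

text \<open>The factorials cancel in the product, and what remains is the coefficient of \<open>\<xi>\<^sup>m\<close> in \<open>\<sigma> \<cdot> ((B\<^sup>j \<rho>) \<circ> A)\<close>.\<close>

lemma sheffer_matrix_mult:
  assumes A: "tangent_to_id A" and inv: "mps_subst A (multi_pow B j * \<rho>) * \<sigma> = multi_pow mps_var j"
  shows "(\<Sum>k | size k \<le> size m. sheffer_matrix A \<sigma> m k * sheffer_matrix B \<rho> k j) = (if m = j then 1 else 0)"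
proof -
  let ?v = "\<lambda>m. fact (size m) / of_nat (arrangements m) :: complex"
  have v: "?v k \<noteq> 0" for k :: "'a multiset" using arrangements_pos[of k] by simp
  have "(\<Sum>k | size k \<le> size m. sheffer_matrix A \<sigma> m k * sheffer_matrix B \<rho> k j) =
    (\<Sum>k | size k \<le> size m. ?v m / ?v j * (mcoeff (multi_pow B j * \<rho>) k * mcoeff (multi_pow A k * \<sigma>) m))"
  proof (intro sum.cong refl)
    fix k
    show "sheffer_matrix A \<sigma> m k * sheffer_matrix B \<rho> k j =
        ?v m / ?v j * (mcoeff (multi_pow B j * \<rho>) k * mcoeff (multi_pow A k * \<sigma>) m)"
      using arrangements_pos[of k] by (simp add: sheffer_matrix_def field_simps del: arrangements_pos)
  qed
  also have "\<dots> = ?v m / ?v j * mcoeff (multi_pow mps_var j) m"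
    unfolding sum_distrib_left[symmetric] mcoeff_subst_times[OF A order_refl, symmetric] inv ..
  finally show ?thesis using v[of m] by (auto simp: multi_pow_var)
qed

text \<open>The matrix and its inverse belong to \<open>F \<mapsto> \<sigma> \<cdot> (F \<circ> A)\<close> and \<open>F \<mapsto> \<rho> \<cdot> (F \<circ> B)\<close>.\<close>

lemma sheffer_matrix_inverse:
  assumes A: "tangent_to_id A" and B: "tangent_to_id B"
    and BA: "\<And>i. mps_subst A (B i) = mps_var i" and AB: "\<And>i. mps_subst B (A i) = mps_var i"
    and \<sigma>: "mps_subst A \<rho> * \<sigma> = 1"
  shows "(\<Sum>k | size k \<le> size m. sheffer_matrix A \<sigma> m k * sheffer_matrix B \<rho> k j) = (if m = j then 1 else 0)"
    and "(\<Sum>k | size k \<le> size m. sheffer_matrix B \<rho> m k * sheffer_matrix A \<sigma> k j) = (if m = j then 1 else 0)"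
proof -
  show "(\<Sum>k | size k \<le> size m. sheffer_matrix A \<sigma> m k * sheffer_matrix B \<rho> k j) = (if m = j then 1 else 0)"
    by (rule sheffer_matrix_mult[OF A])
       (simp add: mps_subst_mult[OF A] mps_subst_multi_pow[OF A] BA mult.assoc \<sigma>)
  have "mps_subst B (mps_subst A \<rho>) = \<rho>"
    by (simp add: mps_subst_subst[OF A B] AB mps_subst_id)
  then have "\<rho> * mps_subst B \<sigma> = 1"
    using arg_cong[OF \<sigma>, of "mps_subst B"] by (simp add: mps_subst_mult[OF B] mps_subst_one[OF B])
  then show "(\<Sum>k | size k \<le> size m. sheffer_matrix B \<rho> m k * sheffer_matrix A \<sigma> k j) = (if m = j then 1 else 0)"
    by (intro sheffer_matrix_mult[OF B])
       (simp add: mps_subst_mult[OF B] mps_subst_multi_pow[OF B] AB mult.assoc mult.commute[of "mps_subst B \<sigma>"])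
qed

lemma sum_power_eq_sum_lists: "(\<Sum>i\<in>UNIV. x i) ^ j = (\<Sum>l | length l = j. \<Prod>i\<leftarrow>l. x (i :: 'd::finite) :: 'a::comm_ring_1)"
proof (induction j)
  case (Suc j)
  have "(\<Sum>l | length l = Suc j. \<Prod>i\<leftarrow>l. x i) = (\<Sum>y\<in>UNIV \<times> {l. length l = j}. x (fst y) * (\<Prod>i\<leftarrow>snd y. x i))"
    by (rule sum.reindex_bij_witness[of _ "\<lambda>y. fst y # snd y" "\<lambda>l. (hd l, tl l)"])
       (auto simp: length_Suc_conv)
  then show ?case using Suc by (simp add: sum_product sum.cartesian_product case_prod_beta)
qed simp

lemma mps_const_mult: "mps_const (a * b) = mps_const a * mps_const b"
  by (rule mps_eqI) (simp add: mcoeff_const_times, simp add: mps_const_def)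

lemma multi_pow_const_times:
  "mcoeff (multi_pow (\<lambda>i. mps_const (\<omega> $ i) * A i) k) m = monom_val \<omega> k * mcoeff (multi_pow A k) m"
proof -
  have "multi_pow (\<lambda>i. mps_const (\<omega> $ i) * A i) k = mps_const (monom_val \<omega> k) * multi_pow A k"
  proof (induction k)
    case empty
    have "mps_const 1 * 1 = (1 :: 'a mps)"
      by (rule mps_eqI) (simp only: mcoeff_const_times mult_1)
    then show ?case by simp
  next
    case (add i k)
    then show ?case by (simp add: mps_const_mult mult_ac)
  qed
  then show ?thesis by (simp add: mcoeff_const_times)
qed

text \<open>The multinomial theorem: \<open>\<langle>\<omega>, A(\<xi>)\<rangle>\<^sup>j\<close> is a sum over tuples of length \<open>j\<close>, and \<open>arrangements k\<close> of them yield
  \<open>\<omega>\<^sup>k A\<^sup>k\<close>.\<close>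

lemma mcoeff_exp_pair:
  "mcoeff (mps_exp (\<Sum>i\<in>UNIV. mps_const (\<omega> $ i) * A i)) m =
   (\<Sum>k | size (k :: ('d::finite) multiset) \<le> size m.
      of_nat (arrangements k) / fact (size k) * monom_val \<omega> k * mcoeff (multi_pow A k) m)"
proof -
  have "mcoeff ((\<Sum>i\<in>UNIV. mps_const (\<omega> $ i) * A i) ^ j) m / fact j = (\<Sum>k | size k = j.
      of_nat (arrangements k) / fact (size k) * monom_val \<omega> k * mcoeff (multi_pow A k) m)" for j
  proof -
    have "mcoeff ((\<Sum>i\<in>UNIV. mps_const (\<omega> $ i) * A i) ^ j) m =
        (\<Sum>l | length l = j. monom_val \<omega> (mset l) * mcoeff (multi_pow A (mset l)) m)"
      by (simp add: sum_power_eq_sum_lists mcoeff_sum multi_pow_mset[symmetric] multi_pow_const_times)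
    also have "\<dots> = (\<Sum>k | size k = j. of_nat (arrangements k) * (monom_val \<omega> k * mcoeff (multi_pow A k) m))"
      unfolding sum_lists_by_mset by (intro sum.cong) (auto simp: arrangements_def)
    finally show ?thesis
      by (simp add: sum_divide_distrib mult.assoc)
  qed
  then show ?thesis by (simp add: mps_exp_def sum_multisets_by_size)
qed

lemma comp_series_eq_subst:
  "comp_series \<rho> A = mps_subst (vector_series A) (tensor_series \<rho>)"
proof (rule mps_eqI)
  fix m
  have "(\<Sum>l | length l = n. \<rho> n l * mcoeff (\<Prod>i\<leftarrow>l. vector_series A i) m) =
        (\<Sum>k | size k = n. mcoeff (tensor_series \<rho>) k * mcoeff (multi_pow (vector_series A) k) m)" for n
    unfolding sum_lists_by_mset tensor_series_def mcoeff_Abs sum_distrib_right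
    by (intro sum.cong) (auto simp: multi_pow_mset[symmetric])
  then show "mcoeff (comp_series \<rho> A) m = mcoeff (mps_subst (vector_series A) (tensor_series \<rho>)) m"
    by (simp add: comp_series_def mps_subst_def sum_multisets_by_size)
qed

lemma tangent_to_id_vector_series:
  assumes "\<forall>\<phi>\<in>sym_tensors 1. A 1 \<phi> = vec_of_tensor \<phi>"
  shows "tangent_to_id (vector_series A)"
  unfolding tangent_to_id_def
proof (intro allI impI)
  fix i and m :: "'a multiset" assume m: "size m \<le> 1"
  show "mcoeff (vector_series A i) m = mcoeff (mps_var i) m"
  proof (cases "m = {#}")
    case False
    then have "size m \<noteq> 0" by simp
    with m have "size m = 1" by linarith
    then obtain j where j: "m = {#j#}" by (metis size_1_singleton_mset)
    have "(\<lambda>l. if mset l = {#j#} then 1 else 0) \<in> sym_tensors 1"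
      by (auto simp: sym_tensors_def)
    then show ?thesis using assms by (simp add: j vector_series_def vec_of_tensor_def mcoeff_var)
  qed (simp add: vector_series_def mcoeff_var)
qed

lemma tensor_power_sym: "tensor_power k \<omega> \<in> sym_tensors k"
  by (auto simp: sym_tensors_def tensor_power_def monom_val_mset[symmetric] dest: mset_eq_length)

lemma monic_sequence_sym:
  assumes "monic_sequence S"
  shows "S n \<omega> \<in> sym_tensors n"
proof -
  obtain U where U: "\<And>k. k \<le> n \<Longrightarrow> linear_op k n (U n k)" "S n \<omega> = (\<lambda>l. \<Sum>k\<le>n. U n k (tensor_power k \<omega>) l)"
    using assms unfolding monic_sequence_def by blast
  have "U n k (tensor_power k \<omega>) \<in> sym_tensors n" if "k \<le> n" for k
    using U(1)[OF that] tensor_power_sym[of k \<omega>] unfolding linear_op_def by blast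
  then have *: "\<And>k l. k \<le> n \<Longrightarrow> length l \<noteq> n \<Longrightarrow> U n k (tensor_power k \<omega>) l = 0"
    "\<And>k l l'. k \<le> n \<Longrightarrow> mset l = mset l' \<Longrightarrow> U n k (tensor_power k \<omega>) l = U n k (tensor_power k \<omega>) l'"
    unfolding sym_tensors_def by blast+
  show ?thesis
    unfolding sym_tensors_def U(2)
  proof (intro CollectI conjI allI impI)
    fix l l' :: "'a list" assume "mset l = mset l'"
    then show "(\<Sum>k\<le>n. U n k (tensor_power k \<omega>) l) = (\<Sum>k\<le>n. U n k (tensor_power k \<omega>) l')"
      by (intro sum.cong refl *(2)) auto
  qed (auto intro!: sum.neutral *(1))
qed

text \<open>Compare the coefficients of \<open>\<xi>\<^sup>m\<close> in the generating function. By symmetry of \<open>S n \<omega>\<close> all arrangements of \<open>m\<close>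
  contribute equally on the left-hand side.\<close>

lemma sheffer_sequence_coeffs:
  fixes S :: "nat \<Rightarrow> complex ^ ('d::finite) \<Rightarrow> 'd tensor"
  assumes S: "sheffer_sequence S A \<rho>"
  defines "\<sigma> \<equiv> inverse (comp_series \<rho> A)"
  shows "S (length l) \<omega> l =
    (\<Sum>k | size k \<le> length l. sheffer_matrix (vector_series A) \<sigma> (mset l) k * monom_val \<omega> k)"
proof -
  let ?m = "mset l" and ?n = "length l"
  have S_sym: "S ?n \<omega> l' = S ?n \<omega> l" if "mset l' = mset l" for l'
    using monic_sequence_sym[of S ?n \<omega>] S that unfolding sheffer_sequence_def sym_tensors_def by blast
  have A: "tangent_to_id (vector_series A)"
    using S unfolding sheffer_sequence_def by (intro tangent_to_id_vector_series) blast
  have "of_nat (arrangements ?m) * (S ?n \<omega> l / fact ?n) = mcoeff (tensor_series (\<lambda>n l. S n \<omega> l / fact n)) ?m"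
  proof -
    have "(\<Sum>l' | mset l' = ?m. S ?n \<omega> l' / fact ?n) = (\<Sum>l' | mset l' = ?m. S ?n \<omega> l / fact ?n)"
      by (rule sum.cong) (auto dest: S_sym)
    then show ?thesis by (simp add: tensor_series_def arrangements_def)
  qed
  also have "\<dots> = mcoeff (mps_exp (pair_series \<omega> A) * \<sigma>) ?m"
    using S unfolding sheffer_sequence_def by (simp add: divide_mps_def \<sigma>_def)
  also have "mps_exp (pair_series \<omega> A) = mps_subst (vector_series A)
      (Abs_mps (\<lambda>k. of_nat (arrangements k) / fact (size k) * monom_val \<omega> k))"
    by (rule mps_eqI) (simp add: pair_series_def mcoeff_exp_pair mps_subst_def)
  also have "mcoeff (\<dots> * \<sigma>) ?m = (\<Sum>k | size k \<le> ?n. of_nat (arrangements k) / fact (size k) *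
      monom_val \<omega> k * mcoeff (multi_pow (vector_series A) k * \<sigma>) ?m)"
    by (subst mcoeff_subst_times[OF A, of _ ?n]) auto
  finally have "S ?n \<omega> l = fact ?n / of_nat (arrangements ?m) * (\<Sum>k | size k \<le> ?n.
      of_nat (arrangements k) / fact (size k) * monom_val \<omega> k * mcoeff (multi_pow (vector_series A) k * \<sigma>) ?m)"
    using arrangements_pos[of ?m] by (simp add: field_simps)
  then show ?thesis
    unfolding sheffer_matrix_def sum_distrib_left by (simp add: mult_ac)
qed

text \<open>Fix a weight exponent \<open>\<delta> \<ge> \<gamma>\<close>. In the entry for \<open>n = size m\<close> and \<open>j = size k\<close> the factorials combine to
  \<open>n! / j! \<cdot> (n - j)!\<^bsup>\<gamma> - 1\<^esup> \<cdot> j!\<^sup>\<delta> = (n choose j) \<cdot> (n - j)!\<^sup>\<gamma> \<cdot> j!\<^sup>\<delta> \<le> 2\<^sup>n \<cdot> n!\<^sup>\<delta>\<close>, because \<open>(n - j)! j! \<le> n!\<close>.\<close>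

lemma factorial_weight_le:
  assumes "j \<le> n" "0 < \<gamma>" "\<gamma> \<le> \<delta>"
  shows "fact n / fact j * fact (n - j) powr (\<gamma> - 1) * fact j powr \<delta> \<le> 2 ^ n * (fact n powr \<delta> :: real)"
proof -
  have fact1: "(1::real) \<le> fact i" for i by (rule fact_ge_1)
  have "fact n / fact j * fact (n - j) powr (\<gamma> - 1) = real (n choose j) * fact (n - j) powr \<gamma>"
    using assms(1) by (simp add: binomial_fact powr_diff)
  also have "\<dots> \<le> 2 ^ n * fact (n - j) powr \<delta>"
    using binomial_le_pow2[of n j] assms fact1[of "n - j"]
    by (intro mult_mono powr_mono) (auto simp flip: of_nat_le_iff)
  finally have "fact n / fact j * fact (n - j) powr (\<gamma> - 1) * fact j powr \<delta> \<le>
      2 ^ n * fact (n - j) powr \<delta> * fact j powr \<delta>"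
    by (intro mult_right_mono) auto
  also have "\<dots> = 2 ^ n * (fact (n - j) * fact j) powr \<delta>"
    by (simp add: powr_mult)
  also have "\<dots> \<le> 2 ^ n * fact n powr \<delta>"
  proof -
    have "fact j * fact (n - j) dvd (fact n :: nat)"
      using binomial_fact_lemma[OF assms(1)] by (metis dvd_triv_left)
    then have "fact (n - j) * fact j \<le> (fact n :: nat)" by (intro dvd_imp_le) (auto simp: mult.commute)
    then have "real (fact (n - j) * fact j) \<le> real (fact n)" by (simp only: of_nat_le_iff)
    then have "fact (n - j) * fact j \<le> (fact n :: real)" by simp
    then show ?thesis using assms by (intro mult_left_mono powr_mono2) auto
  qed
  finally show ?thesis .
qed

text \<open>The weight exponent \<open>\<delta>\<close> corresponds to the order \<open>1 / \<delta>\<close>.\<close>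

definition weight :: "real \<Rightarrow> real \<Rightarrow> 'd multiset \<Rightarrow> real" where
  "weight \<delta> R m = R ^ size m * fact (size m) powr \<delta>"

lemma weight_nonneg: "R \<ge> 0 \<Longrightarrow> weight \<delta> R m \<ge> 0"
  by (simp add: weight_def)

text \<open>Besides \<open>factorial_weight_le\<close>, only factors of exponential growth in \<open>size m\<close> occur: the numbers of
  arrangements and the number of entries of the row. The constant \<open>M\<close> absorbs them.\<close>

lemma sheffer_matrix_row_bound:
  fixes A :: "('d::finite) \<Rightarrow> 'd mps"
  assumes \<sigma>: "sheffer_bound \<gamma> A \<sigma>" and \<gamma>: "0 < \<gamma>" "\<gamma> \<le> \<delta>" and "0 < R"
  obtains K M where "K \<ge> 0" "M > 0"
    "\<And>m. (\<Sum>k | size k \<le> size m. cmod (sheffer_matrix A \<sigma> m k) * weight \<delta> R k) \<le> K * weight \<delta> M m"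
proof -
  obtain K R0 where K: "0 \<le> K" "0 < R0" and le: "\<And>k m. size k \<le> size m \<Longrightarrow>
     cmod (mcoeff (multi_pow A k * \<sigma>) m) \<le> K * R0 ^ size m * fact (size m - size k) powr (\<gamma> - 1)"
    using \<sigma> unfolding sheffer_bound_def by blast
  let ?d = "real CARD('d)" and ?R = "max 1 R"
  let ?M = "2 * ?d * (2 * ?d * R0 * ?R)"
  have entry: "cmod (sheffer_matrix A \<sigma> m k) * weight \<delta> R k \<le> K * (2 * ?d * R0 * ?R) ^ size m * fact (size m) powr \<delta>"
    if "size k \<le> size m" for m k
  proof -
    let ?n = "size m" and ?j = "size k"
    have "fact ?n / arrangements m \<le> (fact ?n :: real)"
      using arrangements_pos[of m] by (simp add: divide_le_eq mult_le_cancel_left1 del: arrangements_pos)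
    moreover have "arrangements k / fact ?j \<le> ?d ^ ?n / fact ?j"
    proof (intro divide_right_mono)
      have "real (arrangements k) \<le> ?d ^ ?j"
        using arrangements_le[of k] by (metis of_nat_le_iff of_nat_power)
      also have "\<dots> \<le> ?d ^ ?n" using that by (intro power_increasing) (auto simp: Suc_le_eq)
      finally show "real (arrangements k) \<le> ?d ^ ?n" .
    qed simp
    ultimately have "cmod (sheffer_matrix A \<sigma> m k) \<le>
        fact ?n * (?d ^ ?n / fact ?j) * (K * R0 ^ ?n * fact (?n - ?j) powr (\<gamma> - 1))"
      unfolding sheffer_matrix_def norm_mult norm_divide norm_of_nat norm_fact
      by (intro mult_mono le that) auto
    moreover have "weight \<delta> R k \<le> ?R ^ ?n * fact ?j powr \<delta>"
      unfolding weight_def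
    proof (intro mult_right_mono)
      have "R ^ ?j \<le> ?R ^ ?j" using \<open>0 < R\<close> by (intro power_mono) auto
      also have "\<dots> \<le> ?R ^ ?n" using that by (intro power_increasing) auto
      finally show "R ^ ?j \<le> ?R ^ ?n" .
    qed simp
    ultimately have "cmod (sheffer_matrix A \<sigma> m k) * weight \<delta> R k \<le>
        fact ?n * (?d ^ ?n / fact ?j) * (K * R0 ^ ?n * fact (?n - ?j) powr (\<gamma> - 1)) * (?R ^ ?n * fact ?j powr \<delta>)"
      using K \<open>0 < R\<close> by (intro mult_mono weight_nonneg) auto
    also have "\<dots> = K * (?d * R0 * ?R) ^ ?n * (fact ?n / fact ?j * fact (?n - ?j) powr (\<gamma> - 1) * fact ?j powr \<delta>)"
      by (simp add: power_mult_distrib)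
    also have "\<dots> \<le> K * (?d * R0 * ?R) ^ ?n * (2 ^ ?n * fact ?n powr \<delta>)"
      using K that \<gamma> by (intro mult_left_mono factorial_weight_le) auto
    also have "\<dots> = K * (2 * ?d * R0 * ?R) ^ ?n * fact ?n powr \<delta>"
      by (simp add: power_mult_distrib)
    finally show ?thesis .
  qed
  have card: "real (card {k :: 'd multiset. size k \<le> n}) \<le> (2 * ?d) ^ n" for n
  proof -
    have "real (card {k :: 'd multiset. size k \<le> n}) = (\<Sum>j\<le>n. real (card {k :: 'd multiset. size k = j}))"
      using sum_multisets_by_size[where 'd='d and n=n and f="\<lambda>_. 1::real"] by simp
    also have "\<dots> \<le> (\<Sum>j\<le>n. ?d ^ n)"
    proof (rule sum_mono)
      fix j assume "j \<in> {..n}"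
      have "real (card {k :: 'd multiset. size k = j}) \<le> ?d ^ j"
        using card_multisets_size[where 'd='d, of j] by (metis of_nat_le_iff of_nat_power)
      also have "\<dots> \<le> ?d ^ n" using \<open>j \<in> {..n}\<close> by (intro power_increasing) (auto simp: Suc_le_eq)
      finally show "real (card {k :: 'd multiset. size k = j}) \<le> ?d ^ n" .
    qed
    also have "\<dots> = real (Suc n) * ?d ^ n" by simp
    also have "\<dots> \<le> 2 ^ n * ?d ^ n"
    proof (intro mult_right_mono)
      have "Suc n \<le> 2 ^ n" by (simp add: Suc_le_eq)
      then have "real (Suc n) \<le> real (2 ^ n)" by (simp only: of_nat_le_iff)
      then show "real (Suc n) \<le> 2 ^ n" by simp
    qed simp
    finally show ?thesis by (simp add: power_mult_distrib)
  qed
  show thesis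
  proof
    show "?M > 0" using K \<open>0 < R\<close> by simp
    fix m :: "'d multiset"
    have "(\<Sum>k | size k \<le> size m. cmod (sheffer_matrix A \<sigma> m k) * weight \<delta> R k) \<le>
       (\<Sum>k :: 'd multiset | size k \<le> size m. K * (2 * ?d * R0 * ?R) ^ size m * fact (size m) powr \<delta>)"
      by (intro sum_mono entry) auto
    also have "\<dots> = real (card {k :: 'd multiset. size k \<le> size m}) *
        (K * (2 * ?d * R0 * ?R) ^ size m * fact (size m) powr \<delta>)"
      by simp
    also have "\<dots> \<le> (2 * ?d) ^ size m * (K * (2 * ?d * R0 * ?R) ^ size m * fact (size m) powr \<delta>)"
      using K \<open>0 < R\<close> by (intro mult_right_mono card) auto
    also have "\<dots> = K * weight \<delta> ?M m"
      unfolding weight_def power_mult_distrib[of "2 * ?d"] by (simp only: mult_ac)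
    finally show "(\<Sum>k | size k \<le> size m. cmod (sheffer_matrix A \<sigma> m k) * weight \<delta> R k) \<le> K * weight \<delta> ?M m" .
  qed (use K in auto)
qed

section \<open>Power series on \<open>\<complex>\<^sup>d\<close>\<close>

lemma norm_le_card_times:
  fixes \<omega> :: "complex ^ 'd::finite"
  assumes "\<And>i. cmod (\<omega> $ i) \<le> R"
  shows "norm \<omega> \<le> real CARD('d) * R"
proof -
  have "norm \<omega> \<le> (\<Sum>i\<in>UNIV. cmod (\<omega> $ i))"
    unfolding norm_vec_def by (rule L2_set_le_sum) auto
  also have "\<dots> \<le> (\<Sum>i\<in>(UNIV :: 'd set). R)" by (intro sum_mono assms)
  finally show ?thesis by simp
qed

definition power_series :: "('d multiset \<Rightarrow> complex) \<Rightarrow> complex ^ ('d::finite) \<Rightarrow> complex" where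
  "power_series a \<omega> = (\<Sum>\<^sub>\<infinity>m. a m * monom_val \<omega> m)"

lemma power_series_abs_summable:
  assumes "(\<lambda>m. cmod (a m) * R ^ size m) summable_on X" "\<And>i. cmod (\<omega> $ i) \<le> R"
  shows "(\<lambda>m. norm (a m * monom_val \<omega> m)) summable_on X"
proof (rule summable_on_comparison_test[OF assms(1)])
  fix m show "norm (a m * monom_val \<omega> m) \<le> cmod (a m) * R ^ size m"
    unfolding norm_mult by (intro mult_left_mono monom_val_le assms) auto
qed auto

text \<open>The point \<open>x\<close> is the index of the coefficient that is to be extracted.\<close>

lemma infsum_tail_small:
  fixes g :: "'a \<Rightarrow> real"
  assumes "g summable_on UNIV" "\<And>x. g x \<ge> 0" "\<epsilon> > 0"
  obtains F where "finite F" "x \<in> F" "infsum g (- F) \<le> \<epsilon>"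
proof -
  obtain F where F: "finite F" "dist (sum g F) (infsum g UNIV) \<le> \<epsilon>"
    using infsum_finite_approximation[OF assms(1,3)] by blast
  have "infsum g UNIV = infsum g (insert x F) + infsum g (- insert x F)"
    using F infsum_Un_disjoint[of g "insert x F" "- insert x F"]
      summable_on_subset[OF assms(1), of "- insert x F"] by (auto simp: Compl_partition)
  moreover have "sum g F \<le> sum g (insert x F)" using F assms by (intro sum_mono2) auto
  ultimately have "infsum g (- insert x F) \<le> \<epsilon>" using F by (simp add: dist_real_def)
  with F show thesis by (intro that[of "insert x F"]) auto
qed

lemma sum_roots_of_unity:
  assumes "c < N" "c' < N"
  defines "\<zeta> \<equiv> exp (2 * of_real pi * \<i> * of_nat 1 / of_nat N)"
  shows "(\<Sum>x<N. (\<zeta> ^ x) ^ c' / (\<zeta> ^ x) ^ c) = (if c' = c then of_nat N else 0)"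
proof -
  have pow: "\<zeta> ^ j = exp (2 * of_real pi * \<i> * of_nat j / of_nat N)" for j
    unfolding \<zeta>_def exp_of_nat_mult[symmetric] by (simp add: field_simps)
  have N1: "\<zeta> ^ N = 1" using assms(1) complex_root_unity[of N 1] by (simp add: \<zeta>_def)
  have \<zeta>0: "\<zeta> \<noteq> 0" by (simp add: \<zeta>_def)
  define q where "q = \<zeta> ^ c' / \<zeta> ^ c"
  have "(\<Sum>x<N. (\<zeta> ^ x) ^ c' / (\<zeta> ^ x) ^ c) = (\<Sum>x<N. q ^ x)"
    by (intro sum.cong) (simp_all add: q_def power_divide flip: power_mult, simp add: mult.commute)
  also have "\<dots> = (if c' = c then of_nat N else 0)"
  proof (cases "c' = c")
    case True
    then show ?thesis using \<zeta>0 by (simp add: q_def)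
  next
    case False
    have "\<zeta> ^ c' \<noteq> \<zeta> ^ c"
      using assms(1,2) False complex_root_unity_eq[of N c' c] by (simp add: pow)
    then have "q \<noteq> 1" using \<zeta>0 by (simp add: q_def)
    moreover have "q ^ N = 1"
      unfolding q_def power_divide by (simp add: power_mult[symmetric] mult.commute[of _ N]) (simp add: power_mult N1 \<zeta>0)
    ultimately show ?thesis using False by (simp add: sum_gp_strict)
  qed
  finally show ?thesis .
qed

text \<open>Averaging over a grid of roots of unity on the torus extracts one coefficient of a
  polynomial exactly as soon as the grid is finer than the degree; an absolutely convergent series
  differs from a polynomial by a small amount on the torus.\<close>

lemma multi_cauchy_estimate:
  fixes a :: "('d::finite) multiset \<Rightarrow> complex"
  assumes R: "R > 0" and summable: "(\<lambda>m. cmod (a m) * R ^ size m) summable_on UNIV"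
    and B: "\<And>\<omega>. (\<And>i. cmod (\<omega> $ i) = R) \<Longrightarrow> cmod (power_series a \<omega>) \<le> B"
  shows "cmod (a m) * R ^ size m \<le> B"
proof (rule field_le_epsilon)
  fix \<epsilon> :: real assume "\<epsilon> > 0"
  let ?g = "\<lambda>m. cmod (a m) * R ^ size m"
  obtain F where F: "finite F" "m \<in> F" "infsum ?g (- F) \<le> \<epsilon>"
    using infsum_tail_small[OF summable _ \<open>\<epsilon> > 0\<close>] R by (metis mult_nonneg_nonneg norm_ge_zero zero_le_power less_eq_real_def)
  have F_le: "cmod (\<Sum>m'\<in>F. a m' * monom_val \<omega> m') \<le> B + \<epsilon>" if \<omega>: "\<And>i. cmod (\<omega> $ i) = R" for \<omega>
  proof -
    let ?f = "\<lambda>m. a m * monom_val \<omega> m"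
    have tail: "(\<lambda>m. norm (?f m)) summable_on - F"
      by (rule power_series_abs_summable[OF summable_on_subset[OF summable]]) (auto simp: \<omega>)
    have "power_series a \<omega> = infsum ?f F + infsum ?f (- F)"
      unfolding power_series_def using F abs_summable_summable[OF tail]
        infsum_Un_disjoint[of ?f F "- F"] by (simp add: Compl_partition)
    then have "cmod (\<Sum>m'\<in>F. ?f m') \<le> cmod (power_series a \<omega>) + cmod (infsum ?f (- F))"
      using F norm_triangle_ineq4[of "power_series a \<omega>" "infsum ?f (- F)"] by simp
    moreover have "cmod (infsum ?f (- F)) \<le> infsum ?g (- F)"
    proof (rule order_trans[OF norm_infsum_bound[OF tail]])
      show "(\<Sum>\<^sub>\<infinity>m\<in>- F. norm (?f m)) \<le> infsum ?g (- F)"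
        unfolding norm_mult
        by (intro infsum_mono mult_left_mono monom_val_le summable_on_subset[OF summable])
           (use tail \<omega> in \<open>auto simp: norm_mult\<close>)
    qed
    ultimately show ?thesis using B[OF \<omega>] F by linarith
  qed
  obtain n where n: "\<And>m. m \<in> F \<Longrightarrow> size m \<le> n"
    using finite_imageI[OF F(1), of size] by (auto simp: finite_nat_set_iff_bounded_le)
  define N where "N = Suc n"
  define \<zeta> where "\<zeta> = exp (2 * of_real pi * \<i> * of_nat 1 / of_nat N)"
  have norm_\<zeta>: "cmod \<zeta> = 1" unfolding \<zeta>_def norm_exp_eq_Re by simp
  define E :: "('d \<Rightarrow> nat) set" where "E = PiE UNIV (\<lambda>_. {..<N})"
  define pt :: "('d \<Rightarrow> nat) \<Rightarrow> complex ^ 'd" where "pt e = (\<chi> i. of_real R * \<zeta> ^ e i)" for e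
  define ch where "ch e = (\<Prod>i\<in>UNIV. (\<zeta> ^ e i) ^ count m i)" for e
  have norm_ch: "cmod (ch e) = 1" for e
    by (simp add: ch_def norm_power norm_\<zeta> flip: prod_norm)
  have cardE: "card E = N ^ CARD('d)" by (simp add: E_def card_PiE)
  have count_less: "count m' i < N" if "m' \<in> F" for m' i
    using n[OF that] count_le_size[of m' i] by (simp add: N_def)
  have orth: "(\<Sum>e\<in>E. monom_val (pt e) m' / ch e) = (if m' = m then of_real R ^ size m * of_nat (N ^ CARD('d)) else 0)"
    if "m' \<in> F" for m'
  proof -
    have "monom_val (pt e) m' / ch e = of_real R ^ size m' * (\<Prod>i\<in>UNIV. (\<zeta> ^ e i) ^ count m' i / (\<zeta> ^ e i) ^ count m i)" for e
    proof -
      have "(\<Prod>i\<in>UNIV. of_real R ^ count m' i) = (of_real R ^ size m' :: complex)"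
        by (simp add: size_multiset_overloaded_eq power_sum[symmetric] sum.mono_neutral_right[of UNIV "set_mset m'"]
            not_in_iff)
      then show ?thesis
        unfolding monom_val_eq_prod pt_def ch_def vec_lambda_beta power_mult_distrib prod.distrib prod_dividef by simp
    qed
    then have "(\<Sum>e\<in>E. monom_val (pt e) m' / ch e) =
        of_real R ^ size m' * (\<Prod>i\<in>UNIV. \<Sum>x<N. (\<zeta> ^ x) ^ count m' i / (\<zeta> ^ x) ^ count m i)"
      unfolding E_def by (simp add: prod_sum_PiE sum_distrib_left)
    also have "(\<Prod>i\<in>UNIV. \<Sum>x<N. (\<zeta> ^ x) ^ count m' i / (\<zeta> ^ x) ^ count m i) =
        (\<Prod>i\<in>UNIV. if count m' i = count m i then of_nat N else 0)"
      unfolding \<zeta>_def by (intro prod.cong refl sum_roots_of_unity count_less F that)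
    also have "\<dots> = (if m' = m then of_nat (N ^ CARD('d)) else 0)"
    proof (cases "m' = m")
      case False
      then obtain i where "count m' i \<noteq> count m i" by (auto simp: multiset_eq_iff)
      then show ?thesis using False by (auto intro!: bexI[of _ i])
    qed simp
    finally show ?thesis by simp
  qed
  have "(\<Sum>e\<in>E. (\<Sum>m'\<in>F. a m' * monom_val (pt e) m') / ch e) = (\<Sum>m'\<in>F. a m' * (\<Sum>e\<in>E. monom_val (pt e) m' / ch e))"
    unfolding sum_divide_distrib sum_distrib_left by (subst sum.swap) simp
  also have "\<dots> = (\<Sum>m'\<in>F. if m' = m then a m * (of_real R ^ size m * of_nat (N ^ CARD('d))) else 0)"
    by (intro sum.cong) (auto simp: orth)
  also have "\<dots> = a m * (of_real R ^ size m * of_nat (N ^ CARD('d)))"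
    using F by simp
  finally have "?g m * real (N ^ CARD('d)) = cmod (\<Sum>e\<in>E. (\<Sum>m'\<in>F. a m' * monom_val (pt e) m') / ch e)"
    using R by (simp add: norm_mult norm_power)
  also have "\<dots> \<le> (\<Sum>e\<in>E. B + \<epsilon>)"
  proof (rule sum_norm_le)
    fix e
    have "cmod (pt e $ i) = R" for i using R by (simp add: pt_def norm_mult norm_power norm_\<zeta>)
    then show "cmod ((\<Sum>m'\<in>F. a m' * monom_val (pt e) m') / ch e) \<le> B + \<epsilon>"
      using F_le[of "pt e"] by (simp add: norm_divide norm_ch)
  qed
  also have "\<dots> = (B + \<epsilon>) * real (N ^ CARD('d))" by (simp add: cardE)
  finally show "?g m \<le> B + \<epsilon>"
    by (rule mult_right_le_imp_le) (simp add: N_def)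
qed


section \<open>Taylor expansion of entire functions on \<open>\<complex>\<^sup>d\<close>\<close>

definition vec_upd :: "complex ^ 'd \<Rightarrow> 'd \<Rightarrow> complex \<Rightarrow> complex ^ 'd" where
  "vec_upd \<omega> i t = (\<chi> j. if j = i then t else \<omega> $ j)"

lemma vec_upd_nth [simp]: "vec_upd \<omega> i t $ j = (if j = i then t else \<omega> $ j)"
  by (simp add: vec_upd_def)

lemma vec_upd_same [simp]: "vec_upd \<omega> i (\<omega> $ i) = \<omega>"
  and vec_upd_upd [simp]: "vec_upd (vec_upd \<omega> i s) i t = vec_upd \<omega> i t"
  and vec_upd_swap: "i \<noteq> j \<Longrightarrow> vec_upd (vec_upd \<omega> i s) j t = vec_upd (vec_upd \<omega> j t) i s"
  by (auto simp: vec_eq_iff)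

text \<open>Functions that are entire in each variable and bounded on bounded sets. In contrast to
  complex differentiability in several variables, this is easily seen to be inherited by the Taylor coefficients
  with respect to a single variable.\<close>

definition separately_entire :: "(complex ^ ('d::finite) \<Rightarrow> complex) \<Rightarrow> bool" where
  "separately_entire g \<longleftrightarrow> (\<forall>i \<omega>. (\<lambda>t. g (vec_upd \<omega> i t)) holomorphic_on UNIV) \<and>
     (\<forall>R. \<exists>B. \<forall>\<omega>. (\<forall>i. cmod (\<omega> $ i) \<le> R) \<longrightarrow> cmod (g \<omega>) \<le> B)"

lemma holomorphic_Cd_separately_entire:
  fixes f :: "complex ^ ('d::finite) \<Rightarrow> complex"
  assumes "holomorphic_Cd f UNIV"
  shows "separately_entire f"
  unfolding separately_entire_def
proof (intro conjI allI)
  fix i :: 'd and \<omega> :: "complex ^ 'd"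
  have upd: "vec_upd \<omega> i = (\<lambda>t. vec_upd \<omega> i 0 + t *s axis i 1)"
    by (auto simp: fun_eq_iff vec_eq_iff axis_def)
  have "linear (\<lambda>t. t *s axis i 1 :: complex ^ 'd)"
    by (rule linearI) (auto simp: vec_eq_iff algebra_simps)
  then have lin: "bounded_linear (\<lambda>t. t *s axis i 1 :: complex ^ 'd)"
    by (simp add: linear_conv_bounded_linear)
  have "(\<lambda>t. f (vec_upd \<omega> i t)) field_differentiable at z" for z
  proof -
    obtain D where D: "(f has_derivative D) (at (vec_upd \<omega> i z))" "\<And>c v. D (c *s v) = c * D v"
      using assms unfolding holomorphic_Cd_def by blast
    have "(vec_upd \<omega> i has_derivative (\<lambda>t. 0 + t *s axis i 1)) (at z)"
      by (subst upd) (intro has_derivative_add has_derivative_const bounded_linear_imp_has_derivative lin)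
    from has_derivative_compose[OF this D(1)]
    have "((\<lambda>t. f (vec_upd \<omega> i t)) has_field_derivative D (axis i 1)) (at z)"
      unfolding has_field_derivative_def by (simp add: D(2) mult.commute[of _ "D (axis i 1)"])
    then show ?thesis unfolding field_differentiable_def by blast
  qed
  then show "(\<lambda>t. f (vec_upd \<omega> i t)) holomorphic_on UNIV"
    by (simp add: holomorphic_on_def)
next
  fix R
  have "continuous_on UNIV f"
    using assms unfolding holomorphic_Cd_def continuous_on_eq_continuous_within
    by (metis UNIV_I has_derivative_continuous)
  then have "compact (f ` cball 0 (real CARD('d) * R))"
    by (intro compact_continuous_image) (auto intro: continuous_on_subset)
  then obtain B where B: "\<And>y. y \<in> f ` cball 0 (real CARD('d) * R) \<Longrightarrow> norm y \<le> B"
    using compact_imp_bounded bounded_iff by metis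
  have "cmod (f \<omega>) \<le> B" if "\<forall>i. cmod (\<omega> $ i) \<le> R" for \<omega>
    using B norm_le_card_times[of \<omega> R] that by auto
  then show "\<exists>B. \<forall>\<omega>. (\<forall>i. cmod (\<omega> $ i) \<le> R) \<longrightarrow> cmod (f \<omega>) \<le> B" by blast
qed

definition partial_taylor :: "'d \<Rightarrow> nat \<Rightarrow> (complex ^ 'd \<Rightarrow> complex) \<Rightarrow> complex ^ 'd \<Rightarrow> complex" where
  "partial_taylor i n g \<omega> = (deriv ^^ n) (\<lambda>t. g (vec_upd \<omega> i t)) 0 / fact n"

lemma partial_taylor_upd [simp]: "partial_taylor i n g (vec_upd \<omega> i t) = partial_taylor i n g \<omega>"
  by (simp add: partial_taylor_def)

lemma partial_taylor_bound:
  assumes "separately_entire g" "R > 0" "\<And>t. cmod t = R \<Longrightarrow> cmod (g (vec_upd \<omega> i t)) \<le> B"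
  shows "cmod (partial_taylor i n g \<omega>) * R ^ n \<le> B"
proof -
  have hol: "(\<lambda>t. g (vec_upd \<omega> i t)) holomorphic_on UNIV"
    using assms(1) by (simp add: separately_entire_def)
  have "cmod ((deriv ^^ n) (\<lambda>t. g (vec_upd \<omega> i t)) 0) \<le> fact n * B / R ^ n"
    using assms by (intro Cauchy_inequality holomorphic_on_imp_continuous_on)
                   (auto intro: holomorphic_on_subset[OF hol])
  then show ?thesis using assms(2) by (simp add: partial_taylor_def norm_divide field_simps)
qed

lemma partial_taylor_sums:
  assumes "separately_entire g"
  shows "(\<lambda>n. partial_taylor i n g \<omega> * t ^ n) sums g (vec_upd \<omega> i t)"
proof -
  have "(\<lambda>t. g (vec_upd \<omega> i t)) holomorphic_on UNIV"
    using assms by (simp add: separately_entire_def)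
  then show ?thesis
    using holomorphic_power_series[of "\<lambda>t. g (vec_upd \<omega> i t)" 0 "cmod t + 1" t]
    by (simp add: partial_taylor_def holomorphic_on_subset)
qed

text \<open>The \<open>n\<close>-th coefficient is the locally uniform limit for \<open>t \<rightarrow> 0\<close> of the function minus its Taylor
  polynomial of degree \<open>n - 1\<close>, divided by \<open>t\<^sup>n\<close>.\<close>

lemma partial_taylor_limit:
  assumes g: "separately_entire g" and B: "\<And>s. cmod s = 1 \<Longrightarrow> cmod (g (vec_upd \<omega> i s)) \<le> B"
    and t: "0 < t" "t \<le> 1/2"
  shows "cmod ((g (vec_upd \<omega> i (of_real t)) - (\<Sum>k<n. partial_taylor i k g \<omega> * of_real t ^ k)) / of_real t ^ n -
          partial_taylor i n g \<omega>) \<le> 2 * B * t"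
proof -
  let ?c = "\<lambda>k. partial_taylor i k g \<omega>" and ?t = "complex_of_real t"
  let ?h = "(g (vec_upd \<omega> i ?t) - (\<Sum>k<n. ?c k * ?t ^ k)) / ?t ^ n"
  have c: "cmod (?c k) \<le> B" for k using partial_taylor_bound[OF g, of 1 \<omega> i B k] B by simp
  have "(\<lambda>p. ?c (p + n) * ?t ^ (p + n)) sums (g (vec_upd \<omega> i ?t) - (\<Sum>k<n. ?c k * ?t ^ k))"
    using partial_taylor_sums[OF g, of i \<omega> ?t] by (rule sums_split_initial_segment)
  then have "(\<lambda>p. ?c (p + n) * ?t ^ (p + n) / ?t ^ n) sums ?h" by (rule sums_divide)
  then have "(\<lambda>p. ?c (p + n) * ?t ^ p) sums ?h" using t by (simp add: power_add)
  then have "(\<lambda>p. ?c (Suc p + n) * ?t ^ Suc p) sums (?h - ?c n)"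
    by (subst sums_Suc_iff) simp
  moreover have "(\<lambda>p. (B * t) * t ^ p) sums ((B * t) * (1 / (1 - t)))"
    using t by (intro sums_mult geometric_sums) auto
  ultimately have "cmod (?h - ?c n) \<le> (B * t) * (1 / (1 - t))"
  proof (rule norm_sums_le)
    fix p
    show "cmod (?c (Suc p + n) * ?t ^ Suc p) \<le> (B * t) * t ^ p"
      using t c[of "Suc p + n"] by (simp add: norm_mult norm_power mult.assoc mult_right_mono)
  qed
  also have "\<dots> \<le> (B * t) * 2"
    using t order_trans[OF norm_ge_zero c] by (intro mult_left_mono) (auto simp: field_simps)
  finally show ?thesis by (simp add: mult_ac)
qed

lemma separately_entire_partial_taylor:
  fixes g :: "complex ^ ('d::finite) \<Rightarrow> complex"
  assumes g: "separately_entire g"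
  shows "separately_entire (partial_taylor i n g)"
proof (induction n rule: less_induct)
  case (less n)
  show ?case
    unfolding separately_entire_def
  proof (intro conjI allI)
    fix R :: real
    let ?R = "max 1 R"
    obtain B where B: "\<And>\<omega>. (\<forall>i. cmod (\<omega> $ i) \<le> ?R) \<Longrightarrow> cmod (g \<omega>) \<le> B"
      using g unfolding separately_entire_def by blast
    have "cmod (partial_taylor i n g \<omega>) \<le> B" if "\<forall>i. cmod (\<omega> $ i) \<le> R" for \<omega>
    proof -
      have "cmod (g (vec_upd \<omega> i t)) \<le> B" if "cmod t = 1" for t
        by (rule B) (use that \<open>\<forall>i. cmod (\<omega> $ i) \<le> R\<close> in \<open>auto simp: le_max_iff_disj\<close>)
      then show ?thesis using partial_taylor_bound[OF g, of 1 \<omega> i B n] by simp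
    qed
    then show "\<exists>B. \<forall>\<omega>. (\<forall>i. cmod (\<omega> $ i) \<le> R) \<longrightarrow> cmod (partial_taylor i n g \<omega>) \<le> B" by blast
  next
    fix j \<omega>
    show "(\<lambda>s. partial_taylor i n g (vec_upd \<omega> j s)) holomorphic_on UNIV"
    proof (cases "j = i")
      case False
      define t where "t q = inverse (real (Suc (Suc q)))" for q
      have t: "0 < t q" "t q \<le> 1/2" for q by (simp_all add: t_def field_simps)
      show ?thesis
      proof (rule holomorphic_uniform_sequence[where f = "\<lambda>q s.
          (g (vec_upd (vec_upd \<omega> j s) i (of_real (t q))) -
           (\<Sum>k<n. partial_taylor i k g (vec_upd \<omega> j s) * of_real (t q) ^ k)) / of_real (t q) ^ n"])
        fix q
        have "(\<lambda>s. g (vec_upd (vec_upd \<omega> i (of_real (t q))) j s)) holomorphic_on UNIV"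
          using g by (simp add: separately_entire_def)
        then have "(\<lambda>s. g (vec_upd (vec_upd \<omega> j s) i (of_real (t q)))) holomorphic_on UNIV"
          using vec_upd_swap[OF False] by simp
        moreover have "(\<lambda>s. partial_taylor i k g (vec_upd \<omega> j s)) holomorphic_on UNIV" if "k < n" for k
          using less.IH[OF that] by (simp add: separately_entire_def)
        ultimately show "(\<lambda>s. (g (vec_upd (vec_upd \<omega> j s) i (of_real (t q))) -
           (\<Sum>k<n. partial_taylor i k g (vec_upd \<omega> j s) * of_real (t q) ^ k)) / of_real (t q) ^ n) holomorphic_on UNIV"
          using t[of q] by (intro holomorphic_intros) auto
      next
        fix x :: complex
        obtain B where B: "\<And>\<omega>'. (\<forall>i. cmod (\<omega>' $ i) \<le> norm \<omega> + cmod x + 1) \<Longrightarrow> cmod (g \<omega>') \<le> B"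
          using g unfolding separately_entire_def by blast
        have close: "cmod ((g (vec_upd (vec_upd \<omega> j s) i (of_real (t q))) -
           (\<Sum>k<n. partial_taylor i k g (vec_upd \<omega> j s) * of_real (t q) ^ k)) / of_real (t q) ^ n -
           partial_taylor i n g (vec_upd \<omega> j s)) \<le> 2 * B * t q" if s: "s \<in> cball x 1" for s q
        proof (rule partial_taylor_limit[OF g _ t])
          fix u :: complex assume u: "cmod u = 1"
          have "cmod s \<le> cmod x + 1" using s norm_triangle_ineq2[of s x] by (simp add: dist_norm norm_minus_commute)
          then have "cmod (vec_upd (vec_upd \<omega> j s) i u $ l) \<le> norm \<omega> + cmod x + 1" for l
            using u Finite_Cartesian_Product.norm_nth_le[of \<omega> l] norm_ge_zero[of \<omega>] norm_ge_zero[of x]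
            unfolding vec_upd_nth by (smt (verit))
          then show "cmod (g (vec_upd (vec_upd \<omega> j s) i u)) \<le> B" by (intro B) auto
        qed
        have "(\<lambda>q. 2 * B * t q) \<longlonglongrightarrow> 2 * B * 0"
          unfolding t_def by (intro tendsto_mult tendsto_const LIMSEQ_Suc[OF LIMSEQ_inverse_real_of_nat])
        then have lim: "(\<lambda>q. 2 * B * t q) \<longlonglongrightarrow> 0" by simp
        have "uniform_limit (cball x 1) (\<lambda>q s. (g (vec_upd (vec_upd \<omega> j s) i (of_real (t q))) -
           (\<Sum>k<n. partial_taylor i k g (vec_upd \<omega> j s) * of_real (t q) ^ k)) / of_real (t q) ^ n)
           (\<lambda>s. partial_taylor i n g (vec_upd \<omega> j s)) sequentially"
        proof (rule uniform_limitI)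
          fix e :: real assume "e > 0"
          with order_tendstoD(2)[OF lim] have "\<forall>\<^sub>F q in sequentially. 2 * B * t q < e" by simp
          then show "\<forall>\<^sub>F q in sequentially. \<forall>s\<in>cball x 1. dist
              ((g (vec_upd (vec_upd \<omega> j s) i (of_real (t q))) -
                (\<Sum>k<n. partial_taylor i k g (vec_upd \<omega> j s) * of_real (t q) ^ k)) / of_real (t q) ^ n)
              (partial_taylor i n g (vec_upd \<omega> j s)) < e"
          proof eventually_elim
            case (elim q)
            then show ?case unfolding dist_norm by (blast intro: le_less_trans[OF close])
          qed
        qed
        then show "\<exists>d>0. cball x d \<subseteq> UNIV \<and> uniform_limit (cball x d) (\<lambda>q s.
          (g (vec_upd (vec_upd \<omega> j s) i (of_real (t q))) -
           (\<Sum>k<n. partial_taylor i k g (vec_upd \<omega> j s) * of_real (t q) ^ k)) / of_real (t q) ^ n)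
           (\<lambda>s. partial_taylor i n g (vec_upd \<omega> j s)) sequentially"
          by (intro exI[of _ 1]) auto
      qed simp
    qed simp
  qed
qed

text \<open>Expansion with respect to the variables in \<open>I\<close>; the induction adds one variable at a time.\<close>

lemma taylor_expansion_in_variables:
  fixes f :: "complex ^ ('d::finite) \<Rightarrow> complex"
  assumes f: "separately_entire f" and I: "finite I"
  obtains c where
    "\<And>m. separately_entire (c m)"
    "\<And>m i \<omega> t. i \<in> I \<Longrightarrow> c m (vec_upd \<omega> i t) = c m \<omega>"
    "\<And>m R B \<omega>. R > 0 \<Longrightarrow> (\<And>\<omega>. (\<And>i. cmod (\<omega> $ i) \<le> R) \<Longrightarrow> cmod (f \<omega>) \<le> B) \<Longrightarrow>
       (\<And>i. cmod (\<omega> $ i) \<le> R) \<Longrightarrow> cmod (c m \<omega>) * R ^ size m \<le> B"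
    "\<And>\<omega>. ((\<lambda>m. c m \<omega> * monom_val \<omega> m) has_sum f \<omega>) {m. set_mset m \<subseteq> I}"
proof -
  define P where "P I c \<longleftrightarrow> (\<forall>m. separately_entire (c m)) \<and>
    (\<forall>m i \<omega> t. i \<in> I \<longrightarrow> c m (vec_upd \<omega> i t) = c m \<omega>) \<and>
    (\<forall>m R B \<omega>. R > 0 \<longrightarrow> (\<forall>\<omega>. (\<forall>i. cmod (\<omega> $ i) \<le> R) \<longrightarrow> cmod (f \<omega>) \<le> B) \<longrightarrow>
       (\<forall>i. cmod (\<omega> $ i) \<le> R) \<longrightarrow> cmod (c m \<omega>) * R ^ size m \<le> B) \<and>
    (\<forall>\<omega>. ((\<lambda>m. c m \<omega> * monom_val \<omega> m) has_sum f \<omega>) {m. set_mset m \<subseteq> I})"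
    for I and c :: "'d multiset \<Rightarrow> complex ^ 'd \<Rightarrow> complex"
  have "\<exists>c. P I c"
    using I
  proof (induction I rule: finite_induct)
    case empty
    have "P {} (\<lambda>m. if m = {#} then f else (\<lambda>_. 0))"
    proof -
      have "0 \<le> B" if "\<forall>\<omega>. (\<forall>i. cmod (\<omega> $ i) \<le> R) \<longrightarrow> cmod (f \<omega>) \<le> B" "R > 0" for R B
        using that(1)[rule_format, of 0] that(2) by (auto intro: order_trans[OF norm_ge_zero])
      moreover have "separately_entire (\<lambda>_. 0 :: complex)" by (auto simp: separately_entire_def)
      moreover have "{m :: 'd multiset. set_mset m \<subseteq> {}} = {{#}}" by auto
      ultimately show ?thesis using f by (auto simp: P_def has_sum_finite_iff)
    qed
    then show ?case by blast
  next
    case (insert i I)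
    then obtain c where "P I c" by blast
    then have c: "\<And>m. separately_entire (c m)" "\<And>m j \<omega> t. j \<in> I \<Longrightarrow> c m (vec_upd \<omega> j t) = c m \<omega>"
      "\<And>m R B \<omega>. R > 0 \<Longrightarrow> (\<And>\<omega>. (\<And>i. cmod (\<omega> $ i) \<le> R) \<Longrightarrow> cmod (f \<omega>) \<le> B) \<Longrightarrow>
       (\<And>i. cmod (\<omega> $ i) \<le> R) \<Longrightarrow> cmod (c m \<omega>) * R ^ size m \<le> B"
      "\<And>\<omega>. ((\<lambda>m. c m \<omega> * monom_val \<omega> m) has_sum f \<omega>) {m. set_mset m \<subseteq> I}"
      unfolding P_def by blast+
    define c' where "c' m = partial_taylor i (count m i) (c (filter_mset (\<lambda>j. j \<noteq> i) m))" for m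
    have size: "size m = size (filter_mset (\<lambda>j. j \<noteq> i) m) + count m i" for m :: "'d multiset"
    proof -
      have "m = filter_mset (\<lambda>j. j \<noteq> i) m + replicate_mset (count m i) i"
        by (rule multiset_eqI) auto
      then show ?thesis by (metis size_replicate_mset size_union)
    qed
    have bound: "cmod (c' m \<omega>) * R ^ size m \<le> B"
      if R: "R > 0" and fB: "\<And>\<omega>. (\<And>i. cmod (\<omega> $ i) \<le> R) \<Longrightarrow> cmod (f \<omega>) \<le> B"
        and \<omega>: "\<And>i. cmod (\<omega> $ i) \<le> R" for m R B \<omega>
    proof -
      let ?m = "filter_mset (\<lambda>j. j \<noteq> i) m"
      have "cmod (c' m \<omega>) * R ^ count m i \<le> B / R ^ size ?m"
        unfolding c'_def
      proof (rule partial_taylor_bound[OF c(1) R])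
        fix t assume "cmod t = R"
        then have "cmod (c ?m (vec_upd \<omega> i t)) * R ^ size ?m \<le> B"
          using \<omega> by (intro c(3) R fB) auto
        then show "cmod (c ?m (vec_upd \<omega> i t)) \<le> B / R ^ size ?m"
          using R by (simp add: field_simps)
      qed
      then show ?thesis unfolding size[of m] using R by (simp add: power_add field_simps)
    qed
    have indep: "c' m (vec_upd \<omega> j t) = c' m \<omega>" if "j \<in> insert i I" for m j \<omega> t
    proof (cases "j = i")
      case False
      then have "c m' (vec_upd (vec_upd \<omega> j t) i s) = c m' (vec_upd \<omega> i s)" for m' s
        using that c(2) vec_upd_swap[OF False] by auto
      then show ?thesis by (simp add: c'_def partial_taylor_def)
    qed (simp add: c'_def)
    have summable: "(\<lambda>m. norm (c' m \<omega> * monom_val \<omega> m)) summable_on UNIV" for \<omega>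
    proof -
      \<comment> \<open>A radius at which the Cauchy bounds dominate the terms at \<open>\<omega>\<close> by a geometric series of ratio at most \<open>1 / (2 d)\<close>.\<close>
      define R where "R = 2 * real CARD('d) * (norm \<omega> + 1)"
      have R: "R > 0" "norm \<omega> \<le> R"
      proof -
        have "1 \<le> real CARD('d)" by (simp add: Suc_le_eq)
        then have "1 * norm \<omega> \<le> 2 * real CARD('d) * (norm \<omega> + 1)"
          by (intro mult_mono) (simp_all add: order_trans[of 1 "real CARD('d)"])
        then show "norm \<omega> \<le> R" by (simp add: R_def)
        show "R > 0" by (simp add: R_def add_nonneg_pos)
      qed
      obtain B where B: "\<And>\<omega>. (\<forall>i. cmod (\<omega> $ i) \<le> R) \<Longrightarrow> cmod (f \<omega>) \<le> B"
        using f unfolding separately_entire_def by blast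
      have le: "norm (c' m \<omega> * monom_val \<omega> m) \<le> B * (norm \<omega> / R) ^ size m" for m
      proof -
        have \<omega>: "cmod (\<omega> $ i) \<le> R" for i using Finite_Cartesian_Product.norm_nth_le[of \<omega> i] R by linarith
        have "cmod (c' m \<omega>) \<le> B / R ^ size m"
          using bound[OF R(1), of B \<omega> m] B \<omega> R by (simp add: field_simps)
        moreover have "cmod (monom_val \<omega> m) \<le> norm \<omega> ^ size m"
          by (intro monom_val_le Finite_Cartesian_Product.norm_nth_le)
        ultimately have "cmod (c' m \<omega>) * cmod (monom_val \<omega> m) \<le> B / R ^ size m * norm \<omega> ^ size m"
          by (intro mult_mono) (auto intro: order_trans[OF norm_ge_zero])
        then show ?thesis by (simp add: norm_mult power_divide)
      qed
      have "real CARD('d) * (norm \<omega> / R) \<le> 1/2"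
      proof -
        have "2 * (real CARD('d) * norm \<omega>) \<le> R" by (simp add: R_def algebra_simps)
        then show ?thesis using R by (simp add: field_simps)
      qed
      then have "(\<lambda>m :: 'd multiset. B * (norm \<omega> / R) ^ size m) summable_on UNIV"
        using R by (intro summable_on_cmult_right multisets_geometric_summable) auto
      then show ?thesis by (rule summable_on_comparison_test) (use le in auto)
    qed
    have sum: "((\<lambda>m. c' m \<omega> * monom_val \<omega> m) has_sum f \<omega>) {m. set_mset m \<subseteq> insert i I}" for \<omega>
    proof -
      let ?h = "\<lambda>(m, n). m + replicate_mset n i"
      have bij: "bij_betw ?h (Sigma {m. set_mset m \<subseteq> I} (\<lambda>_. UNIV)) {m. set_mset m \<subseteq> insert i I}"
      proof (rule bij_betw_byWitness[where f' = "\<lambda>m. (filter_mset (\<lambda>j. j \<noteq> i) m, count m i)"])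
        show "\<forall>x\<in>Sigma {m. set_mset m \<subseteq> I} (\<lambda>_. UNIV). (filter_mset (\<lambda>j. j \<noteq> i) (?h x), count (?h x) i) = x"
        proof
          fix x :: "'d multiset \<times> nat" assume x: "x \<in> Sigma {m. set_mset m \<subseteq> I} (\<lambda>_. UNIV)"
          obtain m n where mn: "x = (m, n)" by (cases x)
          with x have "set_mset m \<subseteq> I" by simp
          then have "i \<notin># m" using insert by auto
          then have "filter_mset (\<lambda>j. j \<noteq> i) m = m" by (induction m) auto
          moreover have "count m i = 0" using \<open>i \<notin># m\<close> by (simp add: not_in_iff)
          moreover have "filter_mset (\<lambda>j. j \<noteq> i) (replicate_mset n i) = {#}" by (induction n) auto
          ultimately show "(filter_mset (\<lambda>j. j \<noteq> i) (?h x), count (?h x) i) = x"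
            by (simp add: mn)
        qed
        show "\<forall>m\<in>{m. set_mset m \<subseteq> insert i I}. ?h (filter_mset (\<lambda>j. j \<noteq> i) m, count m i) = m"
          by (auto intro!: multiset_eqI)
      qed (auto split: if_splits)
      let ?f = "\<lambda>x. c' (?h x) \<omega> * monom_val \<omega> (?h x)"
      have c'h: "c' (?h (m, n)) \<omega> = partial_taylor i n (c m) \<omega>" if "set_mset m \<subseteq> I" for m n
      proof -
        have "i \<notin># m" using insert that by auto
        then have "filter_mset (\<lambda>j. j \<noteq> i) m = m" by (induction m) auto
        moreover have "count m i = 0" using \<open>i \<notin># m\<close> by (simp add: not_in_iff)
        moreover have "filter_mset (\<lambda>j. j \<noteq> i) (replicate_mset n i) = {#}" by (induction n) auto
        ultimately have "filter_mset (\<lambda>j. j \<noteq> i) (m + replicate_mset n i) = m"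
            "count (m + replicate_mset n i) i = n"
          by (simp_all only: filter_union_mset add_0_right count_union count_replicate_mset if_True add_0_left refl)
        then show ?thesis by (simp add: c'_def del: filter_union_mset)
      qed
      have "(\<lambda>m. c' m \<omega> * monom_val \<omega> m) summable_on {m. set_mset m \<subseteq> insert i I}"
        by (rule summable_on_subset[OF abs_summable_summable[OF summable]]) auto
      then have summ: "?f summable_on Sigma {m. set_mset m \<subseteq> I} (\<lambda>_. UNIV)"
        by (subst summable_on_reindex_bij_betw[OF bij, of "\<lambda>m. c' m \<omega> * monom_val \<omega> m"])
      have "(?f has_sum f \<omega>) (Sigma {m. set_mset m \<subseteq> I} (\<lambda>_. UNIV))"
      proof (rule has_sum_SigmaI[OF _ c(4) summ])
        fix m assume "m \<in> {m. set_mset m \<subseteq> I}"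
        then have m: "set_mset m \<subseteq> I" by simp
        have "(\<lambda>(m, n). ?f (m, n)) summable_on Sigma {m. set_mset m \<subseteq> I} (\<lambda>_. UNIV)"
          using summ by (simp add: case_prod_unfold)
        then have "(\<lambda>n. ?f (m, n)) summable_on UNIV"
          by (rule summable_on_SigmaD1[where f = "\<lambda>m n. ?f (m, n)"]) (use m in simp)
        moreover have "?f (m, n) = partial_taylor i n (c m) \<omega> * (\<omega> $ i) ^ n * monom_val \<omega> m" for n
          unfolding c'h[OF m] by (simp add: monom_val_plus monom_val_replicate)
        moreover have "(\<lambda>n. partial_taylor i n (c m) \<omega> * (\<omega> $ i) ^ n * monom_val \<omega> m) sums (c m \<omega> * monom_val \<omega> m)"
          using partial_taylor_sums[OF c(1), of i m \<omega> "\<omega> $ i"] by (intro sums_mult2) simp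
        ultimately show "((\<lambda>n. ?f (m, n)) has_sum c m \<omega> * monom_val \<omega> m) UNIV"
          by (metis (no_types, lifting) ext has_sum_imp_sums has_sum_infsum sums_unique2)
      qed
      then show ?thesis
        by (subst (asm) has_sum_reindex_bij_betw[OF bij, of "\<lambda>m. c' m \<omega> * monom_val \<omega> m"])
    qed
    have "P (insert i I) c'"
      unfolding P_def
    proof (intro conjI allI impI)
      show "separately_entire (c' m)" for m
        unfolding c'_def by (intro separately_entire_partial_taylor c)
      show "c' m (vec_upd \<omega> j t) = c' m \<omega>" if "j \<in> insert i I" for m j \<omega> t
        by (rule indep) (fact that)
      show "cmod (c' m \<omega>) * R ^ size m \<le> B"
        if "R > 0" "\<forall>\<omega>. (\<forall>i. cmod (\<omega> $ i) \<le> R) \<longrightarrow> cmod (f \<omega>) \<le> B" "\<forall>i. cmod (\<omega> $ i) \<le> R" for m R B \<omega>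
        using that by (intro bound) auto
      show "((\<lambda>m. c' m \<omega> * monom_val \<omega> m) has_sum f \<omega>) {m. set_mset m \<subseteq> insert i I}" for \<omega>
        by (rule sum)
    qed
    then show ?case by blast
  qed
  then show thesis using that unfolding P_def by blast
qed

definition entire_coeffs :: "('d multiset \<Rightarrow> complex) \<Rightarrow> bool" where
  "entire_coeffs a \<longleftrightarrow> (\<forall>R>0. (\<lambda>m. cmod (a m) * R ^ size m) summable_on UNIV)"

text \<open>After expansion in all variables the coefficients are constants. Their bounds on every polydisc give
  absolute convergence everywhere.\<close>

theorem entire_power_series:
  fixes f :: "complex ^ ('d::finite) \<Rightarrow> complex"
  assumes f: "holomorphic_Cd f UNIV"
  obtains a where "entire_coeffs a" "f = power_series a"
proof -
  have sep: "separately_entire f" by (rule holomorphic_Cd_separately_entire[OF f])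
  show thesis
  proof (rule taylor_expansion_in_variables[OF sep finite_class.finite_UNIV])
    fix c :: "'d multiset \<Rightarrow> complex ^ 'd \<Rightarrow> complex"
    assume c: "\<And>m i \<omega> t. i \<in> UNIV \<Longrightarrow> c m (vec_upd \<omega> i t) = c m \<omega>"
      "\<And>m R B \<omega>. R > 0 \<Longrightarrow> (\<And>\<omega>. (\<And>i. cmod (\<omega> $ i) \<le> R) \<Longrightarrow> cmod (f \<omega>) \<le> B) \<Longrightarrow>
         (\<And>i. cmod (\<omega> $ i) \<le> R) \<Longrightarrow> cmod (c m \<omega>) * R ^ size m \<le> B"
      "\<And>\<omega>. ((\<lambda>m. c m \<omega> * monom_val \<omega> m) has_sum f \<omega>) {m. set_mset m \<subseteq> UNIV}"
    have const: "c m \<omega> = c m 0" for m \<omega>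
    proof -
      have "c m \<omega> = c m (\<chi> j. if j \<in> I then 0 else \<omega> $ j)" if "finite I" for I
        using that
      proof (induction I)
        case (insert i I)
        have "(\<chi> j. if j \<in> insert i I then 0 else \<omega> $ j) = vec_upd (\<chi> j. if j \<in> I then 0 else \<omega> $ j) i 0"
          by (auto simp: vec_eq_iff)
        then show ?case using insert c(1) by simp
      qed simp
      from this[of UNIV] show ?thesis by (simp add: zero_vec_def)
    qed
    let ?a = "\<lambda>m. c m 0"
    have "(\<lambda>m. cmod (?a m) * R ^ size m) summable_on UNIV" if R: "R > 0" for R
    proof -
      \<comment> \<open>The ratio of a geometric series over multi-indices with sum at most 2; the Cauchy bounds are used at radius \<open>R / q\<close>.\<close>
      let ?q = "1 / (2 * real CARD('d))"
      let ?R = "R / ?q"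
      obtain B where B: "\<And>\<omega>. (\<forall>i. cmod (\<omega> $ i) \<le> ?R) \<Longrightarrow> cmod (f \<omega>) \<le> B"
        using sep unfolding separately_entire_def by blast
      have le: "cmod (?a m) * R ^ size m \<le> B * ?q ^ size m" for m
      proof -
        have "cmod (?a m) * ?R ^ size m \<le> B" using R B by (intro c(2)) auto
        then have "cmod (?a m) * ?R ^ size m * ?q ^ size m \<le> B * ?q ^ size m" by (intro mult_right_mono) auto
        also have "cmod (?a m) * ?R ^ size m * ?q ^ size m = cmod (?a m) * (?R * ?q) ^ size m"
          by (simp only: power_mult_distrib mult.assoc)
        also have "?R * ?q = R" by simp
        finally show ?thesis .
      qed
      have "(\<lambda>m :: 'd multiset. B * ?q ^ size m) summable_on UNIV"
        by (intro summable_on_cmult_right multisets_geometric_summable) auto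
      then show ?thesis by (rule summable_on_comparison_test) (use le R in auto)
    qed
    then have "entire_coeffs ?a" unfolding entire_coeffs_def by blast
    moreover have "f = power_series ?a"
    proof
      fix \<omega>
      show "f \<omega> = power_series ?a \<omega>"
        unfolding power_series_def using c(3)[of \<omega>] by (subst (asm) const) (simp add: infsumI)
    qed
    ultimately show thesis by (rule that)
  qed
qed

lemma entire_coeffs_summable: "entire_coeffs a \<Longrightarrow> R > 0 \<Longrightarrow> (\<lambda>m. cmod (a m) * R ^ size m) summable_on UNIV"
  by (simp add: entire_coeffs_def)

lemma entire_coeffs_abs_summable:
  assumes "entire_coeffs a"
  shows "(\<lambda>m. norm (a m * monom_val \<omega> m)) summable_on UNIV"
proof (rule power_series_abs_summable[where R = "norm \<omega> + 1"])
  show "(\<lambda>m. cmod (a m) * (norm \<omega> + 1) ^ size m) summable_on UNIV"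
    by (rule entire_coeffs_summable[OF assms]) (simp add: add_nonneg_pos)
  show "cmod (\<omega> $ i) \<le> norm \<omega> + 1" for i
    using Finite_Cartesian_Product.norm_nth_le[of \<omega> i] by linarith
qed

lemma entire_coeffs_lincomb:
  assumes "entire_coeffs a" "entire_coeffs b"
  shows "entire_coeffs (\<lambda>m. c * a m + b m)"
  unfolding entire_coeffs_def
proof (intro allI impI)
  fix R :: real assume R: "R > 0"
  have "(\<lambda>m. cmod c * (cmod (a m) * R ^ size m) + cmod (b m) * R ^ size m) summable_on UNIV"
    using assms R by (intro summable_on_add summable_on_cmult_right entire_coeffs_summable)
  then show "(\<lambda>m. cmod (c * a m + b m) * R ^ size m) summable_on UNIV"
  proof (rule summable_on_comparison_test)
    fix m
    have "cmod (c * a m + b m) \<le> cmod c * cmod (a m) + cmod (b m)"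
      using norm_triangle_ineq[of "c * a m" "b m"] by (simp add: norm_mult)
    then have "cmod (c * a m + b m) * R ^ size m \<le> (cmod c * cmod (a m) + cmod (b m)) * R ^ size m"
      using R by (intro mult_right_mono) auto
    then show "cmod (c * a m + b m) * R ^ size m \<le> cmod c * (cmod (a m) * R ^ size m) + cmod (b m) * R ^ size m"
      by (simp add: algebra_simps)
  qed (use R in auto)
qed

lemma power_series_lincomb:
  assumes "entire_coeffs a" "entire_coeffs b"
  shows "power_series (\<lambda>m. c * a m + b m) \<omega> = c * power_series a \<omega> + power_series b \<omega>"
proof -
  note s = abs_summable_summable[OF entire_coeffs_abs_summable[OF assms(1), of \<omega>]]
    abs_summable_summable[OF entire_coeffs_abs_summable[OF assms(2), of \<omega>]]
  have "power_series (\<lambda>m. c * a m + b m) \<omega> = (\<Sum>\<^sub>\<infinity>m. c * (a m * monom_val \<omega> m) + b m * monom_val \<omega> m)"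
    by (simp add: power_series_def algebra_simps)
  also have "\<dots> = c * power_series a \<omega> + power_series b \<omega>"
    unfolding power_series_def using s
    by (subst infsum_add) (auto simp: infsum_cmult_right intro: summable_on_cmult_right)
  finally show ?thesis .
qed

text \<open>The Cauchy estimate for the difference of two series with the same sum, which is bounded by 0.\<close>

lemma power_series_inject:
  assumes a: "entire_coeffs a" and b: "entire_coeffs b" and eq: "power_series a = power_series b"
  shows "a = b"
proof
  fix m
  have "entire_coeffs (\<lambda>m. (-1) * b m + a m)" by (rule entire_coeffs_lincomb[OF b a])
  then have "cmod ((-1) * b m + a m) * 1 ^ size m \<le> 0"
    by (intro multi_cauchy_estimate entire_coeffs_summable)
       (auto simp: power_series_lincomb[OF b a, of "-1", simplified] eq)
  then show "a m = b m" by simp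
qed

lemma finite_support_entire_coeffs:
  assumes "finite F" "\<And>m. m \<notin> F \<Longrightarrow> a m = 0"
  shows "entire_coeffs a" and "power_series a \<omega> = (\<Sum>m\<in>F. a m * monom_val \<omega> m)"
proof -
  have "(\<lambda>m. cmod (a m) * R ^ size m) summable_on UNIV" for R
    by (rule summable_on_cong_neutral[THEN iffD2, OF _ _ _ summable_on_finite[OF assms(1)]])
       (auto simp: assms(2))
  then show "entire_coeffs a" by (simp add: entire_coeffs_def)
  have "power_series a \<omega> = (\<Sum>\<^sub>\<infinity>m\<in>F. a m * monom_val \<omega> m)"
    unfolding power_series_def by (rule infsum_cong_neutral) (auto simp: assms(2))
  then show "power_series a \<omega> = (\<Sum>m\<in>F. a m * monom_val \<omega> m)" using assms(1) by simp
qed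

text \<open>The bound on the derivatives makes the series of the derivatives of the homogeneous parts converge
  uniformly on balls, so that power series may be differentiated termwise.\<close>

lemma monom_val_has_derivative:
  fixes m :: "('d::finite) multiset"
  shows "\<exists>D. (\<forall>\<omega>. ((\<lambda>\<omega>. monom_val \<omega> m) has_derivative D \<omega>) (at \<omega>)) \<and> (\<forall>\<omega> c v. D \<omega> (c *s v) = c * D \<omega> v) \<and>
    (\<forall>\<omega> (R::real) h. 1 \<le> R \<longrightarrow> norm \<omega> \<le> R \<longrightarrow> cmod (D \<omega> h) \<le> size m * R ^ size m * norm h)"
proof (induction m)
  case empty
  show ?case by (rule exI[of _ "\<lambda>_ _. 0"]) auto
next
  case (add i m)
  then obtain D where D: "\<And>\<omega>. ((\<lambda>\<omega>. monom_val \<omega> m) has_derivative D \<omega>) (at \<omega>)"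
    "\<And>\<omega> c v. D \<omega> (c *s v) = c * D \<omega> v"
    "\<And>\<omega> (R::real) h. 1 \<le> R \<Longrightarrow> norm \<omega> \<le> R \<Longrightarrow> cmod (D \<omega> h) \<le> size m * R ^ size m * norm h"
    by blast
  show ?case
  proof (rule exI[of _ "\<lambda>\<omega> h. \<omega> $ i * D \<omega> h + h $ i * monom_val \<omega> m"], intro conjI allI impI)
    fix \<omega> :: "complex ^ 'd"
    have "((\<lambda>\<omega>. \<omega> $ i) has_derivative (\<lambda>h. h $ i)) (at \<omega>)"
      by (rule bounded_linear_imp_has_derivative[OF bounded_linear_vec_nth])
    from has_derivative_mult[OF this D(1)]
    show "((\<lambda>\<omega>. monom_val \<omega> (add_mset i m)) has_derivative (\<lambda>h. \<omega> $ i * D \<omega> h + h $ i * monom_val \<omega> m)) (at \<omega>)"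
      by simp
  next
    fix \<omega> v :: "complex ^ 'd" and c
    show "\<omega> $ i * D \<omega> (c *s v) + (c *s v) $ i * monom_val \<omega> m = c * (\<omega> $ i * D \<omega> v + v $ i * monom_val \<omega> m)"
      by (simp add: D(2) algebra_simps)
  next
    fix \<omega> h :: "complex ^ 'd" and R :: real assume R: "1 \<le> R" "norm \<omega> \<le> R"
    have i: "cmod (\<omega> $ i) \<le> R" "cmod (h $ i) \<le> norm h" for i
      using Finite_Cartesian_Product.norm_nth_le[of \<omega> i] Finite_Cartesian_Product.norm_nth_le[of h i] R by auto
    have "cmod (\<omega> $ i * D \<omega> h + h $ i * monom_val \<omega> m) \<le> cmod (\<omega> $ i) * cmod (D \<omega> h) + cmod (h $ i) * cmod (monom_val \<omega> m)"
      by (metis norm_mult norm_triangle_ineq)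
    also have "\<dots> \<le> R * (size m * R ^ size m * norm h) + norm h * R ^ size m"
    proof (intro add_mono mult_mono i)
      show "cmod (D \<omega> h) \<le> size m * R ^ size m * norm h" by (rule D(3)[OF R])
      show "cmod (monom_val \<omega> m) \<le> R ^ size m" by (rule monom_val_le) (rule i)
    qed (use R in auto)
    also have "\<dots> \<le> R * (size m * R ^ size m * norm h) + R * (R ^ size m * norm h)"
      using R mult_right_mono[of 1 R "R ^ size m * norm h"] by (simp add: mult_ac)
    also have "\<dots> = size (add_mset i m) * R ^ size (add_mset i m) * norm h"
      by (simp add: algebra_simps)
    finally show "cmod (\<omega> $ i * D \<omega> h + h $ i * monom_val \<omega> m) \<le> size (add_mset i m) * R ^ size (add_mset i m) * norm h" .
  qed
qed

lemma multisets_partition_by_size: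
  "bij_betw snd (Sigma UNIV (\<lambda>n. {m :: 'd multiset. size m = n})) UNIV"
  by (rule bij_betw_byWitness[where f' = "\<lambda>m. (size m, m)"]) auto

lemma infsum_by_size:
  fixes f :: "('d::finite) multiset \<Rightarrow> 'b::banach"
  assumes "(\<lambda>m. norm (f m)) summable_on UNIV"
  shows "(\<lambda>n. \<Sum>m | size m = n. f m) sums (\<Sum>\<^sub>\<infinity>m. f m)"
proof -
  have "(f has_sum (\<Sum>\<^sub>\<infinity>m. f m)) UNIV"
    using abs_summable_summable[OF assms] by (rule has_sum_infsum)
  then have "((\<lambda>x. f (snd x)) has_sum (\<Sum>\<^sub>\<infinity>m. f m)) (Sigma UNIV (\<lambda>n. {m :: 'd multiset. size m = n}))"
    by (subst has_sum_reindex_bij_betw[OF multisets_partition_by_size])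
  then have "((\<lambda>n. \<Sum>m | size m = n. f m) has_sum (\<Sum>\<^sub>\<infinity>m. f m)) UNIV"
    by (rule has_sum_SigmaD) (auto intro: has_sum_finite)
  then show ?thesis by (rule has_sum_imp_sums)
qed

lemma power_series_sums:
  fixes a :: "('d::finite) multiset \<Rightarrow> complex"
  assumes "entire_coeffs a"
  shows "(\<lambda>n. \<Sum>m | size m = n. a m * monom_val \<omega> m) sums power_series a \<omega>"
  unfolding power_series_def by (rule infsum_by_size[OF entire_coeffs_abs_summable[OF assms]])

lemma power_series_holomorphic_Cd:
  fixes a :: "('d::finite) multiset \<Rightarrow> complex"
  assumes a: "entire_coeffs a"
  shows "holomorphic_Cd (power_series a) UNIV"
  unfolding holomorphic_Cd_def
proof
  fix x :: "complex ^ 'd"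
  define R where "R = norm x + 1"
  have R: "1 \<le> R" by (simp add: R_def)
  obtain D :: "'d multiset \<Rightarrow> complex ^ 'd \<Rightarrow> complex ^ 'd \<Rightarrow> complex" where D: "\<And>m \<omega>. ((\<lambda>\<omega>. monom_val \<omega> m) has_derivative D m \<omega>) (at \<omega>)"
    "\<And>m \<omega> c v. D m \<omega> (c *s v) = c * D m \<omega> v"
    "\<And>m \<omega> (R::real) h. 1 \<le> R \<Longrightarrow> norm \<omega> \<le> R \<Longrightarrow> cmod (D m \<omega> h) \<le> size m * R ^ size m * norm h"
    using monom_val_has_derivative by metis
  let ?f = "\<lambda>n \<omega>. \<Sum>m | size m = n. a m * monom_val \<omega> m"
  let ?f' = "\<lambda>n \<omega> h. \<Sum>m | size m = n. a m * D m \<omega> h"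
  let ?b = "\<lambda>n. \<Sum>m | size (m :: 'd multiset) = n. cmod (a m) * (2 * R) ^ size m"
  have b: "summable ?b"
    using infsum_by_size[of "\<lambda>m. cmod (a m) * (2 * R) ^ size m"] entire_coeffs_summable[OF a, of "2 * R"] R
    by (auto simp: sums_iff abs_mult)
  have f'_le: "cmod (?f' n \<omega> h) \<le> ?b n * norm h" if "norm \<omega> \<le> R" for n \<omega> h
  proof -
    have "cmod (a m * D m \<omega> h) \<le> cmod (a m) * (2 * R) ^ size m * norm h" for m
    proof -
      have "cmod (D m \<omega> h) \<le> size m * R ^ size m * norm h" by (rule D(3)[OF R that])
      also have "\<dots> \<le> 2 ^ size m * R ^ size m * norm h"
        using R less_imp_le[OF of_nat_less_two_power[of "size m"]] by (intro mult_right_mono) auto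
      finally show ?thesis
        by (simp add: norm_mult power_mult_distrib mult.assoc mult_left_mono)
    qed
    then have "cmod (?f' n \<omega> h) \<le> (\<Sum>m | size m = n. cmod (a m) * (2 * R) ^ size m * norm h)"
      by (intro sum_norm_le) auto
    then show ?thesis by (simp add: sum_distrib_right)
  qed
  define g' where "g' \<omega> h = (\<Sum>n. ?f' n \<omega> h)" for \<omega> h
  have f'_summable: "summable (\<lambda>n. ?f' n \<omega> h)" if "norm \<omega> \<le> R" for \<omega> h
    by (rule summable_comparison_test'[OF summable_mult2[OF b, of "norm h"], of 0]) (rule f'_le[OF that])
  have "\<exists>g. \<forall>\<omega>\<in>ball 0 R. (\<lambda>n. ?f n \<omega>) sums g \<omega> \<and> (g has_derivative g' \<omega>) (at \<omega> within ball 0 R)"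
  proof (rule has_derivative_series)
    show "((\<lambda>\<omega>. ?f n \<omega>) has_derivative ?f' n \<omega>) (at \<omega> within ball 0 R)" for n \<omega>
      by (rule has_derivative_at_withinI) (intro has_derivative_sum has_derivative_mult_right D)
    show "\<forall>\<^sub>F n in sequentially. \<forall>\<omega>\<in>ball 0 R. \<forall>h. norm ((\<Sum>i<n. ?f' i \<omega> h) - g' \<omega> h) \<le> e * norm h"
      if "e > 0" for e
    proof -
      have "(\<lambda>n. \<Sum>i. ?b (i + n)) \<longlonglongrightarrow> 0" by (rule suminf_exist_split2[OF b])
      then have "\<forall>\<^sub>F n in sequentially. (\<Sum>i. ?b (i + n)) < e" using that by (rule order_tendstoD(2))
      then show ?thesis
      proof eventually_elim
        case (elim n)
        show ?case
        proof (intro ballI allI)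
          fix \<omega> h assume "\<omega> \<in> ball (0 :: complex ^ 'd) R"
          then have \<omega>: "norm \<omega> \<le> R" by simp
          have "g' \<omega> h - (\<Sum>i<n. ?f' i \<omega> h) = (\<Sum>i. ?f' (i + n) \<omega> h)"
            unfolding g'_def using suminf_split_initial_segment[OF f'_summable[OF \<omega>, of h], of n] by simp
          also have "norm \<dots> \<le> (\<Sum>i. ?b (i + n) * norm h)"
          proof (rule norm_suminf_le)
            show "norm (?f' (i + n) \<omega> h) \<le> ?b (i + n) * norm h" for i by (rule f'_le[OF \<omega>])
            show "summable (\<lambda>i. ?b (i + n) * norm h)"
              by (rule summable_mult2[OF summable_ignore_initial_segment[OF b]])
          qed
          also have "\<dots> = (\<Sum>i. ?b (i + n)) * norm h"
            by (rule suminf_mult2[symmetric, OF summable_ignore_initial_segment[OF b]])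
          also have "\<dots> \<le> e * norm h" using elim by (intro mult_right_mono) auto
          finally show "norm ((\<Sum>i<n. ?f' i \<omega> h) - g' \<omega> h) \<le> e * norm h"
            by (simp add: norm_minus_commute)
        qed
      qed
    qed
    show "(\<lambda>n. ?f n 0) sums power_series a 0" by (rule power_series_sums[OF a])
  qed (use R in auto)
  then obtain g where g: "\<forall>\<omega>\<in>ball 0 R. (\<lambda>n. ?f n \<omega>) sums g \<omega> \<and> (g has_derivative g' \<omega>) (at \<omega> within ball 0 R)"
    by (rule exE)
  have x: "x \<in> ball 0 R" by (simp add: R_def)
  have "(g has_derivative g' x) (at x)"
    using conjunct2[OF bspec[OF g x]] unfolding at_within_open[OF x open_ball] .
  then have "(power_series a has_derivative g' x) (at x)"
  proof (rule has_derivative_transform_within_open[OF _ open_ball x])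
    fix \<omega> :: "complex ^ 'd" assume "\<omega> \<in> ball 0 R"
    then show "g \<omega> = power_series a \<omega>" by (intro sums_unique2[OF conjunct1[OF bspec[OF g]] power_series_sums[OF a]])
  qed
  moreover have "g' x (c *s v) = c * g' x v" for c v
  proof -
    have "?f' n x (c *s v) = c * ?f' n x v" for n by (simp add: D(2) sum_distrib_left mult_ac)
    then show ?thesis
      unfolding g'_def using suminf_mult[OF f'_summable[of x v], of c] by (simp add: R_def)
  qed
  ultimately show "\<exists>D. (power_series a has_derivative D) (at x) \<and> (\<forall>c v. D (c *s v) = c * D v)"
    by (intro exI conjI allI)
qed

text \<open>Well defined on entire functions by \<open>entire_power_series\<close> and \<open>power_series_inject\<close>.\<close>

definition taylor_coeffs :: "(complex ^ ('d::finite) \<Rightarrow> complex) \<Rightarrow> 'd multiset \<Rightarrow> complex" where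
  "taylor_coeffs f = (THE a. entire_coeffs a \<and> f = power_series a)"

lemma taylor_coeffs_power_series:
  assumes "entire_coeffs a"
  shows "taylor_coeffs (power_series a) = a"
  unfolding taylor_coeffs_def
  by (rule the_equality) (use assms power_series_inject in auto)

lemma taylor_coeffs_entire:
  assumes "holomorphic_Cd f UNIV"
  shows "entire_coeffs (taylor_coeffs f)" and "power_series (taylor_coeffs f) = f"
proof -
  obtain a where a: "entire_coeffs a" "f = power_series a"
    using entire_power_series[OF assms] by blast
  then have "taylor_coeffs f = a" by (simp add: taylor_coeffs_power_series)
  with a show "entire_coeffs (taylor_coeffs f)" "power_series (taylor_coeffs f) = f" by simp_all
qed

section \<open>The spaces of entire functions as weighted sequence spaces\<close>

definition coeff_space :: "real \<Rightarrow> ('d multiset \<Rightarrow> complex) \<Rightarrow> bool" where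
  "coeff_space \<delta> a \<longleftrightarrow> (\<forall>R>0. (\<lambda>m. cmod (a m) * weight \<delta> R m) summable_on UNIV)"

definition coeff_norm :: "real \<Rightarrow> real \<Rightarrow> ('d multiset \<Rightarrow> complex) \<Rightarrow> real" where
  "coeff_norm \<delta> R a = (\<Sum>\<^sub>\<infinity>m. cmod (a m) * weight \<delta> R m)"

lemma coeff_spaceD: "coeff_space \<delta> a \<Longrightarrow> R > 0 \<Longrightarrow> (\<lambda>m. cmod (a m) * weight \<delta> R m) summable_on UNIV"
  by (simp add: coeff_space_def)

lemma weight_pos: "R > 0 \<Longrightarrow> weight \<delta> R m > 0"
  by (simp add: weight_def)

lemma weight_mono:
  assumes "0 \<le> R" "\<gamma> \<le> \<delta>"
  shows "weight \<gamma> R m \<le> weight \<delta> R m"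
  unfolding weight_def using assms fact_ge_1[of "size m"] by (intro mult_left_mono powr_mono) auto

lemma weight_0: "weight 0 R m = R ^ size m"
  by (simp add: weight_def)

lemma entire_coeffs_eq_coeff_space: "entire_coeffs a \<longleftrightarrow> coeff_space 0 a"
  by (simp add: entire_coeffs_def coeff_space_def weight_0)

lemma coeff_space_antimono:
  assumes "coeff_space \<delta> a" "\<gamma> \<le> \<delta>"
  shows "coeff_space \<gamma> a"
  unfolding coeff_space_def
proof (intro allI impI)
  fix R :: real assume R: "R > 0"
  show "(\<lambda>m. cmod (a m) * weight \<gamma> R m) summable_on UNIV"
  proof (rule summable_on_comparison_test[OF coeff_spaceD[OF assms(1) R]])
    show "cmod (a m) * weight \<gamma> R m \<le> cmod (a m) * weight \<delta> R m" for m
      using R assms(2) by (intro mult_left_mono weight_mono) auto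
  qed (use R in \<open>simp add: weight_nonneg\<close>)
qed

lemma coeff_norm_mono:
  assumes "coeff_space \<delta> a" "\<gamma> \<le> \<delta>" "R > 0"
  shows "coeff_norm \<gamma> R a \<le> coeff_norm \<delta> R a"
  unfolding coeff_norm_def
  by (rule infsum_mono[OF coeff_spaceD[OF coeff_space_antimono[OF assms(1,2)] assms(3)] coeff_spaceD[OF assms(1,3)]])
     (use assms in \<open>intro mult_left_mono weight_mono; simp\<close>)

lemma coeff_space_entire: "coeff_space \<delta> a \<Longrightarrow> 0 \<le> \<delta> \<Longrightarrow> entire_coeffs a"
  unfolding entire_coeffs_eq_coeff_space by (rule coeff_space_antimono)

lemma coeff_space_lincomb:
  assumes "coeff_space \<delta> a" "coeff_space \<delta> b"
  shows "coeff_space \<delta> (\<lambda>m. c * a m + b m)"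
  unfolding coeff_space_def
proof (intro allI impI)
  fix R :: real assume R: "R > 0"
  have "(\<lambda>m. cmod c * (cmod (a m) * weight \<delta> R m) + cmod (b m) * weight \<delta> R m) summable_on UNIV"
    by (rule summable_on_add[OF summable_on_cmult_right[OF coeff_spaceD[OF assms(1) R]] coeff_spaceD[OF assms(2) R]])
  then show "(\<lambda>m. cmod (c * a m + b m) * weight \<delta> R m) summable_on UNIV"
  proof (rule summable_on_comparison_test)
    fix m
    have "cmod (c * a m + b m) \<le> cmod c * cmod (a m) + cmod (b m)"
      using norm_triangle_ineq[of "c * a m" "b m"] by (simp add: norm_mult)
    then have "cmod (c * a m + b m) * weight \<delta> R m \<le> (cmod c * cmod (a m) + cmod (b m)) * weight \<delta> R m"
      using R by (intro mult_right_mono) (auto simp: weight_nonneg)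
    then show "cmod (c * a m + b m) * weight \<delta> R m \<le> cmod c * (cmod (a m) * weight \<delta> R m) + cmod (b m) * weight \<delta> R m"
      by (simp add: algebra_simps)
  qed (use R in \<open>simp add: weight_nonneg\<close>)
qed

lemma Emin_pos_le_norm:
  assumes "f \<in> Emin_pos \<alpha>"
  shows "cmod (f \<omega>) * exp (- (1 / 2 ^ l) * norm \<omega> powr \<alpha>) \<le> Emin_norm \<alpha> l f"
  unfolding Emin_norm_def using assms by (intro cSUP_upper) (auto simp: Emin_pos_def)

lemma Emin_norm_nonneg: "f \<in> Emin_pos \<alpha> \<Longrightarrow> 0 \<le> Emin_norm \<alpha> l f"
  by (rule order_trans[OF _ Emin_pos_le_norm[of f \<alpha> 0]]) auto

text \<open>The Cauchy estimate on the polydisc of radius \<open>\<rho>\<close> reads \<open>\<bar>a\<^sub>m\<bar> \<rho>\<^sup>n \<le> \<parallel>f\<parallel> exp (2\<^bsup>-l\<^esup> (d \<rho>)\<^sup>\<alpha>)\<close>. The optimal radius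
  makes the exponent equal to \<open>n\<close>, and \<open>n\<^sup>n \<ge> n!\<close> turns the result into the weight with exponent \<open>1 / \<alpha>\<close>.\<close>

lemma Emin_coeff_estimate:
  fixes f :: "complex ^ ('d::finite) \<Rightarrow> complex"
  assumes \<alpha>: "\<alpha> > 0" and f: "f \<in> Emin_pos \<alpha>"
  defines "d \<equiv> real CARD('d)"
  shows "cmod (taylor_coeffs f m) * fact (size m) powr (1 / \<alpha>) \<le>
    exp 1 * Emin_norm \<alpha> l f * (exp 1 * d / (2 ^ l) powr (1 / \<alpha>)) ^ size m"
proof -
  let ?a = "taylor_coeffs f" and ?n = "size m" and ?E = "Emin_norm \<alpha> l f"
  \<comment> \<open>\<open>n'\<close> replaces \<open>n\<close> because the optimal radius would be 0 for \<open>n = 0\<close>; this costs the factor \<open>exp 1\<close>.\<close>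
  define n' where "n' = max 1 ?n"
  define q where "q = (real n' * 2 ^ l) powr (1 / \<alpha>)"
  define \<rho> where "\<rho> = q / d"
  have d: "d > 0" by (simp add: d_def)
  have n': "n' > 0" "?n \<le> n'" by (auto simp: n'_def)
  have q: "q > 0" using n' by (simp add: q_def)
  have \<rho>: "\<rho> > 0" using q d by (simp add: \<rho>_def)
  have hol: "holomorphic_Cd f UNIV" using f by (simp add: Emin_pos_def)
  have "cmod (?a m) * \<rho> ^ ?n \<le> ?E * exp n'"
  proof (rule multi_cauchy_estimate[OF \<rho> entire_coeffs_summable[OF taylor_coeffs_entire(1)[OF hol] \<rho>]])
    fix \<omega> :: "complex ^ 'd" assume "\<And>i. cmod (\<omega> $ i) = \<rho>"
    then have "norm \<omega> \<le> d * \<rho>" unfolding d_def by (intro norm_le_card_times) auto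
    then have "norm \<omega> \<le> q" using d by (simp add: \<rho>_def)
    then have "norm \<omega> powr \<alpha> \<le> q powr \<alpha>" using \<alpha> by (intro powr_mono2) auto
    also have "q powr \<alpha> = real n' * 2 ^ l" using \<alpha> n' by (simp add: q_def powr_powr)
    finally have "(1 / 2 ^ l) * norm \<omega> powr \<alpha> \<le> n'" by (simp add: field_simps)
    then have le: "exp ((1 / 2 ^ l) * norm \<omega> powr \<alpha>) \<le> exp n'" by simp
    have "cmod (f \<omega>) = cmod (f \<omega>) * exp (- (1 / 2 ^ l) * norm \<omega> powr \<alpha>) * exp ((1 / 2 ^ l) * norm \<omega> powr \<alpha>)"
      by (simp add: mult.assoc flip: exp_add)
    also have "\<dots> \<le> ?E * exp n'"
      using Emin_pos_le_norm[OF f, of \<omega> l] le Emin_norm_nonneg[OF f] by (intro mult_mono) auto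
    finally show "cmod (power_series ?a \<omega>) \<le> ?E * exp n'"
      by (simp add: taylor_coeffs_entire(2)[OF hol])
  qed
  moreover have "fact ?n powr (1 / \<alpha>) * ((2 ^ l) powr (1 / \<alpha>) / d) ^ ?n \<le> \<rho> ^ ?n"
  proof -
    have "fact ?n \<le> real n' ^ ?n"
    proof -
      have "fact ?n \<le> real (?n ^ ?n)" by (rule fact_le_power)
      also have "\<dots> \<le> real n' ^ ?n" using n' by (simp add: power_mono)
      finally show ?thesis .
    qed
    then have "fact ?n powr (1 / \<alpha>) \<le> (real n' ^ ?n) powr (1 / \<alpha>)"
      using \<alpha> by (intro powr_mono2) auto
    also have "\<dots> = (real n' powr (1 / \<alpha>)) ^ ?n"
      using n' by (simp add: powr_realpow[symmetric] powr_powr powr_power mult.commute)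
    finally have "fact ?n powr (1 / \<alpha>) * ((2 ^ l) powr (1 / \<alpha>) / d) ^ ?n \<le>
        (real n' powr (1 / \<alpha>)) ^ ?n * ((2 ^ l) powr (1 / \<alpha>) / d) ^ ?n"
      using d by (intro mult_right_mono) auto
    also have "\<dots> = \<rho> ^ ?n"
      by (simp add: \<rho>_def q_def powr_mult power_mult_distrib[symmetric])
    finally show ?thesis .
  qed
  ultimately have le: "cmod (?a m) * (fact ?n powr (1 / \<alpha>) * ((2 ^ l) powr (1 / \<alpha>) / d) ^ ?n) \<le> ?E * exp n'"
    by (meson mult_left_mono norm_ge_zero order_trans)
  also have "\<dots> \<le> ?E * (exp 1 * exp 1 ^ ?n)"
  proof (intro mult_left_mono Emin_norm_nonneg[OF f])
    have "exp (real n') \<le> exp (1 + real ?n)" by (simp add: n'_def)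
    also have "\<dots> = exp 1 * exp 1 ^ ?n" by (simp add: exp_add exp_of_nat_mult[symmetric])
    finally show "exp (real n') \<le> exp 1 * exp 1 ^ ?n" .
  qed
  finally have "cmod (?a m) * fact ?n powr (1 / \<alpha>) * ((2 ^ l) powr (1 / \<alpha>) / d) ^ ?n * (d / (2 ^ l) powr (1 / \<alpha>)) ^ ?n \<le>
      ?E * (exp 1 * exp 1 ^ ?n) * (d / (2 ^ l) powr (1 / \<alpha>)) ^ ?n"
    using d by (intro mult_right_mono) (auto simp: mult.assoc)
  moreover have "((2 ^ l) powr (1 / \<alpha>) / d) ^ ?n * (d / (2 ^ l) powr (1 / \<alpha>)) ^ ?n = 1"
    using d by (simp add: power_mult_distrib[symmetric])
  ultimately show ?thesis
    by (simp add: mult.assoc power_mult_distrib[symmetric]) (simp add: mult_ac)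
qed

text \<open>By the previous estimate the weighted coefficients decay geometrically, with a ratio that tends to 0 as
  \<open>l\<close> grows. Hence for each \<open>R\<close> some \<open>l\<close> makes their sum converge.\<close>

lemma Emin_coeff_norm_le:
  fixes R :: real
  assumes \<alpha>: "\<alpha> > 0" and R: "R > 0"
  obtains l K where "K \<ge> 0"
    "\<And>f :: complex ^ ('d::finite) \<Rightarrow> complex. f \<in> Emin_pos \<alpha> \<Longrightarrow>
       (\<lambda>m. cmod (taylor_coeffs f m) * weight (1 / \<alpha>) R m) summable_on UNIV \<and>
       coeff_norm (1 / \<alpha>) R (taylor_coeffs f) \<le> K * Emin_norm \<alpha> l f"
proof -
  let ?d = "real CARD('d)"
  obtain l where l: "(2 * exp 1 * ?d * ?d * R) powr \<alpha> < 2 ^ l"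
    using real_arch_pow[of 2] by auto
  define t where "t = (2 ^ l :: real) powr (1 / \<alpha>)"
  have t: "2 * exp 1 * ?d * ?d * R \<le> t"
  proof -
    have "2 * exp 1 * ?d * ?d * R = ((2 * exp 1 * ?d * ?d * R) powr \<alpha>) powr (1 / \<alpha>)"
      using \<alpha> R by (simp add: powr_powr)
    also have "\<dots> \<le> t" unfolding t_def using \<alpha> l by (intro powr_mono2) auto
    finally show ?thesis .
  qed
  have t0: "t > 0" by (simp add: t_def)
  define q where "q = exp 1 * ?d / t * R"
  have q: "0 \<le> q" "?d * q \<le> 1/2" using t t0 R by (simp_all add: q_def field_simps)
  show thesis
  proof (rule that[of "2 * exp 1" l])
    fix f :: "complex ^ 'd \<Rightarrow> complex" assume f: "f \<in> Emin_pos \<alpha>"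
    let ?E = "Emin_norm \<alpha> l f"
    have le: "cmod (taylor_coeffs f m) * weight (1 / \<alpha>) R m \<le> exp 1 * ?E * q ^ size m" for m
    proof -
      have "cmod (taylor_coeffs f m) * fact (size m) powr (1 / \<alpha>) * R ^ size m \<le>
          exp 1 * ?E * (exp 1 * ?d / t) ^ size m * R ^ size m"
        unfolding t_def using R by (intro mult_right_mono Emin_coeff_estimate[OF \<alpha> f]) auto
      also have "\<dots> = exp 1 * ?E * q ^ size m"
        unfolding q_def power_mult_distrib[of "exp 1 * ?d / t" R] by (simp only: mult.assoc)
      finally show ?thesis by (simp add: weight_def mult_ac)
    qed
    have geo: "(\<lambda>m :: 'd multiset. exp 1 * ?E * q ^ size m) summable_on UNIV"
      by (rule summable_on_cmult_right[OF multisets_geometric_summable(1)[OF q]])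
    have summable: "(\<lambda>m. cmod (taylor_coeffs f m) * weight (1 / \<alpha>) R m) summable_on UNIV"
      by (rule summable_on_comparison_test[OF geo le]) (use R in \<open>simp add: weight_nonneg\<close>)
    have "coeff_norm (1 / \<alpha>) R (taylor_coeffs f) \<le> (\<Sum>\<^sub>\<infinity>m :: 'd multiset. exp 1 * ?E * q ^ size m)"
      unfolding coeff_norm_def by (rule infsum_mono[OF summable geo le])
    also have "\<dots> = exp 1 * ?E * (\<Sum>\<^sub>\<infinity>m :: 'd multiset. q ^ size m)" by (rule infsum_cmult_right')
    also have "\<dots> \<le> exp 1 * ?E * 2"
      using Emin_norm_nonneg[OF f] by (intro mult_left_mono multisets_geometric_summable(2) q) auto
    finally show "(\<lambda>m. cmod (taylor_coeffs f m) * weight (1 / \<alpha>) R m) summable_on UNIV \<and>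
        coeff_norm (1 / \<alpha>) R (taylor_coeffs f) \<le> 2 * exp 1 * ?E"
      using summable by simp
  qed simp
qed

lemma power_le_fact_times_exp:
  assumes "(y::real) \<ge> 0"
  shows "y ^ n \<le> fact n * exp y"
proof -
  have "(\<lambda>n. y ^ n /\<^sub>R fact n) sums exp y" by (rule exp_converges)
  then have "sum (\<lambda>n. y ^ n /\<^sub>R fact n) {n} \<le> exp y"
    using assms sum_le_suminf[of "\<lambda>n. y ^ n /\<^sub>R fact n" "{n}"] by (auto simp: sums_iff)
  then show ?thesis by (simp add: field_simps)
qed

text \<open>The converse estimate rests on \<open>y\<^sup>n \<le> n! exp y\<close> for \<open>y = (\<parallel>\<omega>\<parallel> / R)\<^sup>\<alpha>\<close>, raised to the power \<open>1 / \<alpha>\<close>. The radius \<open>R\<close> is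
  chosen such that \<open>y / \<alpha> = 2\<^bsup>-l\<^esup> \<parallel>\<omega>\<parallel>\<^sup>\<alpha>\<close>.\<close>

lemma coeff_norm_Emin_le:
  assumes \<alpha>: "\<alpha> > 0"
  obtains R where "R > 0" "\<And>(a :: ('d::finite) multiset \<Rightarrow> complex) \<omega>. coeff_space (1 / \<alpha>) a \<Longrightarrow>
    cmod (power_series a \<omega>) * exp (- (1 / 2 ^ l) * norm \<omega> powr \<alpha>) \<le> coeff_norm (1 / \<alpha>) R a"
proof -
  \<comment> \<open>The solution of \<open>1 / (\<alpha> R\<^sup>\<alpha>) = 2\<^bsup>-l\<^esup>\<close>.\<close>
  define R where "R = (2 ^ l / \<alpha>) powr (1 / \<alpha>)"
  have R: "R > 0" using \<alpha> by (simp add: R_def)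
  have R\<alpha>: "R powr \<alpha> = 2 ^ l / \<alpha>" using \<alpha> by (simp add: R_def powr_powr)
  show thesis
  proof (rule that[OF R])
    fix a :: "'d multiset \<Rightarrow> complex" and \<omega> :: "complex ^ 'd" assume a: "coeff_space (1 / \<alpha>) a"
    let ?x = "norm \<omega>" and ?e = "exp ((1 / 2 ^ l) * norm \<omega> powr \<alpha>)"
    have pow: "?x ^ n \<le> R ^ n * fact n powr (1 / \<alpha>) * ?e" for n
    proof (cases "?x = 0 \<and> n > 0")
      case False
      define y where "y = (?x / R) powr \<alpha>"
      have "?x ^ n = R ^ n * (?x / R) ^ n" using R by (simp add: power_mult_distrib[symmetric])
      also have "(?x / R) ^ n = (y ^ n) powr (1 / \<alpha>)"
      proof (cases "n = 0")
        case n: False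
        with False have "?x > 0" by simp
          then have z: "?x / R > 0" using R by simp
          have "(y ^ n) powr (1 / \<alpha>) = (?x / R) powr (real n * \<alpha> * (1 / \<alpha>))"
            unfolding y_def using z by (subst powr_power) (auto simp: powr_powr)
          also have "\<dots> = (?x / R) powr real n" using \<alpha> by simp
          also have "\<dots> = (?x / R) ^ n" by (rule powr_realpow[OF z])
          finally show ?thesis by (rule sym)
      qed simp
      also have "\<dots> \<le> (fact n * exp y) powr (1 / \<alpha>)"
        using \<alpha> power_le_fact_times_exp[of y n] by (intro powr_mono2) (auto simp: y_def)
      also have "\<dots> = fact n powr (1 / \<alpha>) * exp (y / \<alpha>)"
        by (simp add: powr_mult exp_powr_real)
      also have "y / \<alpha> = (1 / 2 ^ l) * ?x powr \<alpha>"
        using R \<alpha> by (simp add: y_def powr_divide R\<alpha>)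
      finally show ?thesis using R by (simp add: mult_left_mono mult.assoc)
    qed (use R in \<open>simp add: power_0_left\<close>)
    have le: "cmod (a m * monom_val \<omega> m) \<le> cmod (a m) * weight (1 / \<alpha>) R m * ?e" for m
    proof -
      have "cmod (monom_val \<omega> m) \<le> ?x ^ size m" by (rule monom_val_le) (rule Finite_Cartesian_Product.norm_nth_le)
      also have "\<dots> \<le> weight (1 / \<alpha>) R m * ?e" unfolding weight_def by (rule pow)
      finally show ?thesis by (simp add: norm_mult mult_left_mono mult.assoc)
    qed
    have ent: "entire_coeffs a" using a \<alpha> by (intro coeff_space_entire[OF a]) auto
    have "cmod (power_series a \<omega>) \<le> (\<Sum>\<^sub>\<infinity>m. norm (a m * monom_val \<omega> m))"
      unfolding power_series_def by (rule norm_infsum_bound[OF entire_coeffs_abs_summable[OF ent]])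
    also have "\<dots> \<le> (\<Sum>\<^sub>\<infinity>m. cmod (a m) * weight (1 / \<alpha>) R m * ?e)"
      by (rule infsum_mono[OF entire_coeffs_abs_summable[OF ent] summable_on_cmult_left[OF coeff_spaceD[OF a R]] le])
    also have "\<dots> = coeff_norm (1 / \<alpha>) R a * ?e"
      unfolding coeff_norm_def by (rule infsum_cmult_left')
    finally have "cmod (power_series a \<omega>) * exp (- (1 / 2 ^ l) * norm \<omega> powr \<alpha>) \<le>
        coeff_norm (1 / \<alpha>) R a * ?e * exp (- (1 / 2 ^ l) * norm \<omega> powr \<alpha>)"
      by (intro mult_right_mono) auto
    then show "cmod (power_series a \<omega>) * exp (- (1 / 2 ^ l) * norm \<omega> powr \<alpha>) \<le> coeff_norm (1 / \<alpha>) R a"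
      by (simp add: mult.assoc flip: exp_add)
  qed
qed

lemma Emin_pos_coeff_space:
  fixes f :: "complex ^ ('d::finite) \<Rightarrow> complex"
  assumes "\<alpha> > 0" "f \<in> Emin_pos \<alpha>"
  shows "coeff_space (1 / \<alpha>) (taylor_coeffs f)"
  unfolding coeff_space_def
proof (intro allI impI)
  fix R :: real assume R: "R > 0"
  show "(\<lambda>m. cmod (taylor_coeffs f m) * weight (1 / \<alpha>) R m) summable_on UNIV"
    by (rule Emin_coeff_norm_le[OF assms(1) R, where 'd = 'd]) (use assms(2) in blast)
qed

lemma Emin_pos_power_series: "\<alpha> > 0 \<Longrightarrow> f \<in> Emin_pos \<alpha> \<Longrightarrow> power_series (taylor_coeffs f) = f"
  by (rule taylor_coeffs_entire(2)) (simp add: Emin_pos_def)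

lemma power_series_Emin_pos:
  fixes a :: "('d::finite) multiset \<Rightarrow> complex"
  assumes \<alpha>: "\<alpha> > 0" and a: "coeff_space (1 / \<alpha>) a"
  shows "power_series a \<in> Emin_pos \<alpha>"
proof -
  have "bdd_above (range (\<lambda>\<omega>. cmod (power_series a \<omega>) * exp (- (1 / 2 ^ l) * norm \<omega> powr \<alpha>)))" for l :: nat
  proof (rule coeff_norm_Emin_le[OF \<alpha>, of l, where 'd = 'd])
    fix R :: real assume "\<And>(a :: 'd multiset \<Rightarrow> complex) \<omega>. coeff_space (1 / \<alpha>) a \<Longrightarrow>
      cmod (power_series a \<omega>) * exp (- (1 / 2 ^ l) * norm \<omega> powr \<alpha>) \<le> coeff_norm (1 / \<alpha>) R a"
    from this[OF a] show ?thesis by (intro bdd_aboveI[where M = "coeff_norm (1 / \<alpha>) R a"]) auto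
  qed
  then show ?thesis
    using power_series_holomorphic_Cd[OF coeff_space_entire[OF a]] \<alpha> by (simp add: Emin_pos_def)
qed

lemma Emin_norm_le_coeff_norm:
  assumes \<alpha>: "\<alpha> > 0"
  obtains R where "R > 0" "\<And>a :: ('d::finite) multiset \<Rightarrow> complex. coeff_space (1 / \<alpha>) a \<Longrightarrow>
    Emin_norm \<alpha> l (power_series a) \<le> coeff_norm (1 / \<alpha>) R a"
proof (rule coeff_norm_Emin_le[OF \<alpha>, of l, where 'd = 'd])
  fix R :: real assume R: "R > 0" and "\<And>(a :: 'd multiset \<Rightarrow> complex) \<omega>. coeff_space (1 / \<alpha>) a \<Longrightarrow>
      cmod (power_series a \<omega>) * exp (- (1 / 2 ^ l) * norm \<omega> powr \<alpha>) \<le> coeff_norm (1 / \<alpha>) R a"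
  then have "Emin_norm \<alpha> l (power_series a) \<le> coeff_norm (1 / \<alpha>) R a" if "coeff_space (1 / \<alpha>) a"
    for a :: "'d multiset \<Rightarrow> complex"
    unfolding Emin_norm_def using that by (intro cSUP_least) auto
  then show thesis using that R by blast
qed

lemma Emin_pos_lincomb:
  fixes f g :: "complex ^ ('d::finite) \<Rightarrow> complex"
  assumes \<alpha>: "\<alpha> > 0" and f: "f \<in> Emin_pos \<alpha>" and g: "g \<in> Emin_pos \<alpha>"
  shows "(\<lambda>\<omega>. c * f \<omega> + g \<omega>) \<in> Emin_pos \<alpha>"
    and "taylor_coeffs (\<lambda>\<omega>. c * f \<omega> + g \<omega>) = (\<lambda>m. c * taylor_coeffs f m + taylor_coeffs g m)"
proof -
  let ?a = "taylor_coeffs f" and ?b = "taylor_coeffs g"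
  note sp = Emin_pos_coeff_space[OF \<alpha> f] Emin_pos_coeff_space[OF \<alpha> g]
  have ent: "entire_coeffs ?a" "entire_coeffs ?b"
    using sp \<alpha> by (auto intro: coeff_space_entire)
  have eq: "(\<lambda>\<omega>. c * f \<omega> + g \<omega>) = power_series (\<lambda>m. c * ?a m + ?b m)"
    by (rule ext) (simp add: power_series_lincomb[OF ent] Emin_pos_power_series[OF \<alpha> f] Emin_pos_power_series[OF \<alpha> g])
  show "(\<lambda>\<omega>. c * f \<omega> + g \<omega>) \<in> Emin_pos \<alpha>"
    unfolding eq by (rule power_series_Emin_pos[OF \<alpha> coeff_space_lincomb[OF sp]])
  show "taylor_coeffs (\<lambda>\<omega>. c * f \<omega> + g \<omega>) = (\<lambda>m. c * ?a m + ?b m)"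
    unfolding eq by (rule taylor_coeffs_power_series[OF entire_coeffs_lincomb[OF ent]])
qed

lemma Emin_pos_diff:
  fixes f g :: "complex ^ ('d::finite) \<Rightarrow> complex"
  assumes "\<alpha> > 0" "f \<in> Emin_pos \<alpha>" "g \<in> Emin_pos \<alpha>"
  shows "(\<lambda>\<omega>. f \<omega> - g \<omega>) \<in> Emin_pos \<alpha>"
  using Emin_pos_lincomb(1)[OF assms(1,3,2), of "-1"] by simp

lemma Emin_norm_triangle:
  fixes f g h :: "complex ^ ('d::finite) \<Rightarrow> complex"
  assumes \<alpha>: "\<alpha> > 0" and "f \<in> Emin_pos \<alpha>" "g \<in> Emin_pos \<alpha>" "h \<in> Emin_pos \<alpha>"
  shows "Emin_norm \<alpha> l (\<lambda>\<omega>. f \<omega> - h \<omega>) \<le> Emin_norm \<alpha> l (\<lambda>\<omega>. f \<omega> - g \<omega>) + Emin_norm \<alpha> l (\<lambda>\<omega>. g \<omega> - h \<omega>)"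
  unfolding Emin_norm_def[of _ _ "\<lambda>\<omega>. f \<omega> - h \<omega>"]
proof (rule cSUP_least)
  fix \<omega> :: "complex ^ 'd"
  let ?e = "exp (- (1 / 2 ^ l) * norm \<omega> powr \<alpha>)"
  have "cmod (f \<omega> - h \<omega>) * ?e \<le> (cmod (f \<omega> - g \<omega>) + cmod (g \<omega> - h \<omega>)) * ?e"
    using norm_triangle_ineq[of "f \<omega> - g \<omega>" "g \<omega> - h \<omega>"] by (intro mult_right_mono) auto
  also have "\<dots> \<le> Emin_norm \<alpha> l (\<lambda>\<omega>. f \<omega> - g \<omega>) + Emin_norm \<alpha> l (\<lambda>\<omega>. g \<omega> - h \<omega>)"
    unfolding distrib_right
    by (rule add_mono[OF Emin_pos_le_norm[OF Emin_pos_diff] Emin_pos_le_norm[OF Emin_pos_diff]]) (use assms in auto)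
  finally show "cmod (f \<omega> - h \<omega>) * ?e \<le> Emin_norm \<alpha> l (\<lambda>\<omega>. f \<omega> - g \<omega>) + Emin_norm \<alpha> l (\<lambda>\<omega>. g \<omega> - h \<omega>)" .
qed simp

lemma Emin_norm_zero: "Emin_norm \<alpha> l (\<lambda>\<omega>. 0) = 0"
  by (simp add: Emin_norm_def)

lemma Emin_pos_mono:
  fixes f :: "complex ^ ('d::finite) \<Rightarrow> complex"
  assumes "0 < b" "b \<le> a" "f \<in> Emin_pos b"
  shows "f \<in> Emin_pos a"
proof -
  have "coeff_space (1 / a) (taylor_coeffs f)"
    by (rule coeff_space_antimono[OF Emin_pos_coeff_space[OF assms(1,3)]]) (use assms in \<open>simp add: frac_le\<close>)
  then have "power_series (taylor_coeffs f) \<in> Emin_pos a"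
    using assms by (intro power_series_Emin_pos) auto
  then show ?thesis by (simp add: Emin_pos_power_series[OF assms(1,3)])
qed


section \<open>Row-finite matrices acting on Taylor coefficients\<close>

definition mat_apply :: "('d multiset \<Rightarrow> 'd multiset \<Rightarrow> complex) \<Rightarrow> ('d multiset \<Rightarrow> complex) \<Rightarrow> 'd multiset \<Rightarrow> complex" where
  "mat_apply c a k = (\<Sum>\<^sub>\<infinity>m. a m * c m k)"

text \<open>Rows of finite length whose weighted norms satisfy the estimate needed to act on all sequence spaces
  with weight exponent \<open>\<delta> \<ge> \<gamma>\<close>.\<close>

definition row_bounded :: "real \<Rightarrow> (('d::finite) multiset \<Rightarrow> 'd multiset \<Rightarrow> complex) \<Rightarrow> bool" where
  "row_bounded \<gamma> c \<longleftrightarrow> 0 < \<gamma> \<and> (\<forall>m k. size m < size k \<longrightarrow> c m k = 0) \<and>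
    (\<forall>\<delta>\<ge>\<gamma>. \<forall>R>0. \<exists>K\<ge>0. \<exists>M>0. \<forall>m. (\<Sum>k | size k \<le> size m. cmod (c m k) * weight \<delta> R k) \<le> K * weight \<delta> M m)"

lemma row_boundedD:
  assumes "row_bounded \<gamma> c" "\<gamma> \<le> \<delta>" "0 < R"
  obtains K M where "K \<ge> 0" "M > 0"
    "\<And>m. (\<Sum>k | size k \<le> size m. cmod (c m k) * weight \<delta> R k) \<le> K * weight \<delta> M m"
  using assms unfolding row_bounded_def by metis

lemma row_bounded_eq_0: "row_bounded \<gamma> c \<Longrightarrow> size m < size k \<Longrightarrow> c m k = 0"
  by (simp add: row_bounded_def)

lemma has_sum_row:
  fixes c :: "('d::finite) multiset \<Rightarrow> 'd multiset \<Rightarrow> complex"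
  assumes "row_bounded \<gamma> c" "\<And>k. c m k = 0 \<Longrightarrow> f k = 0"
  shows "(f has_sum (\<Sum>k | size k \<le> size m. f k)) UNIV"
  by (rule has_sum_cong_neutral[THEN iffD1, OF _ _ _ has_sum_finite[OF finite_multisets_size_le[of "size m"]]])
     (auto intro!: assms(2) row_bounded_eq_0[OF assms(1)])

text \<open>Absolute summability of the double series, the justification for all interchanges of summation.\<close>

lemma double_series_summable:
  fixes a :: "('d::finite) multiset \<Rightarrow> complex"
  assumes c: "row_bounded \<gamma> c" and \<delta>: "\<gamma> \<le> \<delta>" and a: "coeff_space \<delta> a" and R: "R > 0"
    and u: "\<And>k. cmod (u k) \<le> L * weight \<delta> R k"
  shows "(\<lambda>(m, k). norm (a m * c m k * u k)) summable_on UNIV \<times> UNIV"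
proof -
  obtain K M where K: "K \<ge> 0" "M > 0"
    and row: "\<And>m. (\<Sum>k | size k \<le> size m. cmod (c m k) * weight \<delta> R k) \<le> K * weight \<delta> M m"
    using row_boundedD[OF c \<delta> R] by blast
  have "0 \<le> L * weight \<delta> R ({#} :: 'd multiset)" by (rule order_trans[OF norm_ge_zero u])
  then have L: "0 \<le> L" using weight_pos[OF R, of \<delta> "{#} :: 'd multiset"] by (simp add: zero_le_mult_iff)
  let ?g = "\<lambda>m. \<Sum>k | size k \<le> size m. norm (a m * c m k * u k)"
  have "?g m \<le> L * K * (cmod (a m) * weight \<delta> M m)" for m
  proof -
    have "?g m \<le> (\<Sum>k | size k \<le> size m. cmod (a m) * L * (cmod (c m k) * weight \<delta> R k))"
    proof (rule sum_mono)
      fix k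
      have "cmod (a m) * cmod (c m k) * cmod (u k) \<le> cmod (a m) * cmod (c m k) * (L * weight \<delta> R k)"
        by (rule mult_left_mono[OF u]) simp
      then show "norm (a m * c m k * u k) \<le> cmod (a m) * L * (cmod (c m k) * weight \<delta> R k)"
        by (simp add: norm_mult mult_ac)
    qed
    also have "\<dots> \<le> cmod (a m) * L * (K * weight \<delta> M m)"
      unfolding sum_distrib_left[symmetric] using L by (intro mult_left_mono row) auto
    finally show ?thesis by (simp add: mult_ac)
  qed
  then have g: "?g summable_on UNIV"
    by (rule summable_on_comparison_test[OF summable_on_cmult_right[OF coeff_spaceD[OF a K(2)]]]) (auto intro: sum_nonneg)
  show ?thesis
    by (rule summable_on_SigmaI[where g = ?g, OF _ g]) (auto intro!: has_sum_row[OF c])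
qed

lemma bounded_column_entry:
  fixes c :: "('d::finite) multiset \<Rightarrow> 'd multiset \<Rightarrow> complex"
  assumes c: "row_bounded \<gamma> c" and \<delta>: "\<gamma> \<le> \<delta>"
  obtains K M where "M > 0" "\<And>m. cmod (c m k) \<le> K * weight \<delta> M m"
proof -
  obtain K M where K: "K \<ge> 0" "M > 0"
    and row: "\<And>m. (\<Sum>k | size k \<le> size m. cmod (c m k) * weight \<delta> 1 k) \<le> K * weight \<delta> M m"
    using row_boundedD[OF c \<delta> zero_less_one] by blast
  have "0 \<le> \<delta>" using c \<delta> by (simp add: row_bounded_def)
  then have w: "1 \<le> weight \<delta> 1 k" using fact_ge_1[of "size k"] by (simp add: weight_def ge_one_powr_ge_zero)
  have "cmod (c m k) \<le> K * weight \<delta> M m" for m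
  proof (cases "size k \<le> size m")
    case True
    have "cmod (c m k) \<le> cmod (c m k) * weight \<delta> 1 k" using w mult_left_mono[OF w, of "cmod (c m k)"] by simp
    also have "\<dots> \<le> (\<Sum>k | size k \<le> size m. cmod (c m k) * weight \<delta> 1 k)"
      by (rule member_le_sum[where f = "\<lambda>k. cmod (c m k) * weight \<delta> 1 k"]) (use True in \<open>auto simp: weight_nonneg\<close>)
    also have "\<dots> \<le> K * weight \<delta> M m" by (rule row)
    finally show ?thesis .
  next
    case False
    then show ?thesis using K by (simp add: row_bounded_eq_0[OF c] weight_nonneg)
  qed
  with K that show thesis by blast
qed

lemma mat_apply_summable:
  fixes a :: "('d::finite) multiset \<Rightarrow> complex"
  assumes c: "row_bounded \<gamma> c" and \<delta>: "\<gamma> \<le> \<delta>" and a: "coeff_space \<delta> a"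
  shows "(\<lambda>m. norm (a m * c m k)) summable_on UNIV"
proof -
  obtain K M where K: "M > 0" "\<And>m. cmod (c m k) \<le> K * weight \<delta> M m"
    using bounded_column_entry[OF c \<delta>, of k] by blast
  show ?thesis
  proof (rule summable_on_comparison_test[OF summable_on_cmult_right[OF coeff_spaceD[OF a K(1)], of K]])
    show "norm (a m * c m k) \<le> K * (cmod (a m) * weight \<delta> M m)" for m
      using mult_left_mono[OF K(2)[of m], of "cmod (a m)"] by (simp add: norm_mult mult_ac)
  qed simp
qed

text \<open>Interchanging the summations turns the norm of the image into a sum of weighted row norms.\<close>

lemma mat_apply_coeff_space:
  fixes c :: "('d::finite) multiset \<Rightarrow> 'd multiset \<Rightarrow> complex"
  assumes c: "row_bounded \<gamma> c" and \<delta>: "\<gamma> \<le> \<delta>" and R: "R > 0"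
  obtains K M where "K \<ge> 0" "M > 0" "\<And>a. coeff_space \<delta> a \<Longrightarrow>
    (\<lambda>k. cmod (mat_apply c a k) * weight \<delta> R k) summable_on UNIV \<and>
    coeff_norm \<delta> R (mat_apply c a) \<le> K * coeff_norm \<delta> M a"
proof -
  obtain K M where K: "K \<ge> 0" "M > 0"
    and row: "\<And>m. (\<Sum>k | size k \<le> size m. cmod (c m k) * weight \<delta> R k) \<le> K * weight \<delta> M m"
    using row_boundedD[OF c \<delta> R] by blast
  show thesis
  proof (rule that[OF K])
    fix a :: "'d multiset \<Rightarrow> complex" assume a: "coeff_space \<delta> a"
    let ?F = "\<lambda>m k. cmod (a m) * cmod (c m k) * weight \<delta> R k"
    have "(\<lambda>(m, k). norm (a m * c m k * complex_of_real (weight \<delta> R k))) summable_on UNIV \<times> UNIV"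
      by (rule double_series_summable[OF c \<delta> a R, of _ 1]) (use R in \<open>simp add: weight_nonneg\<close>)
    then have F: "(\<lambda>(m, k). ?F m k) summable_on UNIV \<times> UNIV"
      using R by (simp add: norm_mult weight_nonneg)
    then have F': "(\<lambda>(k, m). ?F m k) summable_on UNIV \<times> UNIV"
      by (subst product_swap[symmetric], subst summable_on_reindex) (auto simp: o_def case_prod_unfold)
    have col: "(\<lambda>m. ?F m k) summable_on UNIV" for k
      by (rule summable_on_SigmaD1[OF F']) simp
    have le: "cmod (mat_apply c a k) * weight \<delta> R k \<le> (\<Sum>\<^sub>\<infinity>m. ?F m k)" for k
    proof -
      have "cmod (mat_apply c a k) \<le> (\<Sum>\<^sub>\<infinity>m. norm (a m * c m k))"
        unfolding mat_apply_def by (rule norm_infsum_bound[OF mat_apply_summable[OF c \<delta> a]])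
      then have "cmod (mat_apply c a k) * weight \<delta> R k \<le> (\<Sum>\<^sub>\<infinity>m. norm (a m * c m k)) * weight \<delta> R k"
        using R by (intro mult_right_mono weight_nonneg) auto
      also have "\<dots> = (\<Sum>\<^sub>\<infinity>m. ?F m k)" by (simp add: norm_mult infsum_cmult_left'[symmetric])
      finally show ?thesis .
    qed
    have outer: "(\<lambda>k. \<Sum>\<^sub>\<infinity>m. ?F m k) summable_on UNIV"
      using summable_on_SigmaD[OF F'] col by simp
    have summable: "(\<lambda>k. cmod (mat_apply c a k) * weight \<delta> R k) summable_on UNIV"
      by (rule summable_on_comparison_test[OF outer le]) (use R in \<open>simp add: weight_nonneg\<close>)
    have "coeff_norm \<delta> R (mat_apply c a) \<le> (\<Sum>\<^sub>\<infinity>k. \<Sum>\<^sub>\<infinity>m. ?F m k)"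
      unfolding coeff_norm_def by (rule infsum_mono[OF summable outer le])
    also have "\<dots> = (\<Sum>\<^sub>\<infinity>m. \<Sum>\<^sub>\<infinity>k. ?F m k)" by (rule infsum_swap_banach[OF F'])
    also have "\<dots> \<le> (\<Sum>\<^sub>\<infinity>m. K * (cmod (a m) * weight \<delta> M m))"
    proof (rule infsum_mono)
      show "(\<lambda>m. \<Sum>\<^sub>\<infinity>k. ?F m k) summable_on UNIV"
        using summable_on_SigmaD[OF F] summable_on_SigmaD1[OF F] by simp
      show "(\<lambda>m. K * (cmod (a m) * weight \<delta> M m)) summable_on UNIV"
        by (rule summable_on_cmult_right[OF coeff_spaceD[OF a K(2)]])
      fix m
      have "(\<Sum>\<^sub>\<infinity>k. ?F m k) = (\<Sum>k | size k \<le> size m. ?F m k)"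
        by (rule infsumI[OF has_sum_row[OF c]]) simp
      also have "\<dots> = cmod (a m) * (\<Sum>k | size k \<le> size m. cmod (c m k) * weight \<delta> R k)"
        by (simp add: sum_distrib_left mult.assoc)
      also have "\<dots> \<le> cmod (a m) * (K * weight \<delta> M m)" by (intro mult_left_mono row) simp
      finally show "(\<Sum>\<^sub>\<infinity>k. ?F m k) \<le> K * (cmod (a m) * weight \<delta> M m)" by (simp add: mult_ac)
    qed
    also have "\<dots> = K * coeff_norm \<delta> M a" unfolding coeff_norm_def by (rule infsum_cmult_right')
    finally show "(\<lambda>k. cmod (mat_apply c a k) * weight \<delta> R k) summable_on UNIV \<and>
      coeff_norm \<delta> R (mat_apply c a) \<le> K * coeff_norm \<delta> M a" using summable by simp
  qed
qed

lemma coeff_space_mat_apply: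
  fixes a :: "('d::finite) multiset \<Rightarrow> complex"
  assumes c: "row_bounded \<gamma> c" and \<delta>: "\<gamma> \<le> \<delta>" and a: "coeff_space \<delta> a"
  shows "coeff_space \<delta> (mat_apply c a)"
  unfolding coeff_space_def
proof (intro allI impI)
  fix R :: real assume R: "R > 0"
  show "(\<lambda>k. cmod (mat_apply c a k) * weight \<delta> R k) summable_on UNIV"
    by (rule mat_apply_coeff_space[OF c \<delta> R]) (use a in blast)
qed

lemma mat_apply_mat_apply:
  fixes a :: "('d::finite) multiset \<Rightarrow> complex"
  assumes c: "row_bounded \<gamma> c" and c': "row_bounded \<gamma> c'" and \<delta>: "\<gamma> \<le> \<delta>" and a: "coeff_space \<delta> a"
    and inv: "\<And>m j. (\<Sum>k | size k \<le> size m. c m k * c' k j) = (if m = j then 1 else 0)"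
  shows "mat_apply c' (mat_apply c a) = a"
proof
  fix j
  obtain L R where L: "R > 0" "\<And>k. cmod (c' k j) \<le> L * weight \<delta> R k"
    using bounded_column_entry[OF c' \<delta>, of j] by blast
  have "(\<lambda>(m, k). norm (a m * c m k * c' k j)) summable_on UNIV \<times> UNIV"
    by (rule double_series_summable[OF c \<delta> a L])
  then have "(\<lambda>x. norm ((\<lambda>(m, k). a m * c m k * c' k j) x)) summable_on UNIV \<times> UNIV"
    by (simp add: case_prod_unfold)
  then have F: "(\<lambda>(m, k). a m * c m k * c' k j) summable_on UNIV \<times> UNIV"
    by (rule abs_summable_summable)
  have "mat_apply c' (mat_apply c a) j = (\<Sum>\<^sub>\<infinity>k. \<Sum>\<^sub>\<infinity>m. a m * c m k * c' k j)"
    unfolding mat_apply_def by (simp add: infsum_cmult_left'[symmetric])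
  also have "\<dots> = (\<Sum>\<^sub>\<infinity>m. \<Sum>\<^sub>\<infinity>k. a m * c m k * c' k j)" by (rule infsum_swap_banach[OF F, symmetric])
  also have "\<dots> = (\<Sum>\<^sub>\<infinity>m. if m = j then a j else 0)"
  proof (rule infsum_cong)
    fix m
    have "(\<Sum>\<^sub>\<infinity>k. a m * c m k * c' k j) = (\<Sum>k | size k \<le> size m. a m * c m k * c' k j)"
      by (rule infsumI[OF has_sum_row[OF c]]) simp
    also have "\<dots> = a m * (\<Sum>k | size k \<le> size m. c m k * c' k j)" by (simp add: sum_distrib_left mult.assoc)
    finally show "(\<Sum>\<^sub>\<infinity>k. a m * c m k * c' k j) = (if m = j then a j else 0)" by (simp add: inv)
  qed
  also have "\<dots> = (\<Sum>\<^sub>\<infinity>m\<in>{j}. a m)" by (rule infsum_cong_neutral) auto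
  finally show "mat_apply c' (mat_apply c a) j = a j" by simp
qed

lemma mat_apply_lincomb:
  fixes a b :: "('d::finite) multiset \<Rightarrow> complex"
  assumes c: "row_bounded \<gamma> c" and \<delta>: "\<gamma> \<le> \<delta>" and a: "coeff_space \<delta> a" and b: "coeff_space \<delta> b"
  shows "mat_apply c (\<lambda>m. t * a m + b m) = (\<lambda>k. t * mat_apply c a k + mat_apply c b k)"
proof
  fix k
  note s = abs_summable_summable[OF mat_apply_summable[OF c \<delta> a, of k]]
    abs_summable_summable[OF mat_apply_summable[OF c \<delta> b, of k]]
  have "mat_apply c (\<lambda>m. t * a m + b m) k = (\<Sum>\<^sub>\<infinity>m. t * (a m * c m k) + b m * c m k)"
    unfolding mat_apply_def by (simp add: algebra_simps)
  also have "\<dots> = (\<Sum>\<^sub>\<infinity>m. t * (a m * c m k)) + (\<Sum>\<^sub>\<infinity>m. b m * c m k)"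
    by (rule infsum_add[OF summable_on_cmult_right[OF s(1)] s(2)])
  finally show "mat_apply c (\<lambda>m. t * a m + b m) k = t * mat_apply c a k + mat_apply c b k"
    by (simp add: mat_apply_def infsum_cmult_right')
qed

section \<open>The topologies\<close>

lemma Emin_ball_open:
  assumes "f \<in> Emin_pos \<alpha>" "\<epsilon> > 0"
  shows "openin (Emin_pos_topology \<alpha>) {g \<in> Emin_pos \<alpha>. Emin_norm \<alpha> l (\<lambda>\<omega>. g \<omega> - f \<omega>) < \<epsilon>}"
  unfolding Emin_pos_topology_def using assms by (intro topology_generated_by_Basis) blast

lemma topspace_Emin_pos: "topspace (Emin_pos_topology \<alpha>) = Emin_pos \<alpha>"
proof -
  have "f \<in> {g \<in> Emin_pos \<alpha>. Emin_norm \<alpha> 0 (\<lambda>\<omega>. g \<omega> - f \<omega>) < 1}" if "f \<in> Emin_pos \<alpha>"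
    for f :: "complex ^ 'a \<Rightarrow> complex"
    using that by (simp add: Emin_norm_zero)
  then have "f \<in> topspace (Emin_pos_topology \<alpha>)" if "f \<in> Emin_pos \<alpha>" for f :: "complex ^ 'a \<Rightarrow> complex"
    using openin_subset[OF Emin_ball_open[OF that zero_less_one, of 0]] that by blast
  moreover have "topspace (Emin_pos_topology \<alpha>) \<subseteq> (Emin_pos \<alpha> :: (complex ^ 'a \<Rightarrow> complex) set)"
    unfolding Emin_pos_topology_def topology_generated_by_topspace by auto
  ultimately show ?thesis by blast
qed

lemma topspace_Emin_0: "topspace (Emin_topology 0) = (\<Inter>b\<in>{0<..}. Emin_pos b)"
proof -
  let ?X = "\<Inter>b\<in>{0<..}. Emin_pos b :: (complex ^ 'a \<Rightarrow> complex) set"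
  have "?X = topspace (Emin_pos_topology 1) \<inter> ?X"
    unfolding topspace_Emin_pos by auto
  then have "?X \<in> {W \<inter> ?X | W a. a > 0 \<and> openin (Emin_pos_topology a) W}"
    using openin_topspace[of "Emin_pos_topology 1"] zero_less_one by blast
  then have "?X \<subseteq> \<Union> {W \<inter> ?X | W a. a > 0 \<and> openin (Emin_pos_topology a) W}"
    by (rule Union_upper)
  moreover have "\<Union> {W \<inter> ?X | W a. a > 0 \<and> openin (Emin_pos_topology a) W} \<subseteq> ?X"
    by blast
  ultimately show ?thesis
    unfolding Emin_topology_def by simp
qed

text \<open>For linear maps, continuity is the existence of seminorm estimates.\<close>

lemma continuous_map_Emin_posI:
  fixes T :: "(complex ^ ('d::finite) \<Rightarrow> complex) \<Rightarrow> (complex ^ 'd \<Rightarrow> complex)"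
  assumes b: "0 < b" and a: "0 < a"
    and T: "\<And>f. f \<in> Emin_pos b \<Longrightarrow> T f \<in> Emin_pos a"
    and diff: "\<And>f g. f \<in> Emin_pos b \<Longrightarrow> g \<in> Emin_pos b \<Longrightarrow> T (\<lambda>\<omega>. f \<omega> - g \<omega>) = (\<lambda>\<omega>. T f \<omega> - T g \<omega>)"
    and bound: "\<And>l. \<exists>l' K. 0 \<le> K \<and> (\<forall>f\<in>Emin_pos b. Emin_norm a l (T f) \<le> K * Emin_norm b l' f)"
  shows "continuous_map (Emin_pos_topology b) (Emin_pos_topology a) T"
proof -
  let ?S = "{{g \<in> Emin_pos a. Emin_norm a l (\<lambda>\<omega>. g \<omega> - f \<omega>) < \<epsilon>} | f l \<epsilon>. f \<in> Emin_pos a \<and> \<epsilon> > 0}"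
  have "openin (Emin_pos_topology b) (T -` U \<inter> topspace (Emin_pos_topology b))" if U_in: "U \<in> ?S" for U
  proof -
    obtain f l \<epsilon> where U: "U = {g \<in> Emin_pos a. Emin_norm a l (\<lambda>\<omega>. g \<omega> - f \<omega>) < \<epsilon>}"
      and f: "f \<in> Emin_pos a" and \<epsilon>: "\<epsilon> > 0" using U_in by blast
    show ?thesis
    proof (subst openin_subopen, intro ballI)
      fix x assume "x \<in> T -` U \<inter> topspace (Emin_pos_topology b)"
      then have x: "x \<in> Emin_pos b" and Tx: "Emin_norm a l (\<lambda>\<omega>. T x \<omega> - f \<omega>) < \<epsilon>"
        by (auto simp: U topspace_Emin_pos)
      obtain l' K where K: "0 \<le> K" "\<And>f. f \<in> Emin_pos b \<Longrightarrow> Emin_norm a l (T f) \<le> K * Emin_norm b l' f"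
        using bound[of l] by blast
      \<comment> \<open>\<open>K + 1\<close> instead of \<open>K\<close>, which may be 0.\<close>
      define \<eta> where "\<eta> = (\<epsilon> - Emin_norm a l (\<lambda>\<omega>. T x \<omega> - f \<omega>)) / (K + 1)"
      have \<eta>: "\<eta> > 0" using Tx K by (simp add: \<eta>_def)
      let ?V = "{g \<in> Emin_pos b. Emin_norm b l' (\<lambda>\<omega>. g \<omega> - x \<omega>) < \<eta>}"
      have "g \<in> T -` U \<inter> topspace (Emin_pos_topology b)" if g: "g \<in> ?V" for g
      proof -
        have gb: "g \<in> Emin_pos b" and g\<eta>: "Emin_norm b l' (\<lambda>\<omega>. g \<omega> - x \<omega>) < \<eta>" using g by auto
        have gx: "(\<lambda>\<omega>. g \<omega> - x \<omega>) \<in> Emin_pos b" by (rule Emin_pos_diff[OF b gb x])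
        have "Emin_norm a l (\<lambda>\<omega>. T g \<omega> - T x \<omega>) \<le> K * Emin_norm b l' (\<lambda>\<omega>. g \<omega> - x \<omega>)"
          using K(2)[OF gx] by (simp add: diff[OF gb x])
        also have "\<dots> \<le> K * \<eta>" using g\<eta> K by (intro mult_left_mono) auto
        also have "\<dots> < (K + 1) * \<eta>" using \<eta> by simp
        also have "\<dots> = \<epsilon> - Emin_norm a l (\<lambda>\<omega>. T x \<omega> - f \<omega>)" using K by (simp add: \<eta>_def)
        finally have "Emin_norm a l (\<lambda>\<omega>. T g \<omega> - f \<omega>) < \<epsilon>"
          using Emin_norm_triangle[OF a T[OF gb] T[OF x] f, of l] by linarith
        then show ?thesis using gb T[OF gb] by (simp add: U topspace_Emin_pos)
      qed
      moreover have "x \<in> ?V" using x \<eta> by (simp add: Emin_norm_zero)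
      ultimately show "\<exists>V. openin (Emin_pos_topology b) V \<and> x \<in> V \<and> V \<subseteq> T -` U \<inter> topspace (Emin_pos_topology b)"
        using Emin_ball_open[OF x \<eta>, of l'] by (intro exI[of _ ?V]) blast
    qed
  qed
  moreover have "T ` topspace (Emin_pos_topology b) \<subseteq> \<Union> ?S"
  proof -
    have union: "\<Union> ?S = topspace (Emin_pos_topology a)"
      unfolding Emin_pos_topology_def topology_generated_by_topspace ..
    show ?thesis unfolding union topspace_Emin_pos by (rule image_subsetI) (rule T)
  qed
  ultimately show ?thesis
    unfolding Emin_pos_topology_def[of a] continuous_on_generated_topo_iff by blast
qed

text \<open>For order 0 the map is continuous into the space of order \<open>a\<close>, because it factors through the space of
  order \<open>min a (1 / \<gamma>)\<close>.\<close>

lemma continuous_map_Emin_topology: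
  fixes T :: "(complex ^ ('d::finite) \<Rightarrow> complex) \<Rightarrow> (complex ^ 'd \<Rightarrow> complex)"
  assumes \<gamma>: "0 < \<gamma>" and \<alpha>: "0 \<le> \<alpha>" "\<alpha> \<le> 1 / \<gamma>"
    and T: "\<And>a b. 0 < b \<Longrightarrow> b \<le> a \<Longrightarrow> b \<le> 1 / \<gamma> \<Longrightarrow> continuous_map (Emin_pos_topology b) (Emin_pos_topology a) T"
  shows "continuous_map (Emin_topology \<alpha>) (Emin_topology \<alpha>) T"
proof (cases "\<alpha> = 0")
  case False
  then show ?thesis using T[of \<alpha> \<alpha>] \<alpha> by (simp add: Emin_topology_def)
next
  case True
  let ?X = "\<Inter>b\<in>{0<..}. Emin_pos b :: (complex ^ 'd \<Rightarrow> complex) set"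
  let ?S = "{W \<inter> ?X | W a. a > 0 \<and> openin (Emin_pos_topology a) W}"
  have gen: "Emin_topology 0 = topology_generated_by ?S" by (simp add: Emin_topology_def)
  have top: "\<Union> ?S = ?X"
    using topspace_Emin_0[where 'a = 'd] unfolding gen topology_generated_by_topspace .
  have cont: "continuous_map (Emin_pos_topology (min a (1 / \<gamma>))) (Emin_pos_topology a) T" if "a > 0" for a
    using that \<gamma> by (intro T) auto
  have TX: "T f \<in> ?X" if f: "f \<in> ?X" for f
  proof
    fix a :: real assume "a \<in> {0<..}"
    then have a: "a > 0" by simp
    then have "f \<in> Emin_pos (min a (1 / \<gamma>))" using f \<gamma> by simp
    then show "T f \<in> Emin_pos a"
      using cont[OF a] unfolding continuous_map_def topspace_Emin_pos by blast
  qed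
  have "openin (Emin_topology 0) (T -` U \<inter> ?X)" if U_in: "U \<in> ?S" for U
  proof -
    obtain W a where U: "U = W \<inter> ?X" and a: "a > 0" and W: "openin (Emin_pos_topology a) W"
      using U_in by blast
    let ?b = "min a (1 / \<gamma>)"
    let ?V = "{x \<in> topspace (Emin_pos_topology ?b). T x \<in> W}"
    have b: "?b > 0" using a \<gamma> by simp
    have "openin (Emin_pos_topology ?b) ?V" by (rule openin_continuous_map_preimage[OF cont[OF a] W])
    then have "?V \<inter> ?X \<in> ?S" using b by blast
    then have "openin (Emin_topology 0) (?V \<inter> ?X)"
      unfolding gen by (rule topology_generated_by_Basis)
    moreover have "T -` U \<inter> ?X = ?V \<inter> ?X"
      using TX b unfolding U topspace_Emin_pos by blast
    ultimately show ?thesis by simp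
  qed
  then have "continuous_map (Emin_topology 0) (topology_generated_by ?S) T"
    unfolding continuous_on_generated_topo_iff topspace_Emin_0 top using TX by blast
  then show ?thesis unfolding True by (simp only: gen[symmetric])
qed

text \<open>The open sets that eventually contain a given sequence whenever they contain its limit are closed
  under unions and finite intersections. So convergence may be tested on a subbase, and the norms need not be compared with each
  other.\<close>

lemma limit_in_generated_topology:
  assumes sub: "\<And>U. U \<in> S \<Longrightarrow> f \<in> U \<Longrightarrow> \<forall>\<^sub>F n in sequentially. x n \<in> U"
    and W: "openin (topology_generated_by S) W" "f \<in> W"
  shows "\<forall>\<^sub>F n in sequentially. x n \<in> W"
proof -
  have "generate_topology_on S W" using W by (simp add: openin_topology_generated_by_iff)
  then show ?thesis using \<open>f \<in> W\<close>
  proof (induction W rule: generate_topology_on.induct)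
    case (Int U V)
    then have "\<forall>\<^sub>F n in sequentially. x n \<in> U" "\<forall>\<^sub>F n in sequentially. x n \<in> V" by auto
    then show ?case by eventually_elim simp
  next
    case (UN K)
    then obtain U where "U \<in> K" "f \<in> U" by blast
    with UN have "\<forall>\<^sub>F n in sequentially. x n \<in> U" by blast
    then show ?case by eventually_elim (use \<open>U \<in> K\<close> in blast)
  qed (use sub in auto)
qed


section \<open>Polynomials\<close>

lemma polynomials_eq_power_series:
  fixes \<phi> :: "nat \<Rightarrow> ('d::finite) tensor"
  shows "(\<lambda>\<omega>. \<Sum>k\<le>n. tpair k (tensor_power k \<omega>) (\<phi> k)) =
    power_series (\<lambda>m. if size m \<le> n then \<Sum>l | mset l = m. \<phi> (size m) l else 0)"
proof
  fix \<omega> :: "complex ^ 'd"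
  have "tpair k (tensor_power k \<omega>) (\<phi> k) =
      (\<Sum>m | size m = k. (\<Sum>l | mset l = m. \<phi> (size m) l) * monom_val \<omega> m)" for k
  proof -
    have "tpair k (tensor_power k \<omega>) (\<phi> k) = (\<Sum>l | length l = k. monom_val \<omega> (mset l) * \<phi> k l)"
      unfolding tpair_def by (intro sum.cong) (auto simp: tensor_power_def monom_val_mset)
    then show ?thesis
      unfolding sum_lists_by_mset sum_distrib_right
      by (simp only:) (intro sum.cong refl; auto simp: mult.commute)
  qed
  then have "(\<Sum>k\<le>n. tpair k (tensor_power k \<omega>) (\<phi> k)) =
      (\<Sum>m | size m \<le> n. (\<Sum>l | mset l = m. \<phi> (size m) l) * monom_val \<omega> m)"
    by (simp add: sum_multisets_by_size)
  also have "\<dots> = power_series (\<lambda>m. if size m \<le> n then \<Sum>l | mset l = m. \<phi> (size m) l else 0) \<omega>"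
    by (subst finite_support_entire_coeffs(2)[OF finite_multisets_size_le[of n]]) auto
  finally show "(\<Sum>k\<le>n. tpair k (tensor_power k \<omega>) (\<phi> k)) =
      power_series (\<lambda>m. if size m \<le> n then \<Sum>l | mset l = m. \<phi> (size m) l else 0) \<omega>" .
qed

lemma finite_power_series_polynomial:
  fixes a :: "('d::finite) multiset \<Rightarrow> complex"
  assumes "\<And>m. n < size m \<Longrightarrow> a m = 0"
  shows "power_series a \<in> polynomials"
proof -
  define \<phi> where "\<phi> k = (\<lambda>l :: 'd list. if length l = k then a (mset l) / of_nat (arrangements (mset l)) else 0)" for k
  have "\<phi> k \<in> sym_tensors k" for k
    unfolding sym_tensors_def \<phi>_def by (auto dest: mset_eq_length)
  moreover have "(\<lambda>m. if size m \<le> n then \<Sum>l | mset l = m. \<phi> (size m) l else 0) = a"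
  proof
    fix m :: "'d multiset"
    have "(\<Sum>l | mset l = m. \<phi> (size m) l) = (\<Sum>l | mset l = m. a m / of_nat (arrangements m))"
      by (intro sum.cong) (auto simp: \<phi>_def)
    also have "\<dots> = a m" using arrangements_pos[of m] by (simp add: arrangements_def[symmetric])
    finally show "(if size m \<le> n then \<Sum>l | mset l = m. \<phi> (size m) l else 0) = a m"
      using assms[of m] by auto
  qed
  then have "power_series a = (\<lambda>\<omega>. \<Sum>k\<le>n. tpair k (tensor_power k \<omega>) (\<phi> k))"
    unfolding polynomials_eq_power_series by simp
  ultimately show ?thesis unfolding polynomials_def by blast
qed

lemma coeff_space_finite_support:
  assumes "\<And>m. n < size m \<Longrightarrow> a m = 0"
  shows "coeff_space \<delta> (a :: ('d::finite) multiset \<Rightarrow> complex)"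
  unfolding coeff_space_def
proof (intro allI impI)
  fix R :: real
  show "(\<lambda>m. cmod (a m) * weight \<delta> R m) summable_on UNIV"
    by (rule summable_on_cong_neutral[THEN iffD2, OF _ _ _ summable_on_finite[OF finite_multisets_size_le[of n]]])
       (auto simp: assms)
qed

lemma polynomials_Emin_pos:
  fixes p :: "complex ^ ('d::finite) \<Rightarrow> complex"
  assumes "p \<in> polynomials" "\<alpha> > 0"
  shows "p \<in> Emin_pos \<alpha>"
proof -
  obtain n \<phi> where "p = (\<lambda>\<omega>. \<Sum>k\<le>n. tpair k (tensor_power k \<omega>) (\<phi> k))"
    using assms(1) unfolding polynomials_def by blast
  then have p: "p = power_series (\<lambda>m. if size m \<le> n then \<Sum>l | mset l = m. \<phi> (size m) l else 0)"
    by (simp only: polynomials_eq_power_series)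
  show ?thesis
    unfolding p by (rule power_series_Emin_pos[OF assms(2) coeff_space_finite_support[of n]]) simp
qed

definition taylor_poly :: "(complex ^ ('d::finite) \<Rightarrow> complex) \<Rightarrow> nat \<Rightarrow> complex ^ 'd \<Rightarrow> complex" where
  "taylor_poly f n = power_series (\<lambda>m. if size m \<le> n then taylor_coeffs f m else 0)"

lemma taylor_poly_polynomial: "taylor_poly f n \<in> polynomials"
  unfolding taylor_poly_def by (rule finite_power_series_polynomial[of n]) simp

text \<open>In the weighted norm the error is the tail of a convergent series.\<close>

lemma taylor_poly_tendsto:
  fixes f :: "complex ^ ('d::finite) \<Rightarrow> complex"
  assumes \<alpha>: "\<alpha> > 0" and f: "f \<in> Emin_pos \<alpha>"
  shows "(\<lambda>n. Emin_norm \<alpha> l (\<lambda>\<omega>. taylor_poly f n \<omega> - f \<omega>)) \<longlonglongrightarrow> 0"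
proof -
  let ?a = "taylor_coeffs f"
  obtain R where R: "R > 0" "\<And>a :: 'd multiset \<Rightarrow> complex. coeff_space (1 / \<alpha>) a \<Longrightarrow>
      Emin_norm \<alpha> l (power_series a) \<le> coeff_norm (1 / \<alpha>) R a"
    using Emin_norm_le_coeff_norm[OF \<alpha>, where 'd = 'd] by blast
  have a: "coeff_space (1 / \<alpha>) ?a" by (rule Emin_pos_coeff_space[OF \<alpha> f])
  let ?g = "\<lambda>m. cmod (?a m) * weight (1 / \<alpha>) R m"
  have g: "?g summable_on UNIV" by (rule coeff_spaceD[OF a R(1)])
  have "(\<lambda>m. norm (?g m)) summable_on UNIV" using g R(1) by (simp add: weight_nonneg)
  from infsum_by_size[OF this]
  have sums: "(\<lambda>n. \<Sum>m | size m = n. ?g m) sums infsum ?g UNIV" .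
  have le: "Emin_norm \<alpha> l (\<lambda>\<omega>. taylor_poly f n \<omega> - f \<omega>) \<le> infsum ?g UNIV - (\<Sum>k\<le>n. \<Sum>m | size m = k. ?g m)" for n
  proof -
    let ?p = "\<lambda>m. if size m \<le> n then ?a m else 0"
    let ?b = "\<lambda>m. (-1) * ?a m + ?p m"
    have p: "coeff_space (1 / \<alpha>) ?p" by (rule coeff_space_finite_support[of n]) simp
    have b: "coeff_space (1 / \<alpha>) ?b" by (rule coeff_space_lincomb[OF a p])
    have "(\<lambda>\<omega>. taylor_poly f n \<omega> - f \<omega>) = power_series ?b"
    proof
      fix \<omega>
      have "power_series ?b \<omega> = (-1) * power_series ?a \<omega> + power_series ?p \<omega>"
        using \<alpha> by (intro power_series_lincomb coeff_space_entire[OF a] coeff_space_entire[OF p]) auto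
      then show "taylor_poly f n \<omega> - f \<omega> = power_series ?b \<omega>"
        by (simp add: taylor_poly_def Emin_pos_power_series[OF \<alpha> f])
    qed
    then have "Emin_norm \<alpha> l (\<lambda>\<omega>. taylor_poly f n \<omega> - f \<omega>) \<le> coeff_norm (1 / \<alpha>) R ?b"
      using R(2)[OF b] by simp
    also have "coeff_norm (1 / \<alpha>) R ?b = infsum ?g (- {m. size m \<le> n})"
      unfolding coeff_norm_def by (rule infsum_cong_neutral) auto
    also have "\<dots> = infsum ?g UNIV - sum ?g {m. size m \<le> n}"
      using infsum_Un_disjoint[of ?g "{m. size m \<le> n}" "- {m. size m \<le> n}"]
        summable_on_subset[OF g, of "- {m. size m \<le> n}"] by (simp add: Compl_partition)
    finally show ?thesis by (simp add: sum_multisets_by_size)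
  qed
  have "(\<lambda>n. infsum ?g UNIV - (\<Sum>k\<le>n. \<Sum>m | size m = k. ?g m)) \<longlonglongrightarrow> infsum ?g UNIV - infsum ?g UNIV"
    using sums unfolding sums_def_le by (intro tendsto_diff tendsto_const)
  then have "(\<lambda>n. infsum ?g UNIV - (\<Sum>k\<le>n. \<Sum>m | size m = k. ?g m)) \<longlonglongrightarrow> 0" by simp
  then show ?thesis
  proof (rule tendsto_sandwich[OF _ _ tendsto_const, rotated -1])
    show "\<forall>\<^sub>F n in sequentially. 0 \<le> Emin_norm \<alpha> l (\<lambda>\<omega>. taylor_poly f n \<omega> - f \<omega>)"
      using polynomials_Emin_pos[OF taylor_poly_polynomial \<alpha>] f
      by (intro always_eventually allI Emin_norm_nonneg Emin_pos_diff[OF \<alpha>]) auto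
    show "\<forall>\<^sub>F n in sequentially. Emin_norm \<alpha> l (\<lambda>\<omega>. taylor_poly f n \<omega> - f \<omega>) \<le>
        infsum ?g UNIV - (\<Sum>k\<le>n. \<Sum>m | size m = k. ?g m)"
      by (intro always_eventually allI le)
  qed
qed

lemma taylor_poly_eventually_in:
  fixes f :: "complex ^ ('d::finite) \<Rightarrow> complex"
  assumes \<alpha>: "\<alpha> > 0" and f: "f \<in> Emin_pos \<alpha>" and W: "openin (Emin_pos_topology \<alpha>) W" "f \<in> W"
  shows "\<forall>\<^sub>F n in sequentially. taylor_poly f n \<in> W"
proof (rule limit_in_generated_topology[OF _ W(1)[unfolded Emin_pos_topology_def] W(2)])
  fix U assume "U \<in> {{g \<in> Emin_pos \<alpha>. Emin_norm \<alpha> l (\<lambda>\<omega>. g \<omega> - h \<omega>) < \<epsilon>} | h l \<epsilon>. h \<in> Emin_pos \<alpha> \<and> \<epsilon> > 0}"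
    and fU: "f \<in> U"
  then obtain h l \<epsilon> where U: "U = {g \<in> Emin_pos \<alpha>. Emin_norm \<alpha> l (\<lambda>\<omega>. g \<omega> - h \<omega>) < \<epsilon>}" and h: "h \<in> Emin_pos \<alpha>"
    by blast
  have "Emin_norm \<alpha> l (\<lambda>\<omega>. f \<omega> - h \<omega>) < \<epsilon>" using fU by (simp add: U)
  then have "\<forall>\<^sub>F n in sequentially. Emin_norm \<alpha> l (\<lambda>\<omega>. taylor_poly f n \<omega> - f \<omega>) < \<epsilon> - Emin_norm \<alpha> l (\<lambda>\<omega>. f \<omega> - h \<omega>)"
    by (intro order_tendstoD(2)[OF taylor_poly_tendsto[OF \<alpha> f]]) simp
  then show "\<forall>\<^sub>F n in sequentially. taylor_poly f n \<in> U"
  proof eventually_elim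
    case (elim n)
    have "taylor_poly f n \<in> Emin_pos \<alpha>" by (rule polynomials_Emin_pos[OF taylor_poly_polynomial \<alpha>])
    then show ?case using Emin_norm_triangle[OF \<alpha> _ f h, of "taylor_poly f n" l] elim by (simp add: U)
  qed
qed

lemma polynomials_dense:
  assumes "0 \<le> \<alpha>"
  shows "polynomials \<subseteq> (topspace (Emin_topology \<alpha>) :: (complex ^ ('d::finite) \<Rightarrow> complex) set)"
    and "Emin_topology \<alpha> closure_of polynomials = (topspace (Emin_topology \<alpha>) :: (complex ^ ('d::finite) \<Rightarrow> complex) set)"
proof -
  let ?X = "\<Inter>b\<in>{0<..}. Emin_pos b :: (complex ^ 'd \<Rightarrow> complex) set"
  show "polynomials \<subseteq> (topspace (Emin_topology \<alpha>) :: (complex ^ 'd \<Rightarrow> complex) set)"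
  proof (cases "\<alpha> = 0")
    case True
    then show ?thesis using polynomials_Emin_pos by (auto simp: topspace_Emin_0)
  next
    case False
    then have "\<alpha> > 0" using assms by simp
    then show ?thesis using polynomials_Emin_pos by (auto simp: Emin_topology_def topspace_Emin_pos)
  qed
  have ev: "\<forall>\<^sub>F n in sequentially. taylor_poly f n \<in> W"
    if f: "f \<in> topspace (Emin_topology \<alpha>)" and W: "openin (Emin_topology \<alpha>) W" "f \<in> W"
    for f :: "complex ^ 'd \<Rightarrow> complex" and W
  proof (cases "\<alpha> = 0")
    case False
    then show ?thesis
      using taylor_poly_eventually_in[of \<alpha> f W] f W assms by (simp add: Emin_topology_def topspace_Emin_pos)
  next
    case True
    then have fX: "f \<in> ?X" using f by (simp only: topspace_Emin_0)
    have W': "openin (topology_generated_by {W \<inter> ?X | W a. a > 0 \<and> openin (Emin_pos_topology a) W}) W"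
      using W(1) True by (simp add: Emin_topology_def)
    show ?thesis
    proof (rule limit_in_generated_topology[OF _ W' W(2)])
      fix U assume "U \<in> {W \<inter> ?X | W a. a > 0 \<and> openin (Emin_pos_topology a) W}" and fU: "f \<in> U"
      then obtain V a where U: "U = V \<inter> ?X" and a: "a > 0" and V: "openin (Emin_pos_topology a) V" by blast
      have "f \<in> Emin_pos a" "f \<in> V" using fX fU a U by auto
      then have "\<forall>\<^sub>F n in sequentially. taylor_poly f n \<in> V"
        by (intro taylor_poly_eventually_in[OF a _ V])
      then show "\<forall>\<^sub>F n in sequentially. taylor_poly f n \<in> U"
      proof eventually_elim
        case (elim n)
        then show ?case using polynomials_Emin_pos[OF taylor_poly_polynomial[of f n]] by (simp add: U)
      qed
    qed
  qed
  show "Emin_topology \<alpha> closure_of polynomials = (topspace (Emin_topology \<alpha>) :: (complex ^ 'd \<Rightarrow> complex) set)"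
  proof
    show "Emin_topology \<alpha> closure_of polynomials \<subseteq> (topspace (Emin_topology \<alpha>) :: (complex ^ 'd \<Rightarrow> complex) set)"
      by (rule closure_of_subset_topspace)
    show "(topspace (Emin_topology \<alpha>) :: (complex ^ 'd \<Rightarrow> complex) set) \<subseteq> Emin_topology \<alpha> closure_of polynomials"
    proof
      fix f :: "complex ^ 'd \<Rightarrow> complex" assume f: "f \<in> topspace (Emin_topology \<alpha>)"
      have "\<exists>y. y \<in> polynomials \<and> y \<in> W" if "f \<in> W \<and> openin (Emin_topology \<alpha>) W" for W
      proof -
        have "\<forall>\<^sub>F n in sequentially. taylor_poly f n \<in> W" using that by (intro ev[OF f]) auto
        then obtain n where "taylor_poly f n \<in> W" by (auto simp: eventually_sequentially)
        then show ?thesis using taylor_poly_polynomial by blast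
      qed
      then show "f \<in> Emin_topology \<alpha> closure_of polynomials"
        unfolding in_closure_of using f by blast
    qed
  qed
qed


section \<open>Extension of Sheffer operators\<close>

definition coeff_operator :: "(('d::finite) multiset \<Rightarrow> 'd multiset \<Rightarrow> complex) \<Rightarrow>
    (complex ^ 'd \<Rightarrow> complex) \<Rightarrow> complex ^ 'd \<Rightarrow> complex" where
  "coeff_operator c f = power_series (mat_apply c (taylor_coeffs f))"

lemma row_bounded_le_inverse:
  assumes "row_bounded \<gamma> c" "0 < b" "b \<le> 1 / \<gamma>"
  shows "\<gamma> \<le> 1 / b"
proof -
  have "0 < \<gamma>" using assms(1) unfolding row_bounded_def by (rule conjunct1)
  then show ?thesis using assms(2,3) by (simp add: field_simps)
qed

lemma coeff_operator_Emin_pos: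
  fixes c :: "('d::finite) multiset \<Rightarrow> 'd multiset \<Rightarrow> complex"
  assumes c: "row_bounded \<gamma> c" and b: "0 < b" "b \<le> 1 / \<gamma>" and f: "f \<in> Emin_pos b"
  shows "coeff_operator c f \<in> Emin_pos b"
    and "taylor_coeffs (coeff_operator c f) = mat_apply c (taylor_coeffs f)"
proof -
  have \<gamma>: "\<gamma> \<le> 1 / b" by (rule row_bounded_le_inverse[OF c b])
  have sp: "coeff_space (1 / b) (mat_apply c (taylor_coeffs f))"
    by (rule coeff_space_mat_apply[OF c \<gamma> Emin_pos_coeff_space[OF b(1) f]])
  show "coeff_operator c f \<in> Emin_pos b"
    unfolding coeff_operator_def by (rule power_series_Emin_pos[OF b(1) sp])
  show "taylor_coeffs (coeff_operator c f) = mat_apply c (taylor_coeffs f)"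
    unfolding coeff_operator_def
    by (rule taylor_coeffs_power_series[OF coeff_space_entire[OF sp]]) (use b in simp)
qed

lemma coeff_operator_lincomb:
  fixes c :: "('d::finite) multiset \<Rightarrow> 'd multiset \<Rightarrow> complex"
  assumes c: "row_bounded \<gamma> c" and b: "0 < b" "b \<le> 1 / \<gamma>" and f: "f \<in> Emin_pos b" and g: "g \<in> Emin_pos b"
  shows "coeff_operator c (\<lambda>\<omega>. t * f \<omega> + g \<omega>) = (\<lambda>\<omega>. t * coeff_operator c f \<omega> + coeff_operator c g \<omega>)"
proof -
  have \<gamma>: "\<gamma> \<le> 1 / b" and b0: "0 \<le> 1 / b" using row_bounded_le_inverse[OF c b] b by simp_all
  note sp = Emin_pos_coeff_space[OF b(1) f] Emin_pos_coeff_space[OF b(1) g]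
  note ent = coeff_space_entire[OF coeff_space_mat_apply[OF c \<gamma> sp(1)] b0]
    coeff_space_entire[OF coeff_space_mat_apply[OF c \<gamma> sp(2)] b0]
  show ?thesis
    unfolding coeff_operator_def Emin_pos_lincomb(2)[OF b(1) f g] mat_apply_lincomb[OF c \<gamma> sp]
    by (rule ext) (rule power_series_lincomb[OF ent])
qed

lemma coeff_operator_continuous:
  fixes c :: "('d::finite) multiset \<Rightarrow> 'd multiset \<Rightarrow> complex"
  assumes c: "row_bounded \<gamma> c" and b: "0 < b" "b \<le> a" "b \<le> 1 / \<gamma>"
  shows "continuous_map (Emin_pos_topology b) (Emin_pos_topology a) (coeff_operator c)"
proof (rule continuous_map_Emin_posI)
  have a: "0 < a" using b by simp
  have \<gamma>: "\<gamma> \<le> 1 / b" by (rule row_bounded_le_inverse[OF c b(1,3)])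
  have ab: "1 / a \<le> 1 / b" using b by (simp add: frac_le)
  show "0 < a" "0 < b" by fact+
  show "coeff_operator c f \<in> Emin_pos a" if "f \<in> Emin_pos b" for f
    by (rule Emin_pos_mono[OF b(1,2) coeff_operator_Emin_pos(1)[OF c b(1,3) that]])
  show "coeff_operator c (\<lambda>\<omega>. f \<omega> - g \<omega>) = (\<lambda>\<omega>. coeff_operator c f \<omega> - coeff_operator c g \<omega>)"
    if "f \<in> Emin_pos b" "g \<in> Emin_pos b" for f g
    using coeff_operator_lincomb[OF c b(1,3) that(2,1), of "-1"] by simp
  show "\<exists>l' K. 0 \<le> K \<and> (\<forall>f\<in>Emin_pos b. Emin_norm a l (coeff_operator c f) \<le> K * Emin_norm b l' f)" for l
  proof (rule Emin_norm_le_coeff_norm[OF a, where l = l and 'd = 'd])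
    fix R :: real
    assume R: "R > 0" "\<And>a' :: 'd multiset \<Rightarrow> complex. coeff_space (1 / a) a' \<Longrightarrow>
        Emin_norm a l (power_series a') \<le> coeff_norm (1 / a) R a'"
    show ?thesis
    proof (rule mat_apply_coeff_space[OF c \<gamma> R(1)])
      fix K M :: real
      assume K: "K \<ge> 0" "M > 0" and mat: "\<And>a. coeff_space (1 / b) a \<Longrightarrow>
          (\<lambda>k. cmod (mat_apply c a k) * weight (1 / b) R k) summable_on UNIV \<and>
          coeff_norm (1 / b) R (mat_apply c a) \<le> K * coeff_norm (1 / b) M a"
      show ?thesis
      proof (rule Emin_coeff_norm_le[OF b(1) K(2), where 'd = 'd])
        fix K' :: real and l'
        assume K': "K' \<ge> 0" and coeff: "\<And>f :: complex ^ 'd \<Rightarrow> complex. f \<in> Emin_pos b \<Longrightarrow>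
            (\<lambda>m. cmod (taylor_coeffs f m) * weight (1 / b) M m) summable_on UNIV \<and>
            coeff_norm (1 / b) M (taylor_coeffs f) \<le> K' * Emin_norm b l' f"
        have "Emin_norm a l (coeff_operator c f) \<le> (K * K') * Emin_norm b l' f" if f: "f \<in> Emin_pos b" for f
        proof -
          have sp: "coeff_space (1 / b) (taylor_coeffs f)" by (rule Emin_pos_coeff_space[OF b(1) f])
          have sp': "coeff_space (1 / b) (mat_apply c (taylor_coeffs f))"
            by (rule coeff_space_mat_apply[OF c \<gamma> sp])
          have "Emin_norm a l (coeff_operator c f) \<le> coeff_norm (1 / a) R (mat_apply c (taylor_coeffs f))"
            unfolding coeff_operator_def by (rule R(2)[OF coeff_space_antimono[OF sp' ab]])
          also have "\<dots> \<le> coeff_norm (1 / b) R (mat_apply c (taylor_coeffs f))"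
            by (rule coeff_norm_mono[OF sp' ab R(1)])
          also have "\<dots> \<le> K * coeff_norm (1 / b) M (taylor_coeffs f)" by (rule conjunct2[OF mat[OF sp]])
          also have "\<dots> \<le> K * (K' * Emin_norm b l' f)" by (rule mult_left_mono[OF conjunct2[OF coeff[OF f]] K(1)])
          finally show ?thesis by (simp add: mult.assoc)
        qed
        moreover have "0 \<le> K * K'" using K(1) K' by (rule mult_nonneg_nonneg)
        ultimately show ?thesis by (intro exI conjI ballI)
      qed
    qed
  qed
qed

lemma coeff_operator_inverse:
  fixes c :: "('d::finite) multiset \<Rightarrow> 'd multiset \<Rightarrow> complex"
  assumes c: "row_bounded \<gamma> c" and c': "row_bounded \<gamma> c'" and b: "0 < b" "b \<le> 1 / \<gamma>" and f: "f \<in> Emin_pos b"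
    and inv: "\<And>m j. (\<Sum>k | size k \<le> size m. c m k * c' k j) = (if m = j then 1 else 0)"
  shows "coeff_operator c' (coeff_operator c f) = f"
proof -
  have \<gamma>: "\<gamma> \<le> 1 / b" by (rule row_bounded_le_inverse[OF c b])
  have "mat_apply c' (mat_apply c (taylor_coeffs f)) = taylor_coeffs f"
    by (rule mat_apply_mat_apply[OF c c' \<gamma> Emin_pos_coeff_space[OF b(1) f] inv])
  then show ?thesis
    unfolding coeff_operator_def[of c' "coeff_operator c f"] coeff_operator_Emin_pos(2)[OF c b f]
    by (simp add: Emin_pos_power_series[OF b(1) f])
qed

lemma row_bounded_sheffer_matrix:
  assumes "tangent_to_id A" "sheffer_bound \<gamma> A \<sigma>" "0 < \<gamma>"
  shows "row_bounded \<gamma> (sheffer_matrix A \<sigma>)"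
  unfolding row_bounded_def
proof (intro conjI allI impI)
  fix \<delta> R :: real assume "\<gamma> \<le> \<delta>" "0 < R"
  show "\<exists>K\<ge>0. \<exists>M>0. \<forall>m. (\<Sum>k | size k \<le> size m. cmod (sheffer_matrix A \<sigma> m k) * weight \<delta> R k) \<le> K * weight \<delta> M m"
    by (rule sheffer_matrix_row_bound[OF assms(2,3) \<open>\<gamma> \<le> \<delta>\<close> \<open>0 < R\<close>]) (intro exI conjI allI)
qed (fact assms(3), rule sheffer_matrix_eq_0[OF assms(1)])

text \<open>On polynomials all sums are finite, and the claim is the description of \<open>S\<close> by the matrix, extended
  linearly.\<close>

lemma coeff_operator_sheffer:
  fixes S :: "nat \<Rightarrow> complex ^ ('d::finite) \<Rightarrow> 'd tensor"
  assumes S: "sheffer_sequence S A \<rho>" and p: "p \<in> polynomials"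
  defines "c \<equiv> sheffer_matrix (vector_series A) (inverse (comp_series \<rho> A))"
  shows "coeff_operator c p = sheffer_operator S p"
proof -
  have A: "tangent_to_id (vector_series A)"
    using S unfolding sheffer_sequence_def by (intro tangent_to_id_vector_series) blast
  obtain n \<phi> where \<phi>: "\<And>k. \<phi> k \<in> sym_tensors k" and p_eq: "p = (\<lambda>\<omega>. \<Sum>k\<le>n. tpair k (tensor_power k \<omega>) (\<phi> k))"
    using p unfolding polynomials_def by blast
  \<comment> \<open>The Taylor coefficients of \<open>p\<close>.\<close>
  define a where "a m = (if size m \<le> n then \<Sum>l | mset l = m. \<phi> (size m) l else 0)" for m :: "'d multiset"
  have a0: "a m = 0" if "n < size m" for m using that by (simp add: a_def)
  have "p = power_series a" unfolding p_eq polynomials_eq_power_series a_def ..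
  moreover have "entire_coeffs a"
    by (rule coeff_space_entire[OF coeff_space_finite_support[of n a, OF a0] order_refl])
  ultimately have coeffs: "taylor_coeffs p = a" by (simp add: taylor_coeffs_power_series)
  have b: "mat_apply c a j = (\<Sum>m | size m \<le> n. a m * c m j)" for j
  proof -
    have "mat_apply c a j = (\<Sum>\<^sub>\<infinity>m\<in>{m. size m \<le> n}. a m * c m j)"
      unfolding mat_apply_def by (rule infsum_cong_neutral) (auto simp: a0)
    then show ?thesis by simp
  qed
  have c0: "c m j = 0" if "size m < size j" for m j
    unfolding c_def by (rule sheffer_matrix_eq_0[OF A that])
  have b0: "mat_apply c a j = 0" if "n < size j" for j
    unfolding b by (rule sum.neutral) (use that c0 in auto)
  show ?thesis
  proof
    fix \<omega>
    have "coeff_operator c p \<omega> = (\<Sum>j | size j \<le> n. mat_apply c a j * monom_val \<omega> j)"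
      unfolding coeff_operator_def coeffs
      by (rule finite_support_entire_coeffs(2)[OF finite_multisets_size_le]) (use b0 in auto)
    also have "\<dots> = (\<Sum>m | size m \<le> n. a m * (\<Sum>j | size j \<le> n. c m j * monom_val \<omega> j))"
      unfolding b sum_distrib_right sum_distrib_left by (subst sum.swap) (simp only: mult.assoc)
    also have "\<dots> = (\<Sum>k\<le>n. \<Sum>m | size m = k. a m * (\<Sum>j | size j \<le> n. c m j * monom_val \<omega> j))"
      by (rule sum_multisets_by_size)
    also have "\<dots> = (\<Sum>k\<le>n. tpair k (S k \<omega>) (\<phi> k))"
    proof (rule sum.cong[OF refl])
      fix k assume k: "k \<in> {..n}"
      have S_eq: "S k \<omega> l = (\<Sum>j | size j \<le> n. c (mset l) j * monom_val \<omega> j)" if l: "length l = k" for l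
      proof -
        have "S k \<omega> l = (\<Sum>j | size j \<le> k. c (mset l) j * monom_val \<omega> j)"
          using sheffer_sequence_coeffs[OF S, of l \<omega>] l by (simp add: c_def)
        also have "\<dots> = (\<Sum>j | size j \<le> n. c (mset l) j * monom_val \<omega> j)"
          by (rule sum.mono_neutral_left) (use k l c0 in auto)
        finally show ?thesis .
      qed
      have "tpair k (S k \<omega>) (\<phi> k) = (\<Sum>m | size m = k. \<Sum>l | mset l = m. S k \<omega> l * \<phi> k l)"
        unfolding tpair_def by (rule sum_lists_by_mset)
      also have "\<dots> = (\<Sum>m | size m = k. a m * (\<Sum>j | size j \<le> n. c m j * monom_val \<omega> j))"
      proof (rule sum.cong[OF refl])
        fix m :: "'d multiset" assume m: "m \<in> {m. size m = k}"
        have "(\<Sum>l | mset l = m. S k \<omega> l * \<phi> k l) =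
            (\<Sum>l | mset l = m. \<phi> k l * (\<Sum>j | size j \<le> n. c m j * monom_val \<omega> j))"
        proof (rule sum.cong[OF refl])
          fix l assume "l \<in> {l. mset l = m}"
          then have l: "mset l = m" by simp
          have "length l = k" using m unfolding l[symmetric] by simp
          show "S k \<omega> l * \<phi> k l = \<phi> k l * (\<Sum>j | size j \<le> n. c m j * monom_val \<omega> j)"
            unfolding S_eq[OF \<open>length l = k\<close>] l by (rule mult.commute)
        qed
        also have "\<dots> = a m * (\<Sum>j | size j \<le> n. c m j * monom_val \<omega> j)"
          using m k by (simp add: a_def sum_distrib_right)
        finally show "(\<Sum>l | mset l = m. S k \<omega> l * \<phi> k l) = a m * (\<Sum>j | size j \<le> n. c m j * monom_val \<omega> j)" .
      qed
      finally show "(\<Sum>m | size m = k. a m * (\<Sum>j | size j \<le> n. c m j * monom_val \<omega> j)) = tpair k (S k \<omega>) (\<phi> k)" ..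
    qed
    also have "\<dots> = sheffer_operator S p \<omega>" unfolding p_eq sheffer_operator_eq[OF \<phi>] ..
    finally show "coeff_operator c p \<omega> = sheffer_operator S p \<omega>" .
  qed
qed

text \<open>The data \<open>(A, \<sigma>)\<close> and \<open>(B, \<rho>)\<close> give mutually inverse matrices, both of which act continuously.\<close>

theorem sheffer_operator_extends:
  fixes S :: "nat \<Rightarrow> complex ^ ('d::finite) \<Rightarrow> 'd tensor"
  assumes S: "sheffer_sequence S A \<rho>" and B: "tangent_to_id B"
    and BA: "\<And>i. mps_subst (vector_series A) (B i) = mps_var i"
    and AB: "\<And>i. mps_subst B (vector_series A i) = mps_var i"
    and \<gamma>: "0 < \<gamma>" and bound: "sheffer_bound \<gamma> (vector_series A) (inverse (comp_series \<rho> A))"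
    and bound': "sheffer_bound \<gamma> B (tensor_series \<rho>)"
    and \<alpha>: "0 \<le> \<alpha>" "\<alpha> \<le> 1 / \<gamma>"
  shows "extends_to_linear_self_homeomorphism (Emin_topology \<alpha>) polynomials (sheffer_operator S)"
proof -
  define c where "c = sheffer_matrix (vector_series A) (inverse (comp_series \<rho> A))"
  define c' where "c' = sheffer_matrix B (tensor_series \<rho>)"
  have A: "tangent_to_id (vector_series A)"
    using S unfolding sheffer_sequence_def by (intro tangent_to_id_vector_series) blast
  have "mcoeff (comp_series \<rho> A) {#} = 1"
    using S by (intro comp_const) (simp add: sheffer_sequence_def)
  then have inv: "mps_subst (vector_series A) (tensor_series \<rho>) * inverse (comp_series \<rho> A) = 1"
    unfolding comp_series_eq_subst[symmetric] by (rule mps_mult_inverse)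
  have c: "row_bounded \<gamma> c" and c': "row_bounded \<gamma> c'"
    unfolding c_def c'_def by (rule row_bounded_sheffer_matrix[OF A bound \<gamma>] row_bounded_sheffer_matrix[OF B bound' \<gamma>])+
  have cc': "(\<Sum>k | size k \<le> size m. c m k * c' k j) = (if m = j then 1 else 0)"
    and c'c: "(\<Sum>k | size k \<le> size m. c' m k * c k j) = (if m = j then 1 else 0)" for m j
    unfolding c_def c'_def by (rule sheffer_matrix_inverse[OF A B BA AB inv])+
  let ?T = "coeff_operator c" and ?T' = "coeff_operator c'"
  let ?X = "Emin_topology \<alpha> :: (complex ^ 'd \<Rightarrow> complex) topology"
  have X: "\<exists>b. 0 < b \<and> b \<le> 1 / \<gamma> \<and> topspace ?X \<subseteq> Emin_pos b"
  proof (cases "\<alpha> = 0")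
    case True
    then show ?thesis using \<gamma> by (intro exI[of _ "1 / \<gamma>"]) (auto simp: topspace_Emin_0)
  next
    case False
    then show ?thesis using \<alpha> by (intro exI[of _ \<alpha>]) (auto simp: Emin_topology_def topspace_Emin_pos)
  qed
  then obtain b where b: "0 < b" "b \<le> 1 / \<gamma>" and Xb: "topspace ?X \<subseteq> Emin_pos b" by blast
  have "continuous_map ?X ?X ?T" "continuous_map ?X ?X ?T'"
    by (rule continuous_map_Emin_topology[OF \<gamma> \<alpha>], rule coeff_operator_continuous[OF c], assumption+,
        rule continuous_map_Emin_topology[OF \<gamma> \<alpha>], rule coeff_operator_continuous[OF c'], assumption+)
  moreover have "?T' (?T f) = f" "?T (?T' f) = f" if "f \<in> topspace ?X" for f
    using that Xb by (auto intro!: coeff_operator_inverse[OF c c' b _ cc'] coeff_operator_inverse[OF c' c b _ c'c])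
  ultimately have "homeomorphic_maps ?X ?X ?T ?T'"
    unfolding homeomorphic_maps_def by blast
  then have homeo: "homeomorphic_map ?X ?X ?T"
    unfolding homeomorphic_map_maps by blast
  have lin: "?T (\<lambda>x. t * f x + g x) = (\<lambda>x. t * ?T f x + ?T g x)" if "f \<in> topspace ?X" "g \<in> topspace ?X" for t f g
    by (rule coeff_operator_lincomb[OF c b]) (use that Xb in auto)
  have eq: "?T p = sheffer_operator S p" if "p \<in> polynomials" for p
    unfolding c_def by (rule coeff_operator_sheffer[OF S that])
  show ?thesis
    unfolding extends_to_linear_self_homeomorphism_def
  proof (intro conjI)
    show "\<exists>T. (\<forall>p\<in>polynomials. T p = sheffer_operator S p) \<and>
        (\<forall>c. \<forall>f\<in>topspace ?X. \<forall>g\<in>topspace ?X. T (\<lambda>x. c * f x + g x) = (\<lambda>x. c * T f x + T g x)) \<and>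
        homeomorphic_map ?X ?X T"
    proof (rule exI[of _ ?T], intro conjI ballI allI)
      show "?T p = sheffer_operator S p" if "p \<in> polynomials" for p by (rule eq[OF that])
      show "?T (\<lambda>x. t * f x + g x) = (\<lambda>x. t * ?T f x + ?T g x)"
        if "f \<in> topspace ?X" "g \<in> topspace ?X" for t f g by (rule lin[OF that])
      show "homeomorphic_map ?X ?X ?T" by (rule homeo)
    qed
  qed (rule polynomials_dense[OF \<alpha>(1)])+
qed

section \<open>Analyticity of the generating data\<close>

lemma tpair_tensor_power_series:
  "tpair n (\<phi> n) (tensor_power n \<xi>) = (\<Sum>m | size m = n. mcoeff (tensor_series \<phi>) m * monom_val \<xi> m)"
proof -
  have "tpair n (\<phi> n) (tensor_power n \<xi>) = (\<Sum>l | length l = n. \<phi> n l * monom_val \<xi> (mset l))"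
    unfolding tpair_def by (intro sum.cong) (auto simp: tensor_power_def monom_val_mset)
  also have "\<dots> = (\<Sum>m | size m = n. mcoeff (tensor_series \<phi>) m * monom_val \<xi> m)"
    unfolding sum_lists_by_mset tensor_series_def mcoeff_Abs sum_distrib_right
    by (intro sum.cong) auto
  finally show ?thesis .
qed

lemma tensor_power_eq_sum:
  "tensor_power n \<xi> l = (\<Sum>m | size m = n. monom_val \<xi> m * (if mset l = m then 1 else 0))"
proof -
  have "(\<Sum>m | size m = n. monom_val \<xi> m * (if mset l = m then 1 else 0)) =
      (\<Sum>m | size m = n. if m = mset l then monom_val \<xi> (mset l) else 0)"
    by (intro sum.cong) auto
  then show ?thesis by (simp add: tensor_power_def monom_val_mset)
qed

lemma linear_vec_sum:
  fixes L :: "('d::finite) tensor \<Rightarrow> complex ^ 'd"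
  assumes L: "linear_vec k L" and F: "finite F" and \<psi>: "\<And>x. x \<in> F \<Longrightarrow> \<psi> x \<in> sym_tensors k"
  shows "(\<lambda>l. \<Sum>x\<in>F. c x * \<psi> x l) \<in> sym_tensors k"
    and "L (\<lambda>l. \<Sum>x\<in>F. c x * \<psi> x l) = (\<Sum>x\<in>F. c x *s L (\<psi> x))"
proof -
  have zero: "(\<lambda>l :: 'd list. 0) \<in> sym_tensors k" by (simp add: sym_tensors_def)
  have lin: "L (\<lambda>l. t * \<phi> l + \<phi>' l) = t *s L \<phi> + L \<phi>'" if "\<phi> \<in> sym_tensors k" "\<phi>' \<in> sym_tensors k" for t \<phi> \<phi>'
    using L that unfolding linear_vec_def by blast
  have L0: "L (\<lambda>l. 0) = 0" using lin[OF zero zero, of 1] by simp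
  have "(\<lambda>l. \<Sum>x\<in>F. c x * \<psi> x l) \<in> sym_tensors k \<and>
      L (\<lambda>l. \<Sum>x\<in>F. c x * \<psi> x l) = (\<Sum>x\<in>F. c x *s L (\<psi> x))"
    using F \<psi>
  proof (induction F rule: finite_induct)
    case empty
    then show ?case using zero L0 by simp
  next
    case (insert x F)
    have x: "\<psi> x \<in> sym_tensors k" and IH: "(\<lambda>l. \<Sum>x\<in>F. c x * \<psi> x l) \<in> sym_tensors k"
      "L (\<lambda>l. \<Sum>x\<in>F. c x * \<psi> x l) = (\<Sum>x\<in>F. c x *s L (\<psi> x))" using insert by auto
    have eq: "(\<lambda>l. \<Sum>x\<in>insert x F. c x * \<psi> x l) = (\<lambda>l. c x * \<psi> x l + (\<Sum>x\<in>F. c x * \<psi> x l))"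
      using insert by simp
    have "(\<lambda>l. c x * \<psi> x l + (\<Sum>x\<in>F. c x * \<psi> x l)) \<in> sym_tensors k"
    proof -
      have "c x * \<psi> x l + (\<Sum>x\<in>F. c x * \<psi> x l) = 0" if "length l \<noteq> k" for l
        using x IH(1) that unfolding sym_tensors_def by auto
      moreover have "c x * \<psi> x l + (\<Sum>x\<in>F. c x * \<psi> x l) = c x * \<psi> x l' + (\<Sum>x\<in>F. c x * \<psi> x l')" if "mset l = mset l'" for l l'
      proof -
        have "\<psi> x l = \<psi> x l'" using x that unfolding sym_tensors_def by blast
        moreover have "(\<Sum>x\<in>F. c x * \<psi> x l) = (\<Sum>x\<in>F. c x * \<psi> x l')"
          using IH(1) that unfolding sym_tensors_def by blast
        ultimately show ?thesis by simp
      qed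
      ultimately show ?thesis unfolding sym_tensors_def by blast
    qed
    then show ?case unfolding eq using lin[OF x IH(1), of "c x"] IH(2) insert by simp
  qed
  then show "(\<lambda>l. \<Sum>x\<in>F. c x * \<psi> x l) \<in> sym_tensors k"
    "L (\<lambda>l. \<Sum>x\<in>F. c x * \<psi> x l) = (\<Sum>x\<in>F. c x *s L (\<psi> x))" by blast+
qed

text \<open>\<open>\<xi>\<^bsup>\<otimes>n\<^esup>\<close> is the sum over all \<open>m\<close> of degree \<open>n\<close> of \<open>\<xi>\<^sup>m\<close> times the indicator of the arrangements of \<open>m\<close>, the tensor by which
  the coefficients of \<open>vector_series\<close> are defined.\<close>

lemma linear_vec_tensor_power:
  fixes A :: "nat \<Rightarrow> ('d::finite) tensor \<Rightarrow> complex ^ 'd"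
  assumes "linear_vec n (A n)" "n \<ge> 1"
  shows "A n (tensor_power n \<xi>) $ i = (\<Sum>m | size m = n. mcoeff (vector_series A i) m * monom_val \<xi> m)"
proof -
  let ?e = "\<lambda>m l. if mset l = m then 1 else 0 :: complex"
  have sym: "?e m \<in> sym_tensors n" if "m \<in> {m. size m = n}" for m :: "'d multiset"
    using that by (auto simp: sym_tensors_def)
  have "tensor_power n \<xi> = (\<lambda>l. \<Sum>m | size m = n. monom_val \<xi> m * ?e m l)"
    by (rule ext) (rule tensor_power_eq_sum)
  then have "A n (tensor_power n \<xi>) = (\<Sum>m | size m = n. monom_val \<xi> m *s A n (?e m))"
    by (simp only: linear_vec_sum(2)[OF assms(1) finite_multisets_size_eq sym])
  then have "A n (tensor_power n \<xi>) $ i = (\<Sum>m | size m = n. monom_val \<xi> m * A n (?e m) $ i)"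
    by (simp add: sum_component)
  also have "\<dots> = (\<Sum>m | size m = n. mcoeff (vector_series A i) m * monom_val \<xi> m)"
  proof (rule sum.cong[OF refl])
    fix m :: "'d multiset" assume m: "m \<in> {m. size m = n}"
    with assms(2) have "m \<noteq> {#}" by auto
    then show "monom_val \<xi> m * A n (?e m) $ i = mcoeff (vector_series A i) m * monom_val \<xi> m"
      using m by (simp add: vector_series_def)
  qed
  finally show ?thesis .
qed

text \<open>Cauchy's inequality on the unit circle; convergence on a larger disc provides continuity up to the circle.\<close>

lemma power_series_coeff_bound:
  fixes p :: "nat \<Rightarrow> complex"
  assumes sums: "\<And>t. cmod t < 2 \<Longrightarrow> (\<lambda>n. p n * t ^ n) sums h t"
    and B: "\<And>t. cmod t = 1 \<Longrightarrow> cmod (h t) \<le> B"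
  shows "cmod (p n) \<le> B"
proof -
  have hol: "h holomorphic_on ball 0 2"
    by (rule power_series_holomorphic[of 0 2 p h]) (use sums in auto)
  define c where "c n = (deriv ^^ n) h 0 / fact n" for n
  have c: "(\<lambda>n. c n * t ^ n) sums h t" if "cmod t < 2" for t
    using holomorphic_power_series[OF hol, of t] that by (simp add: c_def)
  have radius: "fps_conv_radius (Abs_fps q) > 0" if "\<And>t. cmod t < 2 \<Longrightarrow> (\<lambda>n. q n * t ^ n) sums h t" for q
  proof -
    have "summable (\<lambda>n. q n * 1 ^ n)" by (rule sums_summable[OF that]) simp
    then have le: "ereal (norm (1::complex)) \<le> conv_radius q" by (rule conv_radius_geI)
    have "0 < conv_radius q" by (rule less_le_trans[OF _ le]) simp
    then show ?thesis by (simp add: fps_conv_radius_def)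
  qed
  have "Abs_fps c = Abs_fps p"
  proof (rule eval_fps_eqD[OF radius[OF c] radius[OF sums]])
    have "\<forall>\<^sub>F t in nhds 0. t \<in> ball (0::complex) 2"
      by (rule eventually_nhds_in_open) auto
    then show "\<forall>\<^sub>F t in nhds 0. eval_fps (Abs_fps c) t = eval_fps (Abs_fps p) t"
    proof (rule eventually_mono)
      fix t :: complex assume "t \<in> ball 0 2"
      then have t: "cmod t < 2" by simp
      show "eval_fps (Abs_fps c) t = eval_fps (Abs_fps p) t"
        using sums_unique[OF c[OF t]] sums_unique[OF sums[OF t]] by (simp add: eval_fps_def)
    qed
  qed
  from arg_cong[OF this, of "\<lambda>F. fps_nth F n"] have "c n = p n" by simp
  then have "(deriv ^^ n) h 0 / fact n = p n" by (simp add: c_def)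
  moreover have "cmod ((deriv ^^ n) h 0) \<le> fact n * B / 1 ^ n"
  proof (rule Cauchy_inequality)
    show "h holomorphic_on ball 0 1" by (rule holomorphic_on_subset[OF hol]) auto
    show "continuous_on (cball 0 1) h"
      by (rule continuous_on_subset[OF holomorphic_on_imp_continuous_on[OF hol]]) auto
    show "cmod (h x) \<le> B" if "cmod (0 - x) = 1" for x by (rule B) (use that in simp)
  qed simp
  ultimately have "cmod (p n) * fact n \<le> B * fact n"
    by (simp add: divide_eq_eq norm_mult mult.commute)
  then show ?thesis by (rule mult_right_le_imp_le) simp
qed

text \<open>Pointwise convergence of the homogeneous parts to a continuous function near 0 suffices: a one-variable
  Cauchy estimate on each complex line through 0 bounds the homogeneous parts uniformly on a small torus, and the
  estimate on the torus bounds their coefficients.\<close>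

lemma analytic_seriesI:
  fixes F :: "('d::finite) mps"
  assumes U: "open U" "0 \<in> U" and cont: "continuous_on U h"
    and sums: "\<And>\<xi>. \<xi> \<in> U \<Longrightarrow> (\<lambda>n. \<Sum>m | size m = n. mcoeff F m * monom_val \<xi> m) sums h \<xi>"
  shows "analytic_series F"
proof -
  let ?d = "real CARD('d)"
  obtain e where e: "e > 0" "cball 0 e \<subseteq> U" using U open_contains_cball by blast
  have "compact (h ` cball 0 e)"
    by (rule compact_continuous_image[OF continuous_on_subset[OF cont e(2)]]) simp
  then obtain B where B: "\<And>y. y \<in> h ` cball 0 e \<Longrightarrow> norm y \<le> B"
    using compact_imp_bounded bounded_iff by metis
  \<comment> \<open>The torus of radius \<open>r\<close> lies in the ball of radius \<open>e / 2\<close>, which leaves room for \<open>t \<xi>\<close> with \<open>\<bar>t\<bar> < 2\<close>.\<close>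
  define r where "r = e / (2 * ?d)"
  have r: "r > 0" using e by (simp add: r_def)
  have coeff: "cmod (mcoeff F m) * r ^ size m \<le> B" for m
  proof -
    let ?n = "size m"
    define a where "a m' = (if size m' = ?n then mcoeff F m' else 0)" for m' :: "'d multiset"
    have fin: "(\<lambda>m'. cmod (a m') * r ^ size m') summable_on UNIV"
      by (rule summable_on_cong_neutral[THEN iffD2, OF _ _ _ summable_on_finite[OF finite_multisets_size_eq[of ?n]]])
         (auto simp: a_def)
    have "cmod (a m) * r ^ size m \<le> B"
    proof (rule multi_cauchy_estimate[OF r fin])
      fix \<xi> :: "complex ^ 'd" assume \<xi>: "\<And>i. cmod (\<xi> $ i) = r"
      have norm: "norm \<xi> \<le> e / 2"
        using norm_le_card_times[of \<xi> r] \<xi> by (simp add: r_def)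
      define p where "p n = (\<Sum>m | size m = n. mcoeff F m * monom_val \<xi> m)" for n
      have scale: "monom_val (t *s \<xi>) m = t ^ size m * monom_val \<xi> m" for t m
        by (induction m) (simp_all add: mult_ac)
      have in_ball: "t *s \<xi> \<in> cball 0 e" if "cmod t < 2" for t
      proof -
        have "norm (t *s \<xi>) = cmod t * norm \<xi>"
          by (simp add: norm_vec_def norm_mult L2_set_right_distrib)
        also have "\<dots> \<le> 2 * (e / 2)" using that norm by (intro mult_mono) auto
        finally show ?thesis by simp
      qed
      have "cmod (p ?n) \<le> B"
      proof (rule power_series_coeff_bound[of p "\<lambda>t. h (t *s \<xi>)"])
        fix t :: complex
        show "(\<lambda>n. p n * t ^ n) sums h (t *s \<xi>)" if "cmod t < 2"
        proof -
          have "(\<Sum>m | size m = n. mcoeff F m * monom_val (t *s \<xi>) m) = p n * t ^ n" for n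
            unfolding p_def sum_distrib_right by (rule sum.cong) (auto simp: scale mult_ac)
          then show ?thesis using sums[of "t *s \<xi>"] in_ball[OF that] e(2) by auto
        qed
        show "cmod (h (t *s \<xi>)) \<le> B" if "cmod t = 1"
          by (rule B) (use in_ball[of t] that in auto)
      qed
      also have "p ?n = power_series a \<xi>"
        by (subst finite_support_entire_coeffs(2)[OF finite_multisets_size_eq[of ?n]]) (auto simp: a_def p_def)
      finally show "cmod (power_series a \<xi>) \<le> B" .
    qed
    then show ?thesis by (simp add: a_def)
  qed
  have "0 \<le> B" by (rule order_trans[OF _ coeff[of "{#}"]]) simp
  moreover have "cmod (mcoeff F m) \<le> B * (1 / r) ^ size m" for m
    using coeff[of m] r by (simp add: field_simps)
  ultimately show ?thesis unfolding analytic_series_def using r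
    by (intro exI[of _ B] exI[of _ "1 / r"]) simp
qed

lemma holomorphic_Cd_continuous_on:
  assumes "holomorphic_Cd f U"
  shows "continuous_on U f"
proof (rule continuous_at_imp_continuous_on, intro ballI)
  fix x assume "x \<in> U"
  then obtain D where "(f has_derivative D) (at x)"
    using assms unfolding holomorphic_Cd_def by blast
  then show "isCont f x" by (rule has_derivative_continuous)
qed

lemma holomorphic_near_zero_analytic:
  fixes A :: "nat \<Rightarrow> ('d::finite) tensor \<Rightarrow> complex ^ 'd"
  assumes lin: "\<forall>k\<ge>1. linear_vec k (A k)" and hol: "holomorphic_near_zero A \<rho>"
  shows "analytic_series (vector_series A i)" and "analytic_series (tensor_series \<rho>)"
proof -
  obtain U a r where ex: "open U \<and> 0 \<in> U \<and>
     (\<forall>\<xi>\<in>U. (\<lambda>k. A (Suc k) (tensor_power (Suc k) \<xi>)) sums a \<xi>) \<and>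
     (\<forall>\<xi>\<in>U. (\<lambda>n. tpair n (\<rho> n) (tensor_power n \<xi>)) sums r \<xi>) \<and>
     (\<forall>i. holomorphic_Cd (\<lambda>\<xi>. a \<xi> $ i) U) \<and> holomorphic_Cd r U"
    using hol unfolding holomorphic_near_zero_def by (elim exE)
  then have U: "open U" "0 \<in> U"
    and a: "\<And>\<xi>. \<xi> \<in> U \<Longrightarrow> (\<lambda>k. A (Suc k) (tensor_power (Suc k) \<xi>)) sums a \<xi>"
    and r: "\<And>\<xi>. \<xi> \<in> U \<Longrightarrow> (\<lambda>n. tpair n (\<rho> n) (tensor_power n \<xi>)) sums r \<xi>"
    and hol_a: "\<And>i. holomorphic_Cd (\<lambda>\<xi>. a \<xi> $ i) U" and hol_r: "holomorphic_Cd r U"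
    by simp_all
  show "analytic_series (tensor_series \<rho>)"
    by (rule analytic_seriesI[OF U holomorphic_Cd_continuous_on[OF hol_r]])
       (use r in \<open>simp add: tpair_tensor_power_series\<close>)
  show "analytic_series (vector_series A i)"
  proof (rule analytic_seriesI[OF U holomorphic_Cd_continuous_on[OF hol_a[of i]]])
    fix \<xi> assume \<xi>: "\<xi> \<in> U"
    let ?P = "\<lambda>n. \<Sum>m | size m = n. mcoeff (vector_series A i) m * monom_val \<xi> m"
    have P0: "?P 0 = 0" by (simp add: vector_series_def)
    have "(\<lambda>k. A (Suc k) (tensor_power (Suc k) \<xi>) $ i) sums (a \<xi> $ i)"
      using a[OF \<xi>] by (rule bounded_linear.sums[OF bounded_linear_vec_nth])
    moreover have "A (Suc k) (tensor_power (Suc k) \<xi>) $ i = ?P (Suc k)" for k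
      by (rule linear_vec_tensor_power) (use lin in auto)
    ultimately have "(\<lambda>k. ?P (Suc k)) sums (a \<xi> $ i - ?P 0)" using P0 by (simp only: diff_zero)
    then show "?P sums (a \<xi> $ i)" by (subst (asm) sums_Suc_iff) simp
  qed
qed


section \<open>Sheffer and Appell sequences\<close>

text \<open>Here \<open>\<gamma> = 1\<close>: the majorants of \<open>A\<close> and \<open>B\<close> are at most 1 on a small polydisc, so all their powers are bounded there
  by the same constant.\<close>

lemma sheffer_extends_analytic:
  fixes S :: "nat \<Rightarrow> complex ^ ('d::finite) \<Rightarrow> 'd tensor"
  assumes S: "sheffer_sequence S A \<rho>" and hol: "holomorphic_near_zero A \<rho>" and \<alpha>: "\<alpha> \<in> {0..1}"
  shows "extends_to_linear_self_homeomorphism (Emin_topology \<alpha>) polynomials (sheffer_operator S)"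
proof -
  let ?A = "vector_series A" and ?\<rho> = "tensor_series \<rho>" and ?\<sigma> = "inverse (comp_series \<rho> A)"
  have lin: "\<forall>k\<ge>1. linear_vec k (A k)" and \<rho>0: "\<rho> 0 [] = 1"
    using S by (simp_all add: sheffer_sequence_def)
  have A: "tangent_to_id ?A"
    using S unfolding sheffer_sequence_def by (intro tangent_to_id_vector_series) blast
  have an: "\<And>i. analytic_series (?A i)" "analytic_series ?\<rho>"
    by (rule holomorphic_near_zero_analytic[OF lin hol])+
  have \<sigma>: "mps_subst ?A ?\<rho> * ?\<sigma> = 1"
    unfolding comp_series_eq_subst[symmetric] by (rule mps_mult_inverse) (rule comp_const[of \<rho>, OF \<rho>0])
  have \<rho>_const: "mcoeff ?\<rho> {#} = 1" using \<rho>0 by (simp add: tensor_series_def)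
  obtain B where B: "tangent_to_id B" "\<And>i. mps_subst ?A (B i) = mps_var i" "\<And>i. mps_subst B (?A i) = mps_var i"
    using exists_compositional_inverse[OF A] by blast
  have "\<forall>\<^sub>F r in at_right 0. \<forall>i n. trunc_norm n r (?A i) \<le> 1"
    by (intro eventually_all_finite analytic_series_small an tangent_to_id_const[OF A]) simp
  then have "\<forall>\<^sub>F r in at_right 0. \<forall>n i. trunc_norm n r (?A i) \<le> 1"
    by (rule eventually_mono) blast
  then have bound: "sheffer_bound 1 ?A ?\<sigma>"
    by (rule sheffer_bound_analytic[OF _ reciprocal_of_subst_bound[OF A an \<rho>_const \<sigma>]]) simp
  obtain K where K: "K > 0" "\<forall>\<^sub>F r in at_right 0. \<forall>n. trunc_norm n r ?\<rho> \<le> K"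
    using analytic_series_bounded[OF an(2)] by blast
  have "\<forall>\<^sub>F r in at_right (0::real). r < 1/2"
    unfolding eventually_at_right_field by (intro exI[of _ "1/2"]) auto
  with compositional_inverse_bound[OF A an(1) B(1,3)]
  have "\<forall>\<^sub>F r in at_right 0. \<forall>n i. trunc_norm n r (B i) \<le> 1"
  proof eventually_elim
    case (elim r)
    show ?case
    proof (intro allI)
      fix n i
      have "trunc_norm n r (B i) \<le> 2 * r" using elim(1) by simp
      with elim(2) show "trunc_norm n r (B i) \<le> 1" by linarith
    qed
  qed
  then have bound': "sheffer_bound 1 B ?\<rho>"
    by (rule sheffer_bound_analytic[OF _ K(2,1)])
  show ?thesis
    by (rule sheffer_operator_extends[OF S B zero_less_one bound bound']) (use \<alpha> in auto)
qed

text \<open>Each component of a tensor is bounded by its norm, and a coefficient collects at most \<open>d ^ size m\<close>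
  components.\<close>

lemma mcoeff_tensor_series_le:
  fixes \<theta> :: "nat \<Rightarrow> ('d::finite) tensor"
  assumes "0 < C" "tnorm (size m) (\<theta> (size m)) \<le> C ^ size m * fact (size m) powr \<delta>"
  shows "cmod (mcoeff (tensor_series \<theta>) m) \<le> (real CARD('d) * C) ^ size m * fact (size m) powr \<delta>"
proof -
  let ?n = "size m"
  have le: "cmod (\<theta> ?n l) \<le> tnorm ?n (\<theta> ?n)" if "length l = ?n" for l
  proof -
    have "(cmod (\<theta> ?n l))\<^sup>2 \<le> (\<Sum>l | length l = ?n. (cmod (\<theta> ?n l))\<^sup>2)"
      by (rule member_le_sum[where f = "\<lambda>l. (cmod (\<theta> ?n l))\<^sup>2"]) (use that in auto)
    then show ?thesis unfolding tnorm_def by (rule real_le_rsqrt)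
  qed
  have "cmod (mcoeff (tensor_series \<theta>) m) \<le> (\<Sum>l | mset l = m. tnorm ?n (\<theta> ?n))"
    unfolding tensor_series_def mcoeff_Abs by (rule sum_norm_le) (use le in auto)
  also have "\<dots> = arrangements m * tnorm ?n (\<theta> ?n)" by (simp add: arrangements_def)
  also have "\<dots> \<le> real CARD('d) ^ ?n * (C ^ ?n * fact ?n powr \<delta>)"
  proof (rule mult_mono)
    show "real (arrangements m) \<le> real CARD('d) ^ ?n"
      using arrangements_le[of m] by (metis of_nat_le_iff of_nat_power)
  qed (use assms in \<open>auto simp: tnorm_def intro!: sum_nonneg\<close>)
  finally show ?thesis by (simp add: power_mult_distrib mult.assoc)
qed

text \<open>Here \<open>A\<close> and \<open>B\<close> are the identity and \<open>\<gamma> = 1 / \<beta>\<close>. The growth assumptions leave out degree 0, where both coefficients are 1.\<close>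

lemma appell_extends:
  fixes S :: "nat \<Rightarrow> complex ^ ('d::finite) \<Rightarrow> 'd tensor" and C \<beta> :: real
  assumes S: "appell_sequence S \<rho>" and inv: "1 / tensor_series \<rho> = tensor_series \<theta>"
    and \<beta>: "1 < \<beta>" and C: "1 \<le> C"
    and \<theta>: "\<forall>n\<ge>1. tnorm n (\<theta> n) \<le> C ^ n * fact n powr (1 / \<beta> - 1)"
    and \<rho>: "\<forall>n\<ge>1. tnorm n (\<rho> n) \<le> C ^ n * fact n powr (1 / \<beta> - 1)"
    and \<alpha>: "\<alpha> \<in> {0..\<beta>}"
  shows "extends_to_linear_self_homeomorphism (Emin_topology \<alpha>) polynomials (sheffer_operator S)"
proof -
  have S': "sheffer_sequence S identity_coeffs \<rho>" using S by (simp add: appell_sequence_def)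
  then have \<rho>0: "\<rho> 0 [] = 1" by (simp add: sheffer_sequence_def)
  have A: "vector_series identity_coeffs = mps_var"
    by (rule ext, rule mps_eqI) (simp add: vector_series_identity mcoeff_var)
  have \<rho>_const: "mcoeff (tensor_series \<rho>) {#} = 1" using \<rho>0 by (simp add: tensor_series_def)
  have \<sigma>: "inverse (comp_series \<rho> identity_coeffs) = tensor_series \<theta>"
    using inv by (simp add: comp_identity divide_mps_def)
  have "tensor_series \<rho> * tensor_series \<theta> = 1"
    using mps_mult_inverse[OF \<rho>_const] \<sigma> by (simp add: comp_identity)
  then have "mcoeff (tensor_series \<rho> * tensor_series \<theta>) {#} = 1" by (simp add: mcoeff_one)
  moreover have "{(a, b). a + b = ({#} :: 'd multiset)} = {({#}, {#})}" by auto
  ultimately have \<theta>_const: "mcoeff (tensor_series \<theta>) {#} = 1" by (simp add: mcoeff_times \<rho>_const)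
  have bound: "sheffer_bound (1 / \<beta>) mps_var (tensor_series \<phi>)"
    if "mcoeff (tensor_series \<phi>) {#} = 1" "\<forall>n\<ge>1. tnorm n (\<phi> n) \<le> C ^ n * fact n powr (1 / \<beta> - 1)"
    for \<phi> :: "nat \<Rightarrow> 'd tensor"
  proof (rule sheffer_bound_var)
    show "0 < real CARD('d) * C" using C by simp
    show "cmod (mcoeff (tensor_series \<phi>) m) \<le> (real CARD('d) * C) ^ size m * fact (size m) powr (1 / \<beta> - 1)" for m
    proof (cases "m = {#}")
      case True
      then show ?thesis using that(1) by simp
    next
      case False
      then have "size m \<ge> 1" by (simp add: Suc_le_eq nonempty_has_size)
      then show ?thesis using that(2) C by (intro mcoeff_tensor_series_le) auto
    qed
  qed
  show ?thesis
  proof (rule sheffer_operator_extends[OF S', where B = mps_var and \<gamma> = "1 / \<beta>"])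
    show "sheffer_bound (1 / \<beta>) (vector_series identity_coeffs) (inverse (comp_series \<rho> identity_coeffs))"
      unfolding A \<sigma> by (rule bound[OF \<theta>_const \<theta>])
    show "sheffer_bound (1 / \<beta>) mps_var (tensor_series \<rho>)" by (rule bound[OF \<rho>_const \<rho>])
  qed (use \<alpha> \<beta> in \<open>auto simp: A mps_subst_id tangent_to_id_var\<close>)
qed

theorem corollary3p12:
  shows
    "(\<forall>(S :: nat \<Rightarrow> complex ^ ('d::finite) \<Rightarrow> 'd tensor) A \<rho>.
        sheffer_sequence S A \<rho> \<and> holomorphic_near_zero A \<rho> \<longrightarrow>
        (\<forall>\<alpha>\<in>{0..1}. extends_to_linear_self_homeomorphism
            (Emin_topology \<alpha>) polynomials (sheffer_operator S))) \<and>
     (\<forall>(S :: nat \<Rightarrow> complex ^ 'd \<Rightarrow> 'd tensor) \<rho> \<theta> (\<beta>::real) (C::real).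
        appell_sequence S \<rho> \<and>
        (\<forall>n. \<theta> n \<in> sym_tensors n) \<and> 1 / tensor_series \<rho> = tensor_series \<theta> \<and>
        1 < \<beta> \<and> 1 \<le> C \<and>
        (\<forall>n\<ge>1. tnorm n (\<theta> n) \<le> C ^ n * fact n powr (1 / \<beta> - 1)) \<and>
        (\<forall>n\<ge>1. tnorm n (\<rho> n) \<le> C ^ n * fact n powr (1 / \<beta> - 1)) \<longrightarrow>
        (\<forall>\<alpha>\<in>{0..\<beta>}. extends_to_linear_self_homeomorphism
            (Emin_topology \<alpha>) polynomials (sheffer_operator S)))"
proof (intro conjI allI impI ballI)
  fix S :: "nat \<Rightarrow> complex ^ 'd \<Rightarrow> 'd tensor" and A \<rho> and \<alpha> :: real
  assume "sheffer_sequence S A \<rho> \<and> holomorphic_near_zero A \<rho>" "\<alpha> \<in> {0..1}"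
  then show "extends_to_linear_self_homeomorphism (Emin_topology \<alpha>) polynomials (sheffer_operator S)"
    using sheffer_extends_analytic by blast
next
  fix S :: "nat \<Rightarrow> complex ^ 'd \<Rightarrow> 'd tensor" and \<rho> \<theta> and \<beta> C \<alpha> :: real
  assume *: "appell_sequence S \<rho> \<and>
        (\<forall>n. \<theta> n \<in> sym_tensors n) \<and> 1 / tensor_series \<rho> = tensor_series \<theta> \<and>
        1 < \<beta> \<and> 1 \<le> C \<and>
        (\<forall>n\<ge>1. tnorm n (\<theta> n) \<le> C ^ n * fact n powr (1 / \<beta> - 1)) \<and>
        (\<forall>n\<ge>1. tnorm n (\<rho> n) \<le> C ^ n * fact n powr (1 / \<beta> - 1))"
    and \<alpha>: "\<alpha> \<in> {0..\<beta>}"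
  from * show "extends_to_linear_self_homeomorphism (Emin_topology \<alpha>) polynomials (sheffer_operator S)"
    by (elim conjE) (rule appell_extends[OF _ _ _ _ _ _ \<alpha>])
qed

end
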